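(* The word problems of the following groups are hard for $\mathsf{ALOGTIME}$ (under $\mathsf{DLOGTIME}$-reductions): (1) each of the three Thompson groups $F$, $T$ and $V$; (2) every finitely generated weakly branched self-similar group that has a finitely generated branching subgroup.
   Context: Word problem. A finite standard generating set of a finitely generated group $G$ is $\Sigma=S\cup S^{-1}\cup\{1\}$, where $S$ is a finite set together with a surjective homomorphism from the free group on $S$ onto $G$; words over $\Sigma$ are evaluated in $G$, the letter $1$ evaluating to the identity. The word problem of $G$ is the language $\{w\in\Sigma^* : w=_G 1\}$. When binary strings are required, letters of $\Sigma$ are encoded by distinct binary words of one common length. Complexity. Turing machines have random access to the input via an index tape: in a query state, the next transition depends on the input symbol at the position written in binary on the index tape. $\mathsf{DLOGTIME}$ (resp. $\mathsf{ALOGTIME}$) is the class of languages accepted by deterministic (resp. alternating) machines in logarithmic time. A $\mathsf{DLOGTIME}$-reduction is a many-one reduction by a function $f$ such that $|f(x)|\le p(|x|)$ for some polynomial $p$ and the set of triples $(x,a,i)$ such that the $i$-th letter of $f(x)$ is $a$ ($i$ in binary) is in $\mathsf{DLOGTIME}$. Thompson's groups. $F$ is the group of piecewise affine homeomorphisms of $[0,1]$ with finitely many breakpoints, all dyadic, and slopes powers of $2$ (it is generated by two elements $x_0,x_1$ and is orientation preserving). $T$ is the analogous group of orientation-preserving piecewise affine homeomorphisms of the circle $\mathbb{R}/\mathbb{Z}$ with dyadic breakpoints, slopes powers of $2$, mapping dyadic rationals to dyadic rationals. $V$ is the group of homeomorphisms of the Cantor set $\{0,1\}^{\omega}$ of the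 form $u_iw\mapsto v_iw$ ($1\le i\le n$), where $\{u_1,\dots,u_n\}$ and $\{v_1,\dots,v_n\}$ are finite complete prefix codes. Self-similar groups. Let $X$ be a finite set and $W$ the automorphism group of the regular rooted tree $X^*$ (with edges between $v$ and $vx$), acting on the right. For $g\in W$ let $\pi\in\mathrm{Sym}(X)$ be the restriction of $g$ to $X$, and for $x\in X$ let $g@x\in W$ be defined by $(xv)^g=x^{\pi}v^{g@x}$. The map $\phi:W\to W^X\rtimes \mathrm{Sym}(X)$, $g\mapsto (x\mapsto g@x)\,\pi$, is an isomorphism. A subgroup $G\le W$ is self-similar if $g@x\in G$ for all $g\in G$, $x\in X$. A self-similar group $G$ is weakly branched if there is a non-trivial subgroup $K\le G$ with $\phi(K)\ge K^X$, i.e. for all $k\in K$, $x\in X$ the automorphism acting as $k$ on the subtree $xX^*$ (that is $xv\mapsto xv^k$) and trivially elsewhere lies in $K$; such a $K$ is called a branching subgroup. No transitivity on levels is required. *)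

theory Defs
  imports
    "HOL-Analysis.Analysis"
    "HOL-Algebra.Generated_Groups"
    "HOL-Computational_Algebra.Polynomial"
    "HOL-Library.Landau_Symbols"
    "HOL-Library.Stream"
    "HOL-Library.Sublist"
begin

section \<open>Alternating random access Turing machines\<close>

datatype symbol = Blank | Bit bool | Mark nat

datatype direction = Left | Stay | Right

text \<open>What a transition may depend on besides the state and the scanned tape symbols: in a query
  state, the input symbol at the indexed position; in any other state, nothing.\<close>

datatype observation = No_Query | Outside | Letter bool

text \<open>Tape 0 is the index tape. States and marks are natural numbers, but by finiteness of
  the transition table only finitely many of them matter.\<close>

record machine =
  work_tapes :: nat
  initial_state :: nat
  accepting_states :: "nat set"
  universal_states :: "nat set"
  query_states :: "nat set"
  transitions :: "((nat \<times> observation \<times> symbol list) \<times> (nat \<times> (symbol \<times> direction) list)) set"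

definition alternating_machine :: "machine \<Rightarrow> bool" where
  "alternating_machine M \<longleftrightarrow> finite (transitions M) \<and>
     (\<forall>((q, ob, rs), (q', as)) \<in> transitions M.
        q \<notin> accepting_states M \<and>
        length rs = Suc (work_tapes M) \<and> length as = Suc (work_tapes M))"

definition deterministic_machine :: "machine \<Rightarrow> bool" where
  "deterministic_machine M \<longleftrightarrow> alternating_machine M \<and> single_valued (transitions M)"

text \<open>A tape is infinite to the right; the second component is the head position.\<close>

type_synonym tape = "(nat \<Rightarrow> symbol) \<times> nat"
type_synonym configuration = "nat \<times> tape list"

fun scanned :: "tape \<Rightarrow> symbol" where
  "scanned (t, h) = t h"

fun act :: "symbol \<times> direction \<Rightarrow> tape \<Rightarrow> tape" where
  "act (s, d) (t, h) =
     (t(h := s), case d of Left \<Rightarrow> h - 1 | Stay \<Rightarrow> h | Right \<Rightarrow> Suc h)"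

definition initial_configuration :: "machine \<Rightarrow> configuration" where
  "initial_configuration M =
     (initial_state M, replicate (Suc (work_tapes M)) (\<lambda>_. Blank, 0))"

text \<open>The index is the number whose binary digits, most significant first, are the bits from
  cell 0 up to the first cell that does not hold a bit. Leading zeros are allowed here, and the
  empty string of digits denotes 0. Input positions are counted from 0.\<close>

definition index_value :: "tape \<Rightarrow> nat" where
  "index_value tp =
     (let n = (LEAST n. \<forall>b. fst tp n \<noteq> Bit b)
      in horner_sum of_bool 2 (rev (map (\<lambda>j. fst tp j = Bit True) [0..<n])))"

definition observe :: "machine \<Rightarrow> bool list \<Rightarrow> configuration \<Rightarrow> observation" where
  "observe M x c =
     (if fst c \<in> query_states M
      then (let p = index_value (hd (snd c)) in if p < length x then Letter (x ! p) else Outside)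
      else No_Query)"

definition successor :: "machine \<Rightarrow> bool list \<Rightarrow> configuration \<Rightarrow> configuration \<Rightarrow> bool" where
  "successor M x c c' \<longleftrightarrow>
     (\<exists>as. ((fst c, observe M x c, map scanned (snd c)), (fst c', as)) \<in> transitions M \<and>
           snd c' = map2 act as (snd c))"

text \<open>A halting configuration accepts only if its state is an accepting one, whether or not it is
  universal.\<close>

inductive accepting :: "machine \<Rightarrow> bool list \<Rightarrow> configuration \<Rightarrow> bool"
  for M :: machine and x :: "bool list" where
  final: "fst c \<in> accepting_states M \<Longrightarrow> accepting M x c"
| existential: "fst c \<notin> universal_states M \<Longrightarrow> successor M x c c' \<Longrightarrow> accepting M x c'
    \<Longrightarrow> accepting M x c"
| universal: "fst c \<in> universal_states M \<Longrightarrow> successor M x c c'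
    \<Longrightarrow> (\<And>d. successor M x c d \<Longrightarrow> accepting M x d) \<Longrightarrow> accepting M x c"

primrec halts_within :: "machine \<Rightarrow> bool list \<Rightarrow> nat \<Rightarrow> configuration \<Rightarrow> bool" where
  "halts_within M x 0 c \<longleftrightarrow> (\<nexists>c'. successor M x c c')"
| "halts_within M x (Suc t) c \<longleftrightarrow> (\<forall>c'. successor M x c c' \<longrightarrow> halts_within M x t c')"

definition accepted_language :: "machine \<Rightarrow> bool list set" where
  "accepted_language M = {x. accepting M x (initial_configuration M)}"

definition logarithmic_time :: "machine \<Rightarrow> bool" where
  "logarithmic_time M \<longleftrightarrow>
     (\<exists>t :: nat \<Rightarrow> nat. (\<lambda>n. real (t n)) \<in> O(\<lambda>n. ln (real n)) \<and>
        (\<forall>x. halts_within M x (t (length x)) (initial_configuration M)))"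

definition ALOGTIME :: "bool list set set" where
  "ALOGTIME = {accepted_language M | M. alternating_machine M \<and> logarithmic_time M}"

definition DLOGTIME :: "bool list set set" where
  "DLOGTIME = {accepted_language M | M. deterministic_machine M \<and> logarithmic_time M}"


section \<open>Reductions and hardness\<close>

fun binary :: "nat \<Rightarrow> bool list" where
  "binary n = (if n < 2 then [n = 1] else binary (n div 2) @ [odd n])"

declare binary.simps [simp del]

text \<open>The triple \<open>(x, a, i)\<close> as a bit string. The digits of \<open>i\<close> are each preceded by
  \<open>True\<close> and closed off by \<open>False\<close>. The self-delimiting parts come first so that every
  bit string may follow as \<open>x\<close>: otherwise a machine running in logarithmic time could not
  check that its input is a well-formed triple.\<close>

definition triple :: "bool list \<Rightarrow> bool \<Rightarrow> nat \<Rightarrow> bool list" where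
  "triple x a i = concat (map (\<lambda>b. [True, b]) (binary i)) @ [False, a] @ x"

definition DLOGTIME_computable :: "(bool list \<Rightarrow> bool list) \<Rightarrow> bool" where
  "DLOGTIME_computable f \<longleftrightarrow>
     (\<exists>p :: nat poly. \<forall>x. length (f x) \<le> poly p (length x)) \<and>
     {triple x a i | x a i. i < length (f x) \<and> f x ! i = a} \<in> DLOGTIME"

definition DLOGTIME_reducible :: "bool list set \<Rightarrow> bool list set \<Rightarrow> bool" where
  "DLOGTIME_reducible L P \<longleftrightarrow>
     (\<exists>f. DLOGTIME_computable f \<and> (\<forall>x. x \<in> L \<longleftrightarrow> f x \<in> P))"

definition ALOGTIME_hard :: "bool list set \<Rightarrow> bool" where
  "ALOGTIME_hard P \<longleftrightarrow> (\<forall>L \<in> ALOGTIME. DLOGTIME_reducible L P)"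

definition block_code :: "('a \<Rightarrow> bool list) \<Rightarrow> 'a set \<Rightarrow> bool" where
  "block_code code A \<longleftrightarrow> inj_on code A \<and> (\<exists>n. \<forall>a\<in>A. length (code a) = n)"

definition encode_language :: "('a \<Rightarrow> bool list) \<Rightarrow> 'a list set \<Rightarrow> bool list set" where
  "encode_language code L = (\<lambda>w. concat (map code w)) ` L"


section \<open>Word problems\<close>

text \<open>A homomorphism from the free group on \<open>S\<close> to \<open>G\<close> is given by its values
  \<open>\<sigma>\<close> on \<open>S\<close>; it is surjective iff these values generate \<open>G\<close>.\<close>

definition generating_map :: "('g, 'm) monoid_scheme \<Rightarrow> 's set \<Rightarrow> ('s \<Rightarrow> 'g) \<Rightarrow> bool" where
  "generating_map G S \<sigma> \<longleftrightarrow>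
     finite S \<and> \<sigma> \<in> S \<rightarrow> carrier G \<and> generate G (\<sigma> ` S) = carrier G"

datatype 's letter = Identity | Generator 's | Inverse 's

definition letters :: "'s set \<Rightarrow> 's letter set" where
  "letters S = Generator ` S \<union> Inverse ` S \<union> {Identity}"

fun letter_value :: "('g, 'm) monoid_scheme \<Rightarrow> ('s \<Rightarrow> 'g) \<Rightarrow> 's letter \<Rightarrow> 'g" where
  "letter_value G \<sigma> Identity = \<one>\<^bsub>G\<^esub>"
| "letter_value G \<sigma> (Generator s) = \<sigma> s"
| "letter_value G \<sigma> (Inverse s) = inv\<^bsub>G\<^esub> (\<sigma> s)"

definition word_value :: "('g, 'm) monoid_scheme \<Rightarrow> ('s \<Rightarrow> 'g) \<Rightarrow> 's letter list \<Rightarrow> 'g" where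
  "word_value G \<sigma> w = foldr (\<lambda>a g. letter_value G \<sigma> a \<otimes>\<^bsub>G\<^esub> g) w \<one>\<^bsub>G\<^esub>"

definition word_problem ::
    "('g, 'm) monoid_scheme \<Rightarrow> 's set \<Rightarrow> ('s \<Rightarrow> 'g) \<Rightarrow> 's letter list set" where
  "word_problem G S \<sigma> = {w \<in> lists (letters S). word_value G \<sigma> w = \<one>\<^bsub>G\<^esub>}"


section \<open>Thompson's groups\<close>

text \<open>Groups act on the right: \<open>g \<otimes> h\<close> is \<open>g\<close> followed by \<open>h\<close>.\<close>

definition transformation_group :: "('a \<Rightarrow> 'a) set \<Rightarrow> ('a \<Rightarrow> 'a) monoid" where
  "transformation_group C = \<lparr>carrier = C, mult = (\<lambda>g h. h \<circ> g), one = id\<rparr>"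

definition dyadics :: "real set" where
  "dyadics = {of_int m / 2 ^ n | (m :: int) (n :: nat). True}"

text \<open>\<open>B\<close> is a finite set of dyadic points containing all breakpoints.\<close>

definition dyadic_piecewise_affine_on :: "real set \<Rightarrow> (real \<Rightarrow> real) \<Rightarrow> bool" where
  "dyadic_piecewise_affine_on D f \<longleftrightarrow>
     (\<exists>B. finite B \<and> B \<subseteq> dyadics \<and>
        (\<forall>a b. {a..b} \<subseteq> D \<and> {a<..<b} \<inter> B = {} \<longrightarrow>
           (\<exists>(k :: int) c. \<forall>x\<in>{a..b}. f x = 2 powi k * x + c)))"

text \<open>Homeomorphisms of the unit interval are extended by the identity to the real line.\<close>

definition Thompson_F :: "(real \<Rightarrow> real) monoid" where
  "Thompson_F = transformation_group
     {f. (\<exists>f'. homeomorphism {0..1} {0..1} f f') \<and> dyadic_piecewise_affine_on {0..1} f \<and>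
         (\<forall>x. x \<notin> {0..1} \<longrightarrow> f x = x)}"

quotient_type circle = real / "\<lambda>x y :: real. x - y \<in> \<int>"
proof (rule equivpI)
  show "reflp (\<lambda>x y :: real. x - y \<in> \<int>)"
    by (simp add: reflp_def)
  show "symp (\<lambda>x y :: real. x - y \<in> \<int>)"
    by (metis (no_types, lifting) Ints_minus minus_diff_eq sympI)
  show "transp (\<lambda>x y :: real. x - y \<in> \<int>)"
  proof (rule transpI)
    fix x y z :: real
    assume "x - y \<in> \<int>" "y - z \<in> \<int>"
    then have "(x - y) + (y - z) \<in> \<int>" by (rule Ints_add)
    then show "x - z \<in> \<int>" by simp
  qed
qed

text \<open>\<open>abs_circle\<close> is the projection of the real line onto the circle, which carries the
  quotient topology.\<close>

instantiation circle :: topological_space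
begin

definition open_circle :: "circle set \<Rightarrow> bool" where
  "open_circle U \<longleftrightarrow> open (abs_circle -` U)"

instance
proof
  show "open (UNIV :: circle set)"
    by (simp add: open_circle_def)
  show "open (U \<inter> V)" if "open U" "open V" for U V :: "circle set"
    using that by (simp add: open_circle_def vimage_Int open_Int)
  show "open (\<Union>K)" if "\<forall>U\<in>K. open U" for K :: "circle set set"
    using that by (auto simp: open_circle_def vimage_Union intro!: open_UN)
qed

end

text \<open>A homeomorphism of the circle preserves the orientation iff it has an increasing lift to the
  real line. The differential and dyadic conditions are read off from the lift \<open>h\<close>.\<close>

definition Thompson_T :: "(circle \<Rightarrow> circle) monoid" where
  "Thompson_T = transformation_group
     {g. (\<exists>g'. homeomorphism UNIV UNIV g g') \<and>
         (\<exists>h :: real \<Rightarrow> real.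
            continuous_on UNIV h \<and> strict_mono h \<and> (\<forall>x. h (x + 1) = h x + 1) \<and>
            (\<forall>x. g (abs_circle x) = abs_circle (h x)) \<and>
            dyadic_piecewise_affine_on {0..1} h \<and> h ` dyadics \<subseteq> dyadics)}"

definition complete_prefix_code :: "bool list set \<Rightarrow> bool" where
  "complete_prefix_code C \<longleftrightarrow>
     (\<forall>u\<in>C. \<forall>v\<in>C. prefix u v \<longrightarrow> u = v) \<and>
     (\<forall>w :: bool stream. \<exists>u\<in>C. \<exists>w'. w = u @- w')"

definition Thompson_V :: "(bool stream \<Rightarrow> bool stream) monoid" where
  "Thompson_V = transformation_group
     {g. \<exists>C D \<beta>. finite C \<and> complete_prefix_code C \<and> finite D \<and> complete_prefix_code D \<and>
           bij_betw \<beta> C D \<and> (\<forall>u\<in>C. \<forall>w. g (u @- w) = \<beta> u @- w)}"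


section \<open>Self-similar groups\<close>

definition tree_edge :: "'x list \<Rightarrow> 'x list \<Rightarrow> bool" where
  "tree_edge u v \<longleftrightarrow> (\<exists>x. v = u @ [x] \<or> u = v @ [x])"

definition tree_aut :: "('x list \<Rightarrow> 'x list) monoid" where
  "tree_aut = transformation_group
     {g. bij g \<and> g [] = [] \<and> (\<forall>u v. tree_edge (g u) (g v) \<longleftrightarrow> tree_edge u v)}"

text \<open>\<open>section_at g x\<close> is determined by \<open>g (x # v) = g [x] @ section_at g x v\<close>, where
  \<open>g [x]\<close> has length one.\<close>

definition section_at :: "('x list \<Rightarrow> 'x list) \<Rightarrow> 'x \<Rightarrow> 'x list \<Rightarrow> 'x list" where
  "section_at g x v = tl (g (x # v))"

definition self_similar :: "('x list \<Rightarrow> 'x list) set \<Rightarrow> bool" where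
  "self_similar G \<longleftrightarrow> subgroup G tree_aut \<and> (\<forall>g\<in>G. \<forall>x. section_at g x \<in> G)"

fun on_subtree :: "'x \<Rightarrow> ('x list \<Rightarrow> 'x list) \<Rightarrow> 'x list \<Rightarrow> 'x list" where
  "on_subtree x k [] = []"
| "on_subtree x k (y # v) = (if y = x then x # k v else y # v)"

definition branching_subgroup ::
    "('x list \<Rightarrow> 'x list) set \<Rightarrow> ('x list \<Rightarrow> 'x list) set \<Rightarrow> bool" where
  "branching_subgroup G K \<longleftrightarrow>
     subgroup K tree_aut \<and> K \<subseteq> G \<and> K \<noteq> {id} \<and> (\<forall>k\<in>K. \<forall>x. on_subtree x k \<in> K)"

definition weakly_branched :: "('x list \<Rightarrow> 'x list) set \<Rightarrow> bool" where
  "weakly_branched G \<longleftrightarrow> self_similar G \<and> (\<exists>K. branching_subgroup G K)"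

definition finitely_generated :: "('g, 'm) monoid_scheme \<Rightarrow> bool" where
  "finitely_generated G \<longleftrightarrow>
     (\<exists>E. finite E \<and> E \<subseteq> carrier G \<and> generate G E = carrier G)"

end

(* An alternating machine running in logarithmic time plays a game of logarithmic length: in every
   round the universal and the existential player choose one bit each, and a play makes at most one
   query to the input, namely at its end, since the existential player announces the answers to the
   queries and the universal player may ask for one announcement to be checked. So membership is the
   value of a complete tree of NOR gates of logarithmic height whose leaves depend on one input letter.

   As in Barrington's theorem, the value of the tree is turned into a product in G, but the elements used
   change with the height: level 0 is a fixed nontrivial element, and
     level (j+1) = [[level j, y_j], [level j, z_j]],   y_j = shift^j y,  z_j = shift^j z.
   If u and v are 1 or level j, then [[u, y_j], [v, z_j]] is level (j+1) if both are level j, and 1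
   otherwise. So the values 1 for true and level j for false at height j lead, after a negation, to the
   value of a NOR gate at height j+1. As shift is an endomorphism acting on the generators as a
   substitution, y_j is again a word which is obtained by substituting j times. Padded to a common
   length, all these words branch with a constant degree 2^beta, so the word for the whole tree has
   polynomial length, and the binary address of a letter is the path that leads to it. A deterministic
   machine can thus compute a letter from its address by following one play of the game and making its
   single query.

   It remains to keep the tower nontrivial. If level j moves a set I_j off itself and y_j and z_j are
   supported in I_j, then level (j+1) agrees with [y_j, z_j] on I_j, and it suffices that this commutator
   moves a smaller set I_(j+1) off itself. For Thompson's groups, shift is the conjugation by an element
   contracting I_j to I_(j+1). For a weakly branched group, shift lets the elements of the branching
   subgroup act on the subtree below a vertex that is moved by the commutator of two of its elements. *)

theory Submission
  imports Defs "HOL-Real_Asymp.Real_Asymp"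
begin

text \<open>The word must be readable by a machine that sees \<open>x\<close> only at the end of the
  triple, behind an address of varying length. So its shape is adapted to what a single query can
  test: the tree grows in windows of \<open>C\<close> levels, and window \<open>g\<close> exists iff
  \<open>2 ^ s * (2 ^ g - 1) \<le> length x + 2 * C * g\<close>. The index probed for this consists
  of \<open>g\<close> ones and \<open>s\<close> further digits, so it is written down without
  arithmetic on long numbers; \<open>2 * C * g\<close> is the room that the digits of
  \<open>g\<close> full windows occupy in the triple. The address is read once: it is divided by the
  block length digit by digit in the finite control, and the digits of the quotient, which form the
  path, go to a tape. The constants depend on each other in a circle. A window must hold enough
  rounds for the running time on inputs shorter than \<open>2 ^ (s + g + 1)\<close>, where
  \<open>g\<close> is the last window, so \<open>C\<close> grows linearly with \<open>s\<close>; on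
  the other hand \<open>s\<close> digits must hold numbers of size about \<open>C * s\<close>, that
  is, \<open>2 * C * s + 2 * B + 4 < 2 ^ s\<close>. A large \<open>s\<close> meets both.\<close>

lemma halts_within_stuck:
  "(\<nexists>c'. successor M x c c') \<Longrightarrow> halts_within M x t c"
  by (cases t) auto

section \<open>Deterministic programs\<close>

type_synonym 'q instruction = "('q \<times> (symbol \<times> direction) list) option"

definition idle :: "symbol list \<Rightarrow> (symbol \<times> direction) list" where
  "idle rs = map (\<lambda>s. (s, Stay)) rs"

lemma act_Stay [simp]: "act (scanned t, Stay) t = t"
  by (cases t) auto

lemma length_idle [simp]: "length (idle rs) = length rs"
  by (simp add: idle_def)

lemma map2_act_idle [simp]: "map2 act (idle (map scanned ts)) ts = ts"
  by (induction ts) (auto simp: idle_def)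

definition position_observation :: "bool list \<Rightarrow> tape \<Rightarrow> observation" where
  "position_observation x tp =
     (let p = index_value tp in if p < length x then Letter (x ! p) else Outside)"

text \<open>Control states keep an arbitrary structured type here; the numbering that
  \<open>machine\<close> demands appears only on compilation. Determinism is built in, as
  \<open>delta\<close> is a partial function.\<close>

locale program =
  fixes acc qry :: "'q \<Rightarrow> bool"
    and delta :: "'q \<Rightarrow> observation \<Rightarrow> symbol list \<Rightarrow> 'q instruction"
begin

definition obs :: "bool list \<Rightarrow> 'q \<Rightarrow> tape list \<Rightarrow> observation" where
  "obs x q ts = (if qry q then position_observation x (hd ts) else No_Query)"

definition next_config :: "bool list \<Rightarrow> 'q \<times> tape list \<Rightarrow> ('q \<times> tape list) option" where
  "next_config x c =
     map_option (\<lambda>(q', as). (q', map2 act as (snd c)))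
       (delta (fst c) (obs x (fst c) (snd c)) (map scanned (snd c)))"

text \<open>The number is only an upper bound for the running time: halting earlier is allowed, and
  the verdict is read off from the last state.\<close>

primrec decides :: "bool list \<Rightarrow> nat \<Rightarrow> 'q \<times> tape list \<Rightarrow> bool \<Rightarrow> bool" where
  "decides x 0 c P \<longleftrightarrow> next_config x c = None \<and> acc (fst c) = P"
| "decides x (Suc n) c P \<longleftrightarrow>
     (case next_config x c of None \<Rightarrow> acc (fst c) = P | Some c' \<Rightarrow> decides x n c' P)"

lemma decides_mono: "decides x n c P \<Longrightarrow> n \<le> m \<Longrightarrow> decides x m c P"
proof (induction n arbitrary: c m)
  case 0
  then show ?case by (cases m) auto
next
  case (Suc n)
  then obtain u where u: "m = Suc u" "n \<le> u" by (cases m) auto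
  with Suc show ?case by (auto split: option.splits)
qed

lemma decides_halt: "next_config x c = None \<Longrightarrow> acc (fst c) = P \<Longrightarrow> decides x n c P"
  by (cases n) auto

end

locale finite_program = program acc qry delta
  for acc qry :: "'q \<Rightarrow> bool"
    and delta :: "'q \<Rightarrow> observation \<Rightarrow> symbol list \<Rightarrow> 'q instruction" +
  fixes k :: nat and Q :: "'q set" and \<Gamma> :: "symbol set" and q0 :: 'q
  assumes finite_Q: "finite Q" and finite_Gamma: "finite \<Gamma>"
    and Blank: "Blank \<in> \<Gamma>" and q0: "q0 \<in> Q"
    and delta: "\<And>q ob rs q' as. \<lbrakk>q \<in> Q; set rs \<subseteq> \<Gamma>; length rs = Suc k; delta q ob rs = Some (q', as)\<rbrakk>
        \<Longrightarrow> q' \<in> Q \<and> length as = Suc k \<and> fst ` set as \<subseteq> \<Gamma>"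
    and acc_halts: "\<And>q ob rs. acc q \<Longrightarrow> delta q ob rs = None"
begin

definition code_state :: "'q \<Rightarrow> nat" where
  "code_state = (SOME f. inj_on f Q)"

lemma inj_code_state: "inj_on code_state Q"
  unfolding code_state_def
  using someI_ex[of "\<lambda>f::'q \<Rightarrow> nat. inj_on f Q"] finite_imp_inj_to_nat_seg[OF finite_Q] by blast

text \<open>Restricting states to \<open>Q\<close> and scanned symbols to \<open>\<Gamma>\<close>
  keeps the table finite; \<open>good\<close> is the invariant under which the restriction is never
  felt. There are no universal states, so acceptance follows the single run.\<close>

definition compiled :: machine where
  "compiled = \<lparr>work_tapes = k, initial_state = code_state q0,
     accepting_states = code_state ` {q \<in> Q. acc q}, universal_states = {},
     query_states = code_state ` {q \<in> Q. qry q},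
     transitions = {((code_state q, ob, rs), (code_state q', as)) | q ob rs q' as.
        q \<in> Q \<and> set rs \<subseteq> \<Gamma> \<and> length rs = Suc k \<and> delta q ob rs = Some (q', as)}\<rparr>"

lemma UNIV_observation: "(UNIV :: observation set) = {No_Query, Outside, Letter True, Letter False}"
  by (auto, case_tac x) auto

lemma finite_transitions: "finite (transitions compiled)"
proof (rule finite_subset)
  let ?A = "Q \<times> (UNIV :: observation set) \<times> {rs. set rs \<subseteq> \<Gamma> \<and> length rs = Suc k}"
  show "transitions compiled \<subseteq>
      (\<lambda>(q, ob, rs). ((code_state q, ob, rs),
         case delta q ob rs of Some (q', as) \<Rightarrow> (code_state q', as))) ` ?A"
  proof
    fix t assume "t \<in> transitions compiled"
    then obtain q ob rs q' as where t: "t = ((code_state q, ob, rs), (code_state q', as))"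
      "q \<in> Q" "set rs \<subseteq> \<Gamma>" "length rs = Suc k" "delta q ob rs = Some (q', as)"
      by (auto simp: compiled_def)
    show "t \<in> (\<lambda>(q, ob, rs). ((code_state q, ob, rs),
         case delta q ob rs of Some (q', as) \<Rightarrow> (code_state q', as))) ` ?A"
      by (rule image_eqI[where x = "(q, ob, rs)"]) (use t in auto)
  qed
  show "finite ((\<lambda>(q, ob, rs). ((code_state q, ob, rs),
         case delta q ob rs of Some (q', as) \<Rightarrow> (code_state q', as))) ` ?A)"
    using finite_Q finite_Gamma
    by (intro finite_imageI finite_cartesian_product finite_lists_length_eq)
       (auto simp: UNIV_observation)
qed

lemma deterministic_compiled: "deterministic_machine compiled"
  unfolding deterministic_machine_def alternating_machine_def
proof (intro conjI)
  show "finite (transitions compiled)" by (rule finite_transitions)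
  show "\<forall>((q, ob, rs), (q', as)) \<in> transitions compiled.
        q \<notin> accepting_states compiled \<and>
        length rs = Suc (work_tapes compiled) \<and> length as = Suc (work_tapes compiled)"
  proof clarify
    fix q ob rs q' as assume "((q, ob, rs), (q', as)) \<in> transitions compiled"
    then obtain p p' where p: "q = code_state p" "q' = code_state p'"
      "p \<in> Q" "set rs \<subseteq> \<Gamma>" "length rs = Suc k" "delta p ob rs = Some (p', as)"
      by (auto simp: compiled_def)
    have "length as = Suc k" using delta[OF p(3-6)] by simp
    moreover have "\<not> acc p" using p(6) acc_halts by auto
    ultimately show "q \<notin> accepting_states compiled \<and>
        length rs = Suc (work_tapes compiled) \<and> length as = Suc (work_tapes compiled)"
      using p inj_code_state by (auto simp: compiled_def inj_on_eq_iff)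
  qed
  show "single_valued (transitions compiled)"
  proof (rule single_valuedI)
    fix a b c assume "(a, b) \<in> transitions compiled" "(a, c) \<in> transitions compiled"
    then show "b = c" using inj_code_state by (auto simp: compiled_def inj_on_eq_iff)
  qed
qed

definition good :: "'q \<times> tape list \<Rightarrow> bool" where
  "good c \<longleftrightarrow> fst c \<in> Q \<and> length (snd c) = Suc k \<and> (\<forall>tp\<in>set (snd c). range (fst tp) \<subseteq> \<Gamma>)"

abbreviation "lower c \<equiv> (code_state (fst c), snd c)"

lemma observe_lower:
  "good c \<Longrightarrow> observe compiled x (lower c) = obs x (fst c) (snd c)"
  using inj_code_state
  by (auto simp: observe_def obs_def good_def compiled_def position_observation_def inj_on_eq_iff Let_def)

lemma good_scanned: "good c \<Longrightarrow> set (map scanned (snd c)) \<subseteq> \<Gamma>"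
  by (force simp: good_def)

lemma good_next: "good c \<Longrightarrow> next_config x c = Some c' \<Longrightarrow> good c'"
proof -
  assume g: "good c" and n: "next_config x c = Some c'"
  then obtain q' as where d: "delta (fst c) (obs x (fst c) (snd c)) (map scanned (snd c)) = Some (q', as)"
    and c': "c' = (q', map2 act as (snd c))"
    by (auto simp: next_config_def)
  have *: "q' \<in> Q \<and> length as = Suc k \<and> fst ` set as \<subseteq> \<Gamma>"
    using delta[OF _ _ _ d] g good_scanned[OF g] by (auto simp: good_def)
  have "range (fst (act a tp)) \<subseteq> \<Gamma>" if "(a, tp) \<in> set (zip as (snd c))" for a tp
  proof -
    have "fst a \<in> \<Gamma>" "range (fst tp) \<subseteq> \<Gamma>"
      using that * g set_zip_leftD[OF that] set_zip_rightD[OF that] by (auto simp: good_def)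
    then show ?thesis by (cases a; cases tp) auto
  qed
  then show ?thesis using * g by (auto simp: good_def c' set_zip)
qed

lemma successor_lower:
  assumes "good c"
  shows "successor compiled x (lower c) d \<longleftrightarrow> (\<exists>c'. next_config x c = Some c' \<and> d = lower c')"
proof
  assume "successor compiled x (lower c) d"
  then obtain as where
    "((code_state (fst c), obs x (fst c) (snd c), map scanned (snd c)), (fst d, as)) \<in> transitions compiled"
    and sd: "snd d = map2 act as (snd c)"
    unfolding successor_def observe_lower[OF assms] by auto
  then obtain q q' where q: "q \<in> Q" "code_state (fst c) = code_state q" "fst d = code_state q'"
     "delta q (obs x (fst c) (snd c)) (map scanned (snd c)) = Some (q', as)"
    by (auto simp: compiled_def)
  then have "fst c = q" using assms inj_code_state by (auto simp: good_def inj_on_eq_iff)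
  with q have "next_config x c = Some (q', snd d)"
    using sd by (simp add: next_config_def)
  with q show "\<exists>c'. next_config x c = Some c' \<and> d = lower c'"
    by (metis fst_conv prod.collapse snd_conv)
next
  assume "\<exists>c'. next_config x c = Some c' \<and> d = lower c'"
  then obtain q' as where d: "delta (fst c) (obs x (fst c) (snd c)) (map scanned (snd c)) = Some (q', as)"
    and d': "d = (code_state q', map2 act as (snd c))"
    by (auto simp: next_config_def)
  moreover have "((code_state (fst c), obs x (fst c) (snd c), map scanned (snd c)), (code_state q', as)) \<in> transitions compiled"
    using d assms good_scanned[OF assms] by (auto simp: compiled_def good_def)
  ultimately show "successor compiled x (lower c) d"
    unfolding successor_def observe_lower[OF assms] by auto
qed

lemma decides_halts_within:
  "good c \<Longrightarrow> decides x n c P \<Longrightarrow> halts_within compiled x n (lower c)"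
proof (induction n arbitrary: c)
  case 0
  then show ?case by (simp add: successor_lower)
next
  case (Suc n)
  show ?case
  proof (cases "next_config x c")
    case None
    then show ?thesis using Suc.prems(1) by (intro halts_within_stuck) (simp add: successor_lower)
  next
    case (Some c')
    then show ?thesis using Suc good_next[OF Suc.prems(1) Some] by (auto simp: successor_lower)
  qed
qed

lemma accepting_lower_halted:
  assumes "good c" "next_config x c = None"
  shows "accepting compiled x (lower c) \<longleftrightarrow> acc (fst c)"
proof
  assume "accepting compiled x (lower c)"
  then show "acc (fst c)"
  proof cases
    case final
    then show ?thesis using assms(1) inj_code_state by (auto simp: compiled_def good_def inj_on_eq_iff)
  next
    case (existential c')
    then show ?thesis using assms by (simp add: successor_lower)
  next
    case (universal c')
    then show ?thesis using assms by (simp add: successor_lower)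
  qed
next
  assume "acc (fst c)"
  then show "accepting compiled x (lower c)"
    using assms(1) by (intro accepting.final) (auto simp: compiled_def good_def)
qed

text \<open>Accepting states halt, so a configuration that has a successor is not itself accepting,
  and its only successor decides.\<close>

lemma accepting_lower_step:
  assumes "good c" "next_config x c = Some c'"
  shows "accepting compiled x (lower c) \<longleftrightarrow> accepting compiled x (lower c')"
proof
  have "\<not> acc (fst c)" using assms(2) acc_halts by (auto simp: next_config_def)
  then have na: "fst (lower c) \<notin> accepting_states compiled"
    using assms(1) inj_code_state by (auto simp: compiled_def good_def inj_on_eq_iff)
  have only: "d = lower c'" if "successor compiled x (lower c) d" for d
    using that assms(2) unfolding successor_lower[OF assms(1)] by auto
  assume "accepting compiled x (lower c)"
  then show "accepting compiled x (lower c')"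
  proof cases
    case final
    then show ?thesis using na by blast
  next
    case (existential d)
    then show ?thesis using only by blast
  next
    case (universal d)
    then show ?thesis using only by blast
  qed
next
  have "successor compiled x (lower c) (lower c')"
    unfolding successor_lower[OF assms(1)] using assms(2) by blast
  moreover have "fst (lower c) \<notin> universal_states compiled"
    by (simp add: compiled_def)
  moreover assume "accepting compiled x (lower c')"
  ultimately show "accepting compiled x (lower c)"
    using accepting.existential by blast
qed

lemma decides_accepting:
  "good c \<Longrightarrow> decides x n c P \<Longrightarrow> accepting compiled x (lower c) = P"
proof (induction n arbitrary: c)
  case 0
  then show ?case by (simp add: accepting_lower_halted)
next
  case (Suc n)
  then show ?case
    by (cases "next_config x c")
       (auto simp: accepting_lower_halted accepting_lower_step good_next)
qed

theorem decidable_in_DLOGTIME: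
  fixes T :: "nat \<Rightarrow> nat"
  assumes "(\<lambda>n. real (T n)) \<in> O(\<lambda>n. ln (real n))"
    and "\<And>x. decides x (T (length x)) (q0, replicate (Suc k) (\<lambda>_. Blank, 0)) (x \<in> L)"
  shows "L \<in> DLOGTIME"
proof -
  let ?c = "(q0, replicate (Suc k) (\<lambda>_. Blank, 0)) :: 'q \<times> tape list"
  have good: "good ?c" using q0 Blank by (auto simp: good_def)
  have init: "initial_configuration compiled = lower ?c"
    by (simp add: initial_configuration_def compiled_def)
  have "L = accepted_language compiled"
    unfolding accepted_language_def init using decides_accepting[OF good assms(2)] by blast
  moreover have "logarithmic_time compiled"
    unfolding logarithmic_time_def init
    using assms(1) decides_halts_within[OF good assms(2)] by blast
  ultimately show ?thesis
    using deterministic_compiled by (auto simp: DLOGTIME_def)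
qed

end

section \<open>A machine computing the letters of an addressed word\<close>

text \<open>\<open>Before j v\<close>: the \<open>j\<close> digits read so far have the value \<open>v\<close> below the block length, so
  the quotient has no digit yet. \<open>After j m r\<close>: the quotient started with the \<open>j\<close>th digit, the
  current remainder is \<open>m\<close>, and \<open>r\<close> counts the digits in the current window.\<close>

datatype division = Before nat nat | After nat nat nat

text \<open>The trailing \<open>bool\<close> is the claimed letter, and the \<open>nat\<close> in
  front of it in the later states is the position inside the block or, in \<open>Copy\<close>,
  \<open>Ones\<close> and \<open>Range_Query\<close>, the window count. \<open>Inc\<close>,
  \<open>Back\<close>, \<open>Write\<close> and \<open>Shift_Left\<close> are subroutines that carry
  their continuation.\<close>

datatype 'z control =
    Start | Probe_Write nat | Probe_Query | Rewind_Fuel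
  | Flag division | Digit division | Claim division
  | Inc "'z control" | Back "'z control"
  | Copy nat nat nat bool | Ones nat nat nat bool
  | Write "bool list" "'z control" | Shift_Left nat "'z control"
  | Range_Query nat nat nat bool | Top_Query nat bool
  | Rewind_Digits nat bool | Simulate 'z nat bool
  | Rewind_All 'z nat bool | Copy_Index 'z nat bool | Add bool 'z nat bool
  | Pop 'z nat bool | Final_Query 'z nat bool | Accept | Reject

abbreviation "st x \<equiv> (x, Stay)"
abbreviation "lt x \<equiv> (x, direction.Left)"
abbreviation "rt x \<equiv> (x, direction.Right)"

definition digits :: "nat \<Rightarrow> nat \<Rightarrow> bool list" where
  "digits n v = rev (map (bit v) [0..<n])"

fun queries :: "'z control \<Rightarrow> bool" where
  "queries Probe_Query = True"
| "queries (Flag d) = True"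
| "queries (Digit d) = True"
| "queries (Claim d) = True"
| "queries (Range_Query j m r a) = True"
| "queries (Top_Query m a) = True"
| "queries (Final_Query z m a) = True"
| "queries q = False"

text \<open>Tape 0 is the index tape and tape 1 moves along with it to mark its left end; tape 2 bounds the
  number of digits to be read; tape 3 holds the digits of the quotient after the first one; tape 4
  holds the offset of the embedded input, least significant digit first; tapes 5 and 6 serve for adding
  this offset; the tapes of the simulated machine follow.\<close>

locale addressing =
  fixes B s C :: nat and blk :: "'e \<Rightarrow> bool list" and e1 :: 'e
    and z0 :: 'z and zstep :: "bool \<Rightarrow> 'z \<Rightarrow> symbol list \<Rightarrow> 'z \<times> (symbol \<times> direction) list"
    and lf :: "'z \<Rightarrow> observation option" and out :: "'z \<Rightarrow> bool \<Rightarrow> 'e"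
    and k :: nat and ZZ :: "'z set" and \<Gamma> :: "symbol set" and EE :: "'e set"
  assumes B: "1 \<le> B" and C: "1 \<le> C" and s: "1 \<le> s" and big: "2 * C * s + 2 * B + 4 < 2 ^ s"
    and finite_ZZ: "finite ZZ" and finite_Gamma: "finite \<Gamma>"
    and Gamma: "{Blank, Bit False, Bit True, Mark 0} \<subseteq> \<Gamma>"
    and z0: "z0 \<in> ZZ"
    and zstep: "\<And>b z rs. \<lbrakk>z \<in> ZZ; set rs \<subseteq> \<Gamma>; length rs = Suc k\<rbrakk> \<Longrightarrow> fst (zstep b z rs) \<in> ZZ \<and>
        length (snd (zstep b z rs)) = Suc k \<and> fst ` set (snd (zstep b z rs)) \<subseteq> \<Gamma>"
    and e1: "e1 \<in> EE" and out: "\<And>z b. z \<in> ZZ \<Longrightarrow> out z b \<in> EE"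
    and blk: "\<And>e. e \<in> EE \<Longrightarrow> length (blk e) = B"
begin

definition answer :: "'e \<Rightarrow> nat \<Rightarrow> bool \<Rightarrow> 'z control" where
  "answer e m a = (if blk e ! m = a then Accept else Reject)"

text \<open>The scanned symbols, tape by tape: \<open>i\<close> index, \<open>w\<close> companion,
  \<open>u\<close> fuel, \<open>d\<close> quotient digits, \<open>c\<close> offset, \<open>p\<close>
  copy of the simulated index, \<open>t\<close> sum, \<open>ms\<close> simulated machine. Halting
  with \<open>None\<close> rejects in every state but \<open>Accept\<close>.\<close>

fun delta0 :: "'z control \<Rightarrow> observation \<Rightarrow> symbol \<Rightarrow> symbol \<Rightarrow> symbol \<Rightarrow> symbol \<Rightarrow> symbol \<Rightarrow> symbol \<Rightarrow> symbol
    \<Rightarrow> symbol list \<Rightarrow> 'z control instruction" where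
  \<comment> \<open>Tapes 1 to 6 leave cell 0 blank as a mark of their left end; the index tape
    cannot, since its digits start in cell 0.\<close>
  "delta0 Start ob i w u d c p t ms =
     Some (Probe_Write s, [st i, rt w, rt u, rt d, rt c, rt p, rt t] @ idle ms)"
| "delta0 (Probe_Write j) ob i w u d c p t ms =
     Some (if j = 0 then Probe_Query else Probe_Write (j - 1),
       [rt (Bit True), rt (Mark 0), rt (Mark 0), st d, st c, st p, st t] @ idle ms)"
| "delta0 Probe_Query ob i w u d c p t ms =
     (if ob = Outside then Some (Rewind_Fuel, [lt i, lt w, lt u, st d, st c, st p, st t] @ idle ms)
      else Some (Probe_Write 0, [st i, st w, st u, st d, st c, st p, st t] @ idle ms))"
| "delta0 Rewind_Fuel ob i w u d c p t ms =
     (if u = Blank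
      then Some (Back (Flag (Before 0 0)), [st i, rt w, rt u, st d, st c, st p, st t] @ idle ms)
      else Some (Rewind_Fuel, [lt (Bit False), lt w, lt u, st d, st c, st p, st t] @ idle ms))"
| "delta0 (Inc q) ob i w u d c p t ms =
     (if i = Bit True then Some (Inc q, [lt (Bit False), lt w, st u, st d, st c, st p, st t] @ idle ms)
      else Some (Back q, [rt (Bit True), rt w, st u, st d, st c, st p, st t] @ idle ms))"
| "delta0 (Back q) ob i w u d c p t ms =
     (if i = Blank then Some (q, [lt i, lt w, st u, st d, st c, st p, st t] @ idle ms)
      else Some (Back q, [rt i, rt w, st u, st d, st c, st p, st t] @ idle ms))"
| "delta0 (Flag q) ob i w u d c p t ms =
     (case ob of
        Letter b \<Rightarrow> Some (Inc (if b then Digit q else Claim q),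
          [st i, st w, st u, st d, st c, st p, st t] @ idle ms)
      | _ \<Rightarrow> None)"
\<comment> \<open>As \<open>v < B\<close>, the first value that reaches \<open>B\<close> is below
  \<open>2 * B\<close>, so the quotient starts with the digit 1 and one subtraction gives the
  remainder. A digit after the value 0 would follow a leading zero, which \<open>binary\<close>
  never produces. In \<open>After\<close>, one mark of fuel is spent per \<open>C\<close> digits;
  when the fuel is gone, the address is beyond the word.\<close>
| "delta0 (Digit q) ob i w u d c p t ms =
     (case ob of
        Letter b \<Rightarrow>
          (case q of
             Before j v \<Rightarrow>
               (if B < j \<or> 0 < j \<and> v = 0 then None
                else Some (Inc (Flag (if 2 * v + of_bool b < B then Before (Suc j) (2 * v + of_bool b)
                     else After (Suc j) (2 * v + of_bool b - B) 0)),
                   [st i, st w, st u, st d, st c, st p, st t] @ idle ms))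
           | After j v r \<Rightarrow>
               (if u = Blank then None
                else Some (Inc (Flag (After j ((2 * v + of_bool b) mod B) (if r = C then 1 else Suc r))),
                   [st i, st w, if r = C then rt u else st u, rt (Bit (B \<le> 2 * v + of_bool b)),
                    st c, st p, st t] @ idle ms)))
      | _ \<Rightarrow> None)"
| "delta0 (Claim q) ob i w u d c p t ms =
     (case ob of
        Letter a \<Rightarrow>
          (case q of
             Before j v \<Rightarrow>
               (if j = 0 then None
                else Some (answer e1 v a, [st i, st w, st u, st d, st c, st p, st t] @ idle ms))
           | After j v r \<Rightarrow> Some (Inc (Copy j v r a), [st i, st w, st u, st d, st c, st p, st t] @ idle ms))
      | _ \<Rightarrow> None)"
| "delta0 (Copy j v r a) ob i w u d c p t ms =
     (if w = Blank then Some (Ones j v r a, [st i, rt w, lt u, st d, st c, st p, st t] @ idle ms)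
      else Some (Copy j v r a, [lt i, lt w, st u, st d, rt i, st p, st t] @ idle ms))"
\<comment> \<open>The fuel head has counted the completed windows in unary, so moving it back writes
  the \<open>g\<close> leading ones of the index to be probed.\<close>
| "delta0 (Ones j v r a) ob i w u d c p t ms =
     (if u = Blank then Some (Write (digits s (2 * r + 2 * j + 1)) (Range_Query j v r a),
          [st i, st w, st u, st d, st c, st p, st t] @ idle ms)
      else Some (Ones j v r a, [rt (Bit True), rt (Mark 0), lt u, st d, st c, st p, st t] @ idle ms))"
| "delta0 (Write bs q) ob i w u d c p t ms =
     (case bs of
        [] \<Rightarrow> Some (q, [st Blank, st w, st u, st d, st c, st p, st t] @ idle ms)
      | b # bs' \<Rightarrow> Some (Write bs' q, [rt (Bit b), rt (Mark 0), st u, st d, st c, st p, st t] @ idle ms))"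
| "delta0 (Shift_Left n q) ob i w u d c p t ms =
     (if n = 0 then Some (q, [st i, st w, st u, st d, st c, st p, st t] @ idle ms)
      else Some (Shift_Left (n - 1) q, [lt i, lt w, st u, st d, st c, st p, st t] @ idle ms))"
\<comment> \<open>Only a full window (\<open>r = C\<close>) can end in a leaf; whether it does
  depends on the existence of a further window, which the second query tests.\<close>
| "delta0 (Range_Query j v r a) ob i w u d c p t ms =
     (if ob = Outside then None
      else Some (if r = C then Shift_Left s (Write (True # digits s (2 * j + 1)) (Top_Query v a))
             else answer e1 v a, [st i, st w, st u, st d, st c, st p, st t] @ idle ms))"
| "delta0 (Top_Query v a) ob i w u d c p t ms =
     (if ob = Outside then Some (Rewind_Digits v a, [st i, st w, st u, lt d, st c, st p, st t] @ idle ms)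
      else Some (answer e1 v a, [st i, st w, st u, st d, st c, st p, st t] @ idle ms))"
| "delta0 (Rewind_Digits v a) ob i w u d c p t ms =
     (if d = Blank then Some (Simulate z0 v a, [st i, st w, st u, rt d, st c, st p, st t] @ idle ms)
      else Some (Rewind_Digits v a, [st i, st w, st u, lt d, st c, st p, st t] @ idle ms))"
| "delta0 (Simulate z v a) ob i w u d c p t ms =
     (if d = Blank
      then (case lf z of
              None \<Rightarrow> Some (answer (out z False) v a, [st i, st w, st u, st d, st c, st p, st t] @ idle ms)
            | Some _ \<Rightarrow> Some (Rewind_All z v a, [st i, lt w, st u, lt d, lt c, st p, st t] @ idle ms))
      else Some (Simulate (fst (zstep (d = Bit True) z ms)) v a,
             [st i, st w, st u, rt d, st c, st p, st t] @ snd (zstep (d = Bit True) z ms)))"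
| "delta0 (Rewind_All z v a) ob i w u d c p t ms =
     (if w = Blank \<and> d = Blank \<and> c = Blank
      then Some (Copy_Index z v a, [st i, st w, st u, st d, rt c, st p, st t] @ idle ms)
      else Some (Rewind_All z v a,
             [lt i, if w = Blank then st w else lt w, st u, if d = Blank then st d else lt d,
              if c = Blank then st c else lt c, st p, st t] @ map (\<lambda>x. lt x) ms))"
| "delta0 (Copy_Index z v a) ob i w u d c p t ms =
     (if hd ms = Bit True \<or> hd ms = Bit False
      then Some (Copy_Index z v a, [st i, st w, st u, st d, st c, rt (hd ms), st t] @ map (\<lambda>x. rt x) ms)
      else Some (Add False z v a, [st i, st w, st u, st d, st c, lt p, st t] @ idle ms))"
\<comment> \<open>Addition from the least significant digit: the offset is read rightwards, the
  copied index leftwards from its last digit. A carry left at the end becomes one more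
  digit.\<close>
| "delta0 (Add y z v a) ob i w u d c p t ms =
     (if p = Blank \<and> c = Blank
      then (if y then Some (Add False z v a, [st i, st w, st u, st d, st c, st p, rt (Bit True)] @ idle ms)
            else Some (Pop z v a, [st i, st w, st u, st d, st c, st p, lt t] @ idle ms))
      else Some (Add (of_bool y + of_bool (p = Bit True) + of_bool (c = Bit True) \<ge> (2::nat)) z v a,
             [st i, st w, st u, st d, if c = Blank then st c else rt c, if p = Blank then st p else lt p,
              rt (Bit (odd (of_bool y + of_bool (p = Bit True) + of_bool (c = Bit True) :: nat)))] @ idle ms))"
| "delta0 (Pop z v a) ob i w u d c p t ms =
     (if t = Blank then Some (Final_Query z v a, [st Blank, st w, st u, st d, st c, st p, st t] @ idle ms)
      else Some (Pop z v a, [rt t, st w, st u, st d, st c, st p, lt t] @ idle ms))"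
| "delta0 (Final_Query z v a) ob i w u d c p t ms =
     Some (answer (out z (lf z = Some ob)) v a, [st i, st w, st u, st d, st c, st p, st t] @ idle ms)"
| "delta0 Accept ob i w u d c p t ms = None"
| "delta0 Reject ob i w u d c p t ms = None"

definition delta :: "'z control \<Rightarrow> observation \<Rightarrow> symbol list \<Rightarrow> 'z control instruction" where
  "delta q ob rs =
     (case rs of i # w # u # d # c # p # t # ms \<Rightarrow> delta0 q ob i w u d c p t ms | _ \<Rightarrow> None)"

sublocale program "\<lambda>q. q = Accept" queries delta .

definition divisions :: "division set" where
  "divisions = (\<lambda>(j, v). Before j v) ` ({..B + 1} \<times> {..<B})
     \<union> (\<lambda>(j, v, r). After j v r) ` ({..B + 1} \<times> {..<B} \<times> {..C})"

definition contexts :: "(nat \<times> nat \<times> nat \<times> bool) set" where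
  "contexts = {..B + 1} \<times> {..<B} \<times> {..C} \<times> UNIV"

text \<open>Together with \<open>written_controls\<close> and \<open>controls\<close> a finite
  superset of the reachable states. It stays finite because continuations nest boundedly:
  \<open>Shift_Left\<close> wraps a \<open>Write\<close>, and \<open>Write\<close>,
  \<open>Inc\<close> and \<open>Back\<close> wrap simple states.\<close>

definition simple_controls :: "'z control set" where
  "simple_controls = {Start, Probe_Query, Rewind_Fuel, Accept, Reject}
     \<union> Probe_Write ` {..s} \<union> Flag ` divisions \<union> Digit ` divisions \<union> Claim ` divisions
     \<union> (\<lambda>(j, v, r, a). Copy j v r a) ` contexts \<union> (\<lambda>(j, v, r, a). Ones j v r a) ` contexts
     \<union> (\<lambda>(j, v, r, a). Range_Query j v r a) ` contexts
     \<union> (\<lambda>(v, a). Top_Query v a) ` ({..<B} \<times> UNIV)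
     \<union> (\<lambda>(v, a). Rewind_Digits v a) ` ({..<B} \<times> UNIV)
     \<union> (\<lambda>(z, v, a). Simulate z v a) ` (ZZ \<times> {..<B} \<times> UNIV)
     \<union> (\<lambda>(z, v, a). Rewind_All z v a) ` (ZZ \<times> {..<B} \<times> UNIV)
     \<union> (\<lambda>(z, v, a). Copy_Index z v a) ` (ZZ \<times> {..<B} \<times> UNIV)
     \<union> (\<lambda>(y, z, v, a). Add y z v a) ` (UNIV \<times> ZZ \<times> {..<B} \<times> UNIV)
     \<union> (\<lambda>(z, v, a). Pop z v a) ` (ZZ \<times> {..<B} \<times> UNIV)
     \<union> (\<lambda>(z, v, a). Final_Query z v a) ` (ZZ \<times> {..<B} \<times> UNIV)"

definition written_controls :: "'z control set" where
  "written_controls = (\<lambda>(bs, q). Write bs q) ` ({bs. set bs \<subseteq> UNIV \<and> length bs \<le> Suc s} \<times> simple_controls)"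

definition controls :: "'z control set" where
  "controls = simple_controls \<union> written_controls \<union> Inc ` simple_controls \<union> Back ` simple_controls
     \<union> (\<lambda>(n, q). Shift_Left n q) ` ({..s} \<times> written_controls)"

lemma finite_controls: "finite controls"
proof -
  have d: "finite divisions" "finite contexts" by (auto simp: divisions_def contexts_def)
  then have "finite simple_controls"
    unfolding simple_controls_def by (intro finite_UnI finite_imageI finite_cartesian_product) (auto simp: finite_ZZ)
  moreover from this have "finite written_controls"
    unfolding written_controls_def
    by (intro finite_imageI finite_cartesian_product finite_lists_length_le) auto
  ultimately show ?thesis
    unfolding controls_def by (intro finite_UnI finite_imageI finite_cartesian_product) auto
qed

lemma length_digits [simp]: "length (digits n v) = n"
  by (simp add: digits_def)


lemma simple_controls_simps [simp]:
  "Start \<in> simple_controls" "Probe_Query \<in> simple_controls" "Rewind_Fuel \<in> simple_controls"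
  "Accept \<in> simple_controls" "Reject \<in> simple_controls"
  "Probe_Write j \<in> simple_controls \<longleftrightarrow> j \<le> s"
  "Flag d \<in> simple_controls \<longleftrightarrow> d \<in> divisions"
  "Digit d \<in> simple_controls \<longleftrightarrow> d \<in> divisions"
  "Claim d \<in> simple_controls \<longleftrightarrow> d \<in> divisions"
  "Copy j v r a \<in> simple_controls \<longleftrightarrow> j \<le> B + 1 \<and> v < B \<and> r \<le> C"
  "Ones j v r a \<in> simple_controls \<longleftrightarrow> j \<le> B + 1 \<and> v < B \<and> r \<le> C"
  "Range_Query j v r a \<in> simple_controls \<longleftrightarrow> j \<le> B + 1 \<and> v < B \<and> r \<le> C"
  "Top_Query v a \<in> simple_controls \<longleftrightarrow> v < B"
  "Rewind_Digits v a \<in> simple_controls \<longleftrightarrow> v < B"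
  "Simulate z v a \<in> simple_controls \<longleftrightarrow> z \<in> ZZ \<and> v < B"
  "Rewind_All z v a \<in> simple_controls \<longleftrightarrow> z \<in> ZZ \<and> v < B"
  "Copy_Index z v a \<in> simple_controls \<longleftrightarrow> z \<in> ZZ \<and> v < B"
  "Add y z v a \<in> simple_controls \<longleftrightarrow> z \<in> ZZ \<and> v < B"
  "Pop z v a \<in> simple_controls \<longleftrightarrow> z \<in> ZZ \<and> v < B"
  "Final_Query z v a \<in> simple_controls \<longleftrightarrow> z \<in> ZZ \<and> v < B"
  "Write bs q \<notin> simple_controls" "Inc q \<notin> simple_controls" "Back q \<notin> simple_controls"
  "Shift_Left n q \<notin> simple_controls"
  by (auto simp: simple_controls_def image_iff contexts_def)

lemma written_controls_simps [simp]:
  "Write bs q \<in> written_controls \<longleftrightarrow> length bs \<le> Suc s \<and> q \<in> simple_controls"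
  by (auto simp: written_controls_def image_iff)

lemma controls_simps [simp]:
  "Write bs q \<in> controls \<longleftrightarrow> length bs \<le> Suc s \<and> q \<in> simple_controls"
  "Inc q \<in> controls \<longleftrightarrow> q \<in> simple_controls"
  "Back q \<in> controls \<longleftrightarrow> q \<in> simple_controls"
  "Shift_Left n q \<in> controls \<longleftrightarrow> n \<le> s \<and> q \<in> written_controls"
  by (auto simp: controls_def image_iff) (auto simp: written_controls_def)

lemma simple_controls_subset: "q \<in> simple_controls \<Longrightarrow> q \<in> controls"
  by (simp add: controls_def)

lemma controls_cases:
  assumes "q \<in> controls"
  obtains "q \<in> simple_controls"
  | bs p where "q = Write bs p" "length bs \<le> Suc s" "p \<in> simple_controls"
  | p where "q = Inc p" "p \<in> simple_controls"
  | p where "q = Back p" "p \<in> simple_controls"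
  | n p where "q = Shift_Left n p" "n \<le> s" "p \<in> written_controls"
proof -
  consider "q \<in> simple_controls" | "q \<in> written_controls" | "q \<in> Inc ` simple_controls"
    | "q \<in> Back ` simple_controls" | "q \<in> (\<lambda>(n, q). Shift_Left n q) ` ({..s} \<times> written_controls)"
    using assms by (auto simp: controls_def)
  then show thesis
  proof cases
    case 2
    then show thesis using that(2) by (auto simp: written_controls_def)
  qed (use that in auto)
qed

lemma written_controls_subset: "q \<in> written_controls \<Longrightarrow> q \<in> controls"
  by (auto simp: controls_def)

lemma divisions_simps [simp]:
  "Before j v \<in> divisions \<longleftrightarrow> j \<le> B + 1 \<and> v < B"
  "After j v r \<in> divisions \<longleftrightarrow> j \<le> B + 1 \<and> v < B \<and> r \<le> C"
  by (auto simp: divisions_def image_iff)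

lemma answer_control [simp]: "answer e v a \<in> controls" "answer e v a \<in> simple_controls"
  by (auto simp: answer_def simple_controls_subset)

lemma delta0_control:
  assumes "q \<in> controls" and "delta0 q ob i w u d c p t ms = Some (q', as)"
    and "set ms \<subseteq> \<Gamma>" "length ms = Suc k"
  shows "q' \<in> controls"
  using assms(1)
proof (cases rule: controls_cases)
  case 1
  show ?thesis
  proof (cases q)
    case (Digit dv)
    then have dv: "dv \<in> divisions" using 1 by simp
    obtain b where ob: "ob = Letter b" using assms(2) Digit by (auto split: observation.splits)
    show ?thesis
    proof (cases dv)
      case (Before j v)
      then have "2 * v + of_bool b - B < B" using dv by (cases b) auto
      then show ?thesis using assms(2) Digit Before dv ob
        by (auto split: if_splits)
    next
      case (After j v r)
      then show ?thesis using assms(2) Digit dv ob B C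
        by (auto split: if_splits)
    qed
  qed (use assms 1 zstep z0 B simple_controls_subset[of "Simulate z0 _ _"] in \<open>auto simp: simple_controls_subset written_controls_subset
         split: if_splits observation.splits division.splits option.splits\<close>)
next
  case (2 bs p)
  then show ?thesis using assms by (auto simp: simple_controls_subset split: list.splits)
next
  case (5 n p)
  then show ?thesis using assms by (auto simp: written_controls_subset split: if_splits)
qed (use assms in \<open>auto simp: simple_controls_subset split: if_splits\<close>)

lemma delta0_actions:
  assumes "q \<in> controls" and "delta0 q ob i w u d c p t ms = Some (q', as)"
    and "set (i # w # u # d # c # p # t # ms) \<subseteq> \<Gamma>" "length ms = Suc k"
  shows "length as = k + 8 \<and> list_all (\<lambda>a. fst a \<in> \<Gamma>) as"
proof -
  have bit: "Bit b \<in> \<Gamma>" for b using Gamma by (cases b) auto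
  have G: "i \<in> \<Gamma>" "w \<in> \<Gamma>" "u \<in> \<Gamma>" "d \<in> \<Gamma>" "c \<in> \<Gamma>" "p \<in> \<Gamma>" "t \<in> \<Gamma>" "hd ms \<in> \<Gamma>"
    "Blank \<in> \<Gamma>" "Mark 0 \<in> \<Gamma>" "list_all (\<lambda>a. fst a \<in> \<Gamma>) (idle ms)"
    "list_all (\<lambda>a. fst a \<in> \<Gamma>) (map (\<lambda>x. (x, D)) ms)" for D :: direction
    using assms(3,4) Gamma by (cases ms; auto simp: list_all_iff idle_def)+
  note splits = if_split_asm observation.split_asm division.split_asm list.split_asm option.split_asm
  show ?thesis
  proof (cases q)
    case (Simulate z v a)
    then have "z \<in> ZZ" using assms(1) by (auto simp: controls_def written_controls_def)
    then have z: "length (snd (zstep y z ms)) = Suc k" "list_all (\<lambda>a. fst a \<in> \<Gamma>) (snd (zstep y z ms))" for y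
      using assms(3,4) zstep[of z ms y] by (auto simp: list_all_iff image_subset_iff)
    show ?thesis using assms(2,4) Simulate
      by (clarsimp split: splits) (simp_all add: G z)
  qed (insert assms(2,4), (clarsimp split: splits; simp add: G bit)+)
qed

lemma finite_program_addressing:
  "finite_program (\<lambda>q. q = Accept) delta (k + 7) controls \<Gamma> Start"
proof
  show "finite controls" by (rule finite_controls)
  show "finite \<Gamma>" by (rule finite_Gamma)
  show "Blank \<in> \<Gamma>" using Gamma by simp
  show "Start \<in> controls" by (simp add: simple_controls_subset)
  show "delta q ob rs = None" if "q = Accept" for q ob rs
    using that by (auto simp: delta_def split: list.splits)
  fix q ob rs q' as
  assume a: "q \<in> controls" "set rs \<subseteq> \<Gamma>" "length rs = Suc (k + 7)" "delta q ob rs = Some (q', as)"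
  obtain i w u d c p t ms where rs: "rs = i # w # u # d # c # p # t # ms"
    using a(4) by (auto simp: delta_def split: list.splits)
  then show "q' \<in> controls \<and> length as = Suc (k + 7) \<and> fst ` set as \<subseteq> \<Gamma>"
    using a delta0_control[of q ob i w u d c p t ms q' as] delta0_actions[of q ob i w u d c p t ms q' as]
    by (auto simp: delta_def list_all_iff)
qed

lemma decides_Suc:
  "decides x (Suc n) (q, I # W # U # D # K # S # Z # ms) P \<longleftrightarrow>
     (case delta0 q (if queries q then position_observation x I else No_Query) (scanned I) (scanned W)
        (scanned U) (scanned D) (scanned K) (scanned S) (scanned Z) (map scanned ms) of
        None \<Rightarrow> (q = Accept) = P
      | Some (q', as) \<Rightarrow> decides x n (q', map2 act as (I # W # U # D # K # S # Z # ms)) P)"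
  by (auto simp: next_config_def delta_def obs_def split: option.splits)

lemma decides_answer:
  "(blk e ! v = a) = P \<Longrightarrow> decides x n (answer e v a, I # W # U # D # K # S # Z # ms) P"
  by (rule decides_halt) (auto simp: answer_def next_config_def delta_def)

end

section \<open>Binary numerals and the tape contents that hold them\<close>

abbreviation digits_value :: "bool list \<Rightarrow> nat" where
  "digits_value bs \<equiv> horner_sum of_bool 2 (rev bs)"

lemma digits_value_append:
  "digits_value (bs @ cs) = digits_value bs * 2 ^ length cs + digits_value cs"
  by (induction cs rule: rev_induct) (auto simp: algebra_simps simp flip: append_assoc)

lemma digits_value_less: "digits_value bs < 2 ^ length bs"
  by (induction bs rule: rev_induct) auto

lemma horner_sum_replicate_True: "horner_sum of_bool 2 (replicate n True) = (2 ^ n - 1 :: nat)"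
proof -
  have "Suc (horner_sum of_bool 2 (replicate n True)) = 2 ^ n"
    by (induction n) simp_all
  then show ?thesis by simp
qed

lemma digits_value_digits: "v < 2 ^ n \<Longrightarrow> digits_value (digits n v) = v"
  by (simp add: digits_def horner_sum_bit_eq_take_bit take_bit_nat_eq_self)

lemma index_value_eq:
  assumes "\<And>j. j < length bs \<Longrightarrow> t j = Bit (bs ! j)" "\<And>b. t (length bs) \<noteq> Bit b"
  shows "index_value (t, h) = digits_value bs"
proof -
  have "(LEAST n. \<forall>b. t n \<noteq> Bit b) = length bs"
    using assms by (intro Least_equality) (auto simp: not_less[symmetric])
  moreover have "map (\<lambda>j. t j = Bit True) [0..<length bs] = bs"
    using assms(1) by (intro nth_equalityI) auto
  ultimately show ?thesis by (simp add: index_value_def)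
qed

definition ones_tape :: "nat \<Rightarrow> nat \<Rightarrow> symbol" where
  "ones_tape h = (\<lambda>j. if j < h then Bit True else Blank)"

text \<open>Shifted by one against \<open>ones_tape\<close>: a head cannot notice the left end of
  its tape, so the companion head runs one cell ahead and finds the blank cell 0 when the index tape
  is used up.\<close>

definition tally_tape :: "nat \<Rightarrow> nat \<Rightarrow> symbol" where
  "tally_tape h = (\<lambda>j. if 0 < j \<and> j \<le> h then Mark 0 else Blank)"

definition counter_tape :: "nat \<Rightarrow> nat \<Rightarrow> nat \<Rightarrow> symbol" where
  "counter_tape w v = (\<lambda>j. if j < w then Bit (bit v (w - 1 - j)) else Blank)"

definition list_tape :: "bool list \<Rightarrow> nat \<Rightarrow> symbol" where
  "list_tape bs = (\<lambda>j. if 0 < j \<and> j \<le> length bs then Bit (bs ! (j - 1)) else Blank)"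

lemma list_tape_Nil: "list_tape [] = (\<lambda>_. Blank)"
  by (auto simp: list_tape_def)

lemma list_tape_upd: "(list_tape bs)(Suc (length bs) := Bit b) = list_tape (bs @ [b])"
  by (auto simp: list_tape_def fun_eq_iff nth_append)

lemma index_value_ones: "index_value (ones_tape h, p) = 2 ^ h - 1"
  using index_value_eq[of "replicate h True" "ones_tape h" p]
  by (simp add: ones_tape_def horner_sum_replicate_True)

lemma index_value_counter: "v < 2 ^ w \<Longrightarrow> index_value (counter_tape w v, p) = v"
  using index_value_eq[of "digits w v" "counter_tape w v" p]
  by (simp add: counter_tape_def digits_value_digits) (simp add: digits_def rev_nth)

lemma ones_tape_upd: "(ones_tape h)(h := Bit True) = ones_tape (Suc h)"
  by (auto simp: ones_tape_def)

lemma tally_tape_upd: "(tally_tape h)(Suc h := Mark 0) = tally_tape (Suc h)"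
  by (auto simp: tally_tape_def)

function trailing_ones :: "nat \<Rightarrow> nat" where
  "trailing_ones n = (if odd n then Suc (trailing_ones (n div 2)) else 0)"
  by pat_completeness auto
termination by (relation "Wellfounded.measure id") (auto elim!: oddE)

fun ones_count :: "nat \<Rightarrow> nat" where
  "ones_count n = (if n = 0 then 0 else of_bool (odd n) + ones_count (n div 2))"

declare trailing_ones.simps [simp del] ones_count.simps [simp del]

text \<open>An increment turns the trailing ones into zeros and the zero in front of them into a
  one.\<close>

lemma ones_count_Suc: "ones_count (Suc n) + trailing_ones n = Suc (ones_count n)"
proof (induction n rule: less_induct)
  case (less n)
  show ?case
  proof (cases "even n")
    case True
    then show ?thesis
      using trailing_ones.simps[of n] ones_count.simps[of n] ones_count.simps[of "Suc n"] by auto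
  next
    case False
    then have "n div 2 < n" by (cases n) auto
    from less.IH[OF this] show ?thesis
      using False trailing_ones.simps[of n] ones_count.simps[of n] ones_count.simps[of "Suc n"]
      by (auto elim!: oddE)
  qed
qed

lemma ones_count_0 [simp]: "ones_count 0 = 0"
  by (simp add: ones_count.simps)

section \<open>Measuring the input and counting its positions\<close>

context addressing
begin

declare decides.simps(2) [simp del]

lemmas step_simps = decides_Suc ones_tape_upd tally_tape_upd

text \<open>The number of ones at which the probe first falls outside the input, since the index
  \<open>2 ^ w - 1\<close> is outside iff \<open>n < 2 ^ w\<close>. The lower bound
  \<open>s < w\<close> comes from the ones written before the first query.\<close>

definition width :: "nat \<Rightarrow> nat" where
  "width n = (LEAST w. s < w \<and> n < 2 ^ w)"

lemma width_greater: "s < width n" and width_bound: "n < 2 ^ width n"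
proof -
  have "s < Suc (s + n) \<and> n < 2 ^ Suc (s + n)"
    using less_exp[of n] power_increasing[of n "Suc (s + n)" "2::nat"] by linarith
  from LeastI[of "\<lambda>w. s < w \<and> n < 2 ^ w", OF this]
  show "s < width n" "n < 2 ^ width n" by (auto simp: width_def)
qed

lemma width_least: "s < w \<Longrightarrow> w < width n \<Longrightarrow> 2 ^ w \<le> n"
  using not_less_Least[of w "\<lambda>w. s < w \<and> n < 2 ^ w"] by (auto simp: width_def)

lemma decides_Probe_Query:
  assumes "decides x T (Rewind_Fuel, (ones_tape w, w - 1) # (tally_tape w, w) # (tally_tape w, w) # D # K # S # Z # ms) P"
    and "w = width (length x)"
    and "s < h" "h \<le> w"
  shows "decides x (T + 2 * (w - h) + 1)
     (Probe_Query, (ones_tape h, h) # (tally_tape h, Suc h) # (tally_tape h, Suc h) # D # K # S # Z # ms) P"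
  using assms(3,4)
proof (induction "w - h" arbitrary: h)
  case 0
  then have "h = w" by simp
  have "(ones_tape w)(w := Blank) = ones_tape w" "(tally_tape w)(Suc w := Blank) = tally_tape w"
    by (auto simp: ones_tape_def tally_tape_def)
  moreover have "\<not> 2 ^ w - Suc 0 < length x"
    using width_bound[of "length x"] assms(2) by simp
  moreover have "ones_tape w w = Blank" "tally_tape w (Suc w) = Blank"
    by (auto simp: ones_tape_def tally_tape_def)
  ultimately show ?case using assms(1) \<open>h = w\<close>
    by (simp add: step_simps position_observation_def index_value_ones Let_def)
next
  case (Suc n)
  then have h: "h < w" by simp
  have e: "T + 2 * (w - h) + 1 = Suc (Suc (T + 2 * (w - Suc h) + 1))" using h by simp
  have lt: "2 ^ h - 1 < length x"
  proof (rule less_le_trans)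
    show "2 ^ h \<le> length x" using width_least[of h "length x"] h Suc.prems assms(2) by simp
  qed simp
  have "decides x (T + 2 * (w - Suc h) + 1) (Probe_Query, (ones_tape (Suc h), Suc h) #
     (tally_tape (Suc h), Suc (Suc h)) # (tally_tape (Suc h), Suc (Suc h)) # D # K # S # Z # ms) P"
    using Suc by (intro Suc.hyps(1)) auto
  then show ?case unfolding e using lt
    by (simp add: step_simps position_observation_def index_value_ones)
qed

lemma decides_Probe_Write:
  assumes "decides x T (Probe_Query, (ones_tape (h + Suc j), h + Suc j) #
     (tally_tape (h + Suc j), Suc (h + Suc j)) # (tally_tape (h + Suc j), Suc (h + Suc j)) # D # K # S # Z # ms) P"
  shows "decides x (T + Suc j)
     (Probe_Write j, (ones_tape h, h) # (tally_tape h, Suc h) # (tally_tape h, Suc h) # D # K # S # Z # ms) P"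
  using assms
proof (induction j arbitrary: h)
  case 0
  then show ?case by (simp add: step_simps)
next
  case (Suc j)
  have "decides x (T + Suc j) (Probe_Write j, (ones_tape (Suc h), Suc h) #
     (tally_tape (Suc h), Suc (Suc h)) # (tally_tape (Suc h), Suc (Suc h)) # D # K # S # Z # ms) P"
    using Suc.prems by (intro Suc.IH) simp
  then show ?case by (simp add: step_simps)
qed

lemma decides_Back:
  assumes "decides x T (q, (f, w - 1) # (g, w) # U # D # K # S # Z # ms) P"
    and "\<And>j. h \<le> j \<Longrightarrow> j < w \<Longrightarrow> f j \<noteq> Blank" "f w = Blank" "h \<le> w" 
  shows "decides x (T + (w - h) + 1) (Back q, (f, h) # (g, Suc h) # U # D # K # S # Z # ms) P"
  using assms(2,4)
proof (induction "w - h" arbitrary: h)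
  case 0
  then show ?case using assms(1,3) by (simp add: step_simps fun_upd_idem)
next
  case (Suc n)
  then have h: "h < w" by simp
  have e: "T + (w - h) + 1 = Suc (T + (w - Suc h) + 1)" using h by simp
  have "decides x (T + (w - Suc h) + 1) (Back q, (f, Suc h) # (g, Suc (Suc h)) # U # D # K # S # Z # ms) P"
    using Suc by (intro Suc.hyps(1)) auto
  then show ?case unfolding e using h Suc.prems
    by (simp add: step_simps)
qed

lemma decides_Rewind_Fuel:
  assumes "decides x T (Back (Flag (Before 0 0)), (counter_tape w 0, 0) # (tally_tape w, 1) # (tally_tape w, 1) # D # K # S # Z # ms) P"
  shows "c \<le> w \<Longrightarrow> decides x (T + c + 1)
     (Rewind_Fuel, (\<lambda>j. if j < c then Bit True else counter_tape w 0 j, c - 1) # (tally_tape w, c) # (tally_tape w, c) # D # K # S # Z # ms) P"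
proof (induction c)
  case 0
  then show ?case using assms by (simp add: step_simps) (simp add: tally_tape_def fun_upd_idem)
next
  case (Suc c)
  have *: "(\<lambda>j. if j < Suc c then Bit True else counter_tape w 0 j)(c := Bit False) =
      (\<lambda>j. if j < c then Bit True else counter_tape w 0 j)"
    using Suc.prems by (auto simp: fun_eq_iff counter_tape_def)
  have "tally_tape w (Suc c) \<noteq> Blank" using Suc.prems by (simp add: tally_tape_def)
  then show ?case using Suc by (simp add: step_simps *)
qed

theorem decides_Start:
  assumes "decides x T (Flag (Before 0 0), (counter_tape w 0, w - 1) # (tally_tape w, w) # (tally_tape w, 1) #
        (\<lambda>_. Blank, 1) # (\<lambda>_. Blank, 1) # (\<lambda>_. Blank, 1) # (\<lambda>_. Blank, 1) # ms) P"
    and w: "w = width (length x)" and m: "T + 4 * w + 4 \<le> m"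
  shows "decides x m (Start, (\<lambda>_. Blank, 0) # (\<lambda>_. Blank, 0) # (\<lambda>_. Blank, 0) #
        (\<lambda>_. Blank, 0) # (\<lambda>_. Blank, 0) # (\<lambda>_. Blank, 0) # (\<lambda>_. Blank, 0) # ms) P"
proof -
  let ?b = "(\<lambda>_. Blank, 1) :: tape"
  have sw: "s < w" using width_greater w by simp
  have 1: "decides x (T + w + 1) (Back (Flag (Before 0 0)), (counter_tape w 0, 0) # (tally_tape w, Suc 0) # (tally_tape w, 1) #
       ?b # ?b # ?b # ?b # ms) P"
    using decides_Back[OF assms(1), where h = 0] by (auto simp: counter_tape_def)
  have "(\<lambda>j. if j < w then Bit True else counter_tape w 0 j) = ones_tape w"
    by (auto simp: counter_tape_def ones_tape_def)
  with decides_Rewind_Fuel[of x "T + w + 1" w ?b ?b ?b ?b ms P w] 1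
  have 2: "decides x (T + w + 1 + w + 1) (Rewind_Fuel, (ones_tape w, w - 1) # (tally_tape w, w) # (tally_tape w, w) #
       ?b # ?b # ?b # ?b # ms) P"
    by simp
  have 3: "decides x (T + w + 1 + w + 1 + 2 * (w - Suc s) + 1) (Probe_Query, (ones_tape (Suc s), Suc s) #
       (tally_tape (Suc s), Suc (Suc s)) # (tally_tape (Suc s), Suc (Suc s)) # ?b # ?b # ?b # ?b # ms) P"
    using decides_Probe_Query[OF 2 w, of "Suc s"] sw by simp
  have "ones_tape 0 = (\<lambda>_. Blank)" "tally_tape 0 = (\<lambda>_. Blank)"
    by (auto simp: ones_tape_def tally_tape_def)
  then have 4: "decides x (T + w + 1 + w + 1 + 2 * (w - Suc s) + 1 + Suc s) (Probe_Write s, (\<lambda>_. Blank, 0) #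
       ?b # ?b # ?b # ?b # ?b # ?b # ms) P"
    using decides_Probe_Write[of x "T + w + 1 + w + 1 + 2 * (w - Suc s) + 1" 0 s ?b ?b ?b ?b ms P] 3 by simp
  have "decides x (Suc (T + w + 1 + w + 1 + 2 * (w - Suc s) + 1 + Suc s)) (Start, (\<lambda>_. Blank, 0) # (\<lambda>_. Blank, 0) # (\<lambda>_. Blank, 0) #
        (\<lambda>_. Blank, 0) # (\<lambda>_. Blank, 0) # (\<lambda>_. Blank, 0) # (\<lambda>_. Blank, 0) # ms) P"
    by (subst decides_Suc) (use 4 in \<open>simp add: fun_upd_idem\<close>)
  then show ?thesis by (rule decides_mono) (use m sw in simp)
qed

text \<open>The counter \<open>u * 2 ^ i\<close> is in the middle of an increment: its last
  \<open>i\<close> digits have been cleared by the carry, and \<open>u\<close> is the part that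
  remains to be incremented.\<close>

lemma counter_tape_clear:
  assumes "i < w" "u < 2 ^ (w - i)" "odd u"
  shows "(counter_tape w (u * 2 ^ i))(w - Suc i := Bit False) = counter_tape w (u div 2 * 2 ^ Suc i)"
proof
  fix j
  have "bit (u div 2 * 2 ^ Suc i) n \<longleftrightarrow> bit (u * 2 ^ i) n \<and> n \<noteq> i" for n
  proof -
    have "u div 2 * 2 ^ Suc i = push_bit i (2 * (u div 2))"
      by (simp add: push_bit_eq_mult)
    moreover have "u * 2 ^ i = push_bit i u" by (simp add: push_bit_eq_mult)
    ultimately have e: "u div 2 * 2 ^ Suc i = push_bit i (2 * (u div 2))" "u * 2 ^ i = push_bit i u" by auto
    show ?thesis
    proof (cases n i rule: linorder_cases)
      case greater
      then obtain m where m: "n = Suc (i + m)" using less_imp_Suc_add by blast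
      have "bit (2 * (u div 2)) (Suc m) = bit u (Suc m)" by (simp add: bit_Suc)
      moreover have "n - i = Suc m" "i \<le> n" "n \<noteq> i" using m by auto
      ultimately show ?thesis unfolding e bit_push_bit_iff_nat by simp
    next
      case equal
      show ?thesis unfolding e equal by (simp add: bit_push_bit_iff_nat bit_0)
    next
      case less
      then show ?thesis unfolding e by (simp add: bit_push_bit_iff_nat)
    qed
  qed
  from this[of "w - 1 - j"] show "((counter_tape w (u * 2 ^ i))(w - Suc i := Bit False)) j = counter_tape w (u div 2 * 2 ^ Suc i) j"
    unfolding counter_tape_def fun_upd_def using assms(1) by auto
qed

lemma counter_tape_set:
  assumes "i < w" "even u"
  shows "(counter_tape w (u * 2 ^ i))(w - Suc i := Bit True) = counter_tape w (Suc u * 2 ^ i)"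
proof
  fix j
  have "bit (Suc u * 2 ^ i) n \<longleftrightarrow> bit (u * 2 ^ i) n \<or> n = i" for n
  proof -
    have "Suc u * 2 ^ i = push_bit i (1 + u)" "u * 2 ^ i = push_bit i u"
      by (simp_all add: push_bit_eq_mult)
    moreover have "bit (1 + u) m \<longleftrightarrow> bit u m \<or> m = 0" for m
      using even_bit_succ_iff[OF assms(2)] by simp
    ultimately show ?thesis
      by (auto simp only: bit_push_bit_iff_nat)
  qed
  from this[of "w - 1 - j"] show "((counter_tape w (u * 2 ^ i))(w - Suc i := Bit True)) j = counter_tape w (Suc u * 2 ^ i) j"
    unfolding counter_tape_def fun_upd_def using assms(1) by auto
qed

lemma counter_tape_bit: "i < w \<Longrightarrow> counter_tape w (u * 2 ^ i) (w - Suc i) = Bit (odd u)"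
  by (simp add: counter_tape_def) (simp add: bit_iff_odd)

text \<open>Each trailing one is paid twice, for the carry moving left over it and for the way back,
  and the \<open>i\<close> digits cleared earlier are paid for the way back only.\<close>

lemma decides_Inc_aux:
  assumes "decides x T (q, (counter_tape w (Suc u * 2 ^ i), w - 1) # (g, w) # U # D # K # S # Z # ms) P"
    and "Suc u < 2 ^ (w - i)" "i < w"
  shows "decides x (T + 2 * trailing_ones u + i + 2)
     (Inc q, (counter_tape w (u * 2 ^ i), w - Suc i) # (g, w - i) # U # D # K # S # Z # ms) P"
  using assms
proof (induction u arbitrary: i rule: less_induct)
  case (less u)
  show ?case
  proof (cases "even u")
    case True
    have "decides x (T + (w - (w - i)) + 1)
       (Back q, (counter_tape w (Suc u * 2 ^ i), w - i) # (g, Suc (w - i)) # U # D # K # S # Z # ms) P"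
      using less.prems by (intro decides_Back) (auto simp: counter_tape_def)
    then show ?thesis
      using less.prems True trailing_ones.simps[of u]
      by (simp add: step_simps counter_tape_bit counter_tape_set Suc_diff_Suc)
  next
    case False
    then obtain v where v: "u = Suc (2 * v)" by (auto elim!: oddE)
    obtain n where n: "w - i = Suc n" using less.prems by (cases "w - i") auto
    have i: "Suc i < w"
      using less.prems v n by (cases n) auto
    have "w - Suc i = n" using n by simp
    then have "Suc v < 2 ^ (w - Suc i)" using less.prems(2) v n by simp
    moreover have e: "Suc v * 2 ^ Suc i = Suc u * 2 ^ i" using v by simp
    ultimately have "decides x (T + 2 * trailing_ones v + Suc i + 2)
       (Inc q, (counter_tape w (v * 2 ^ Suc i), w - Suc (Suc i)) # (g, w - Suc i) # U # D # K # S # Z # ms) P"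
      using i v less.prems(1)[folded e] by (intro less.IH) auto
    moreover have "trailing_ones u = Suc (trailing_ones v)"
      using v trailing_ones.simps[of u] by simp
    moreover have "(counter_tape w (u * 2 ^ i))(w - Suc i := Bit False) = counter_tape w (v * 2 ^ Suc i)"
      using counter_tape_clear[of i w u] less.prems v by simp
    ultimately show ?thesis
      using i False less.prems(3) by (auto simp: step_simps counter_tape_bit elim!: decides_mono)
  qed
qed

text \<open>The number of ones is the potential that makes an increment cost amortized constant time.\<close>

lemma decides_Inc:
  assumes "decides x T (q, (counter_tape w (Suc v), w - 1) # (g, w) # U # D # K # S # Z # ms) P"
    and "Suc v < 2 ^ w" and "0 < w" and "T + 2 * ones_count v + 4 \<le> m + 2 * ones_count (Suc v)"
  shows "decides x m (Inc q, (counter_tape w v, w - 1) # (g, w) # U # D # K # S # Z # ms) P"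
proof -
  have "decides x (T + 2 * trailing_ones v + 0 + 2)
     (Inc q, (counter_tape w (v * 2 ^ 0), w - Suc 0) # (g, w - 0) # U # D # K # S # Z # ms) P"
    by (rule decides_Inc_aux) (use assms in auto)
  then show ?thesis
    by (auto elim!: decides_mono) (use assms(4) ones_count_Suc[of v] in linarith)
qed

end

lemma map2_act_move [simp]:
  "map2 act (map ((\<lambda>x. (x, d)) \<circ> scanned) ms) ms = map (\<lambda>tp. act (scanned tp, d) tp) ms"
  by (induction ms) auto

lemma list_tape_simps [simp]:
  "list_tape bs 0 = Blank" "list_tape bs (Suc j) = (if j < length bs then Bit (bs ! j) else Blank)"
  by (auto simp: list_tape_def)

lemma list_tape_eq_Blank: "list_tape bs j = Blank \<longleftrightarrow> j = 0 \<or> length bs < j"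
  by (auto simp: list_tape_def)

lemma idle_Cons [simp]: "idle (x # xs) = (x, Stay) # idle xs"
  by (simp add: idle_def)

section \<open>Following a path and making the single query\<close>

context addressing
begin

declare decides.simps [simp del]

definition sim_step :: "bool \<Rightarrow> 'z \<times> tape list \<Rightarrow> 'z \<times> tape list" where
  "sim_step b c = (fst (zstep b (fst c) (map scanned (snd c))),
     map2 act (snd (zstep b (fst c) (map scanned (snd c)))) (snd c))"

definition leaf :: "bool list \<Rightarrow> 'z \<times> tape list \<Rightarrow> 'e" where
  "leaf x c = out (fst c)
     (case lf (fst c) of None \<Rightarrow> False | Some ob \<Rightarrow> position_observation x (hd (snd c)) = ob)"

primrec leaves :: "bool list \<Rightarrow> nat \<Rightarrow> 'z \<times> tape list \<Rightarrow> 'e list" where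
  "leaves x 0 c = [leaf x c]"
| "leaves x (Suc n) c = leaves x n (sim_step False c) @ leaves x n (sim_step True c)"

lemma length_leaves: "length (leaves x n c) = 2 ^ n"
  by (induction n arbitrary: c) auto

lemma nth_leaves:
  "leaves x (length bs) c ! digits_value bs = leaf x (foldl (\<lambda>c b. sim_step b c) c bs)"
proof (induction bs arbitrary: c)
  case Nil
  then show ?case by simp
next
  case (Cons b bs)
  have "digits_value (b # bs) = of_bool b * 2 ^ length bs + digits_value bs"
    using digits_value_append[of "[b]" bs] by simp
  then show ?case using Cons digits_value_less[of bs] by (auto simp: nth_append length_leaves)
qed

text \<open>Bounds the simulated tapes after \<open>h\<close> steps. This limits both the rewinding
  of the heads and the length of the simulated index.\<close>

definition sim_good :: "nat \<Rightarrow> 'z \<times> tape list \<Rightarrow> bool" where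
  "sim_good h c \<longleftrightarrow> fst c \<in> ZZ \<and> length (snd c) = Suc k \<and>
     (\<forall>tp\<in>set (snd c). range (fst tp) \<subseteq> \<Gamma> \<and> snd tp \<le> h \<and> (\<forall>j\<ge>h. fst tp j = Blank))"

lemma act_sim_good:
  assumes "range (fst tp) \<subseteq> \<Gamma> \<and> snd tp \<le> h \<and> (\<forall>j\<ge>h. fst tp j = Blank)" "fst a \<in> \<Gamma>"
  shows "range (fst (act a tp)) \<subseteq> \<Gamma> \<and> snd (act a tp) \<le> Suc h \<and> (\<forall>j\<ge>Suc h. fst (act a tp) j = Blank)"
  using assms by (cases tp; cases a; cases "snd a") auto

lemma sim_good_step:
  assumes "sim_good h c"
  shows "sim_good (Suc h) (sim_step b c)"
proof -
  have s: "set (map scanned (snd c)) \<subseteq> \<Gamma>"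
    using assms by (force simp: sim_good_def)
  let ?r = "zstep b (fst c) (map scanned (snd c))"
  have z: "fst ?r \<in> ZZ" "length (snd ?r) = Suc k" "fst ` set (snd ?r) \<subseteq> \<Gamma>"
    using zstep[OF _ s, of "fst c" b] assms by (auto simp: sim_good_def)
  have step: "range (fst (act a tp)) \<subseteq> \<Gamma> \<and> snd (act a tp) \<le> Suc h \<and> (\<forall>j\<ge>Suc h. fst (act a tp) j = Blank)"
    if "(a, tp) \<in> set (zip (snd ?r) (snd c))" for a tp
  proof (rule act_sim_good)
    show "fst a \<in> \<Gamma>" using set_zip_leftD[OF that] z(3) by auto
    show "range (fst tp) \<subseteq> \<Gamma> \<and> snd tp \<le> h \<and> (\<forall>j\<ge>h. fst tp j = Blank)"
      using set_zip_rightD[OF that] assms by (simp add: sim_good_def)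
  qed
  have "\<forall>tp\<in>set (map2 act (snd ?r) (snd c)).
      range (fst tp) \<subseteq> \<Gamma> \<and> snd tp \<le> Suc h \<and> (\<forall>j\<ge>Suc h. fst tp j = Blank)"
  proof
    fix tp' assume "tp' \<in> set (map2 act (snd ?r) (snd c))"
    then obtain a tp where "(a, tp) \<in> set (zip (snd ?r) (snd c))" "tp' = act a tp"
      by auto
    with step show "range (fst tp') \<subseteq> \<Gamma> \<and> snd tp' \<le> Suc h \<and> (\<forall>j\<ge>Suc h. fst tp' j = Blank)"
      by blast
  qed
  then show ?thesis using z(1,2) assms
    unfolding sim_good_def sim_step_def fst_conv snd_conv by simp
qed

lemma decides_Simulate:
  assumes "qs = ps @ bs" "sim_good (length ps) (z, ms)"
    and "foldl (\<lambda>c b. sim_step b c) (z, ms) bs = (z', ms')"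
    and "decides x T (Simulate z' v a, I # W # U # (list_tape qs, Suc (length qs)) # K # S # Z # ms') P"
  shows "decides x (T + length bs)
    (Simulate z v a, I # W # U # (list_tape qs, Suc (length ps)) # K # S # Z # ms) P"
  using assms
proof (induction bs arbitrary: ps z ms)
  case Nil
  then show ?case by simp
next
  case (Cons b bs)
  obtain z1 ms1 where 1: "sim_step b (z, ms) = (z1, ms1)" by fastforce
  then have "sim_good (length (ps @ [b])) (z1, ms1)"
    using sim_good_step[OF Cons.prems(2), of b] by simp
  then have "decides x (T + length bs)
    (Simulate z1 v a, I # W # U # (list_tape qs, Suc (length (ps @ [b]))) # K # S # Z # ms1) P"
    using Cons.prems 1 by (intro Cons.IH) auto
  moreover have "list_tape qs (Suc (length ps)) = Bit b"
    using Cons.prems(1) by (simp add: list_tape_def)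
  moreover have "z1 = fst (zstep b z (map scanned ms))" "ms1 = map2 act (snd (zstep b z (map scanned ms))) ms"
    using 1 by (auto simp: sim_step_def)
  ultimately show ?case
    by (simp add: decides_Suc fun_upd_idem del: list_tape_simps)
qed

text \<open>The simulated tapes have no end marks. As the head that matters is no farther out than
  the digit head (\<open>h \<le> hD\<close>), moving left until all marked tapes are exhausted
  brings it to cell 0. Only the first simulated tape is tracked, since only its index is read
  afterwards.\<close>

lemma decides_Rewind_All:
  assumes "\<And>ms'. decides x T (Copy_Index z v a, (fI, 0) # (fW, 0) # U # (list_tape qs, 0) #
      (list_tape ks, 1) # S # Z # (t, 0) # ms') P"
    and "fW 0 = Blank" "\<And>j. 0 < j \<Longrightarrow> j \<le> hW \<Longrightarrow> fW j = Mark 0"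
    and "hI \<le> hW" "hD \<le> length qs" "hK \<le> length ks" "h \<le> hD"
  shows "decides x (T + hW + hD + hK + 1) (Rewind_All z v a, (fI, hI) # (fW, hW) # U # (list_tape qs, hD) #
      (list_tape ks, hK) # S # Z # (t, h) # ms) P"
  using assms(3-)
proof (induction "hW + hD + hK" arbitrary: hI hW hD hK h ms rule: less_induct)
  case less
  show ?case
  proof (cases "hW + hD + hK = 0")
    case True
    then show ?thesis using less.prems assms(1,2)
      by (simp add: decides_Suc fun_upd_idem)
  next
    case False
    have "decides x (T + (hW - 1) + (hD - 1) + (hK - 1) + 1) (Rewind_All z v a, (fI, hI - 1) # (fW, hW - 1) # U # (list_tape qs, hD - 1) #
      (list_tape ks, hK - 1) # S # Z # (t, h - 1) # map (\<lambda>tp. act (scanned tp, direction.Left) tp) ms) P"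
      using False less.prems by (intro less.hyps) (auto simp: less_diff_conv2 not_less)
    then have "decides x (T + hW + hD + hK) (Rewind_All z v a, (fI, hI - 1) # (fW, hW - 1) # U # (list_tape qs, hD - 1) #
      (list_tape ks, hK - 1) # S # Z # (t, h - 1) # map (\<lambda>tp. act (scanned tp, direction.Left) tp) ms) P"
      by (rule decides_mono) (use False in auto)
    moreover have "fW hW = Blank \<longleftrightarrow> hW = 0" "list_tape qs hD = Blank \<longleftrightarrow> hD = 0"
      "list_tape ks hK = Blank \<longleftrightarrow> hK = 0"
      using less.prems assms(2) by (cases "hW = 0"; auto simp: list_tape_eq_Blank)+
    ultimately show ?thesis using False
      by (auto simp: decides_Suc fun_upd_idem simp del: list_tape_simps)
  qed
qed

lemma decides_Copy_Index:
  assumes "\<And>ms'. decides x T (Add False z v a, I # W # U # D # K # (list_tape ps, length ps) # Z # ms') P"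
    and "\<And>j. j < length ps \<Longrightarrow> t j = Bit (ps ! j)" "\<And>b. t (length ps) \<noteq> Bit b"
    and "j \<le> length ps"
  shows "decides x (T + (length ps - j) + 1) (Copy_Index z v a, I # W # U # D # K # (list_tape (take j ps), Suc j) # Z # (t, j) # ms) P"
  using assms(4)
proof (induction "length ps - j" arbitrary: j ms)
  case 0
  then have j: "j = length ps" by simp
  show ?case using assms(1,3) unfolding j
    by (simp add: decides_Suc list_tape_def fun_upd_idem)
next
  case (Suc n)
  then have j: "j < length ps" by simp
  have "decides x (T + (length ps - Suc j) + 1) (Copy_Index z v a, I # W # U # D # K # (list_tape (take (Suc j) ps), Suc (Suc j)) # Z # (t, Suc j) #
      map (\<lambda>tp. act (scanned tp, direction.Right) tp) ms) P"
    using Suc j by (intro Suc.hyps(1)) auto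
  moreover have "(list_tape (take j ps))(Suc j := Bit (ps ! j)) = list_tape (take (Suc j) ps)"
    using list_tape_upd[of "take j ps" "ps ! j"] j by (simp add: take_Suc_conv_app_nth)
  ultimately have "decides x (Suc (T + (length ps - Suc j) + 1)) (Copy_Index z v a, I # W # U # D # K # (list_tape (take j ps), Suc j) # Z # (t, j) # ms) P"
    using assms(2)[OF j]
    by (subst decides_Suc; cases "ps ! j") (auto simp: fun_upd_idem simp del: list_tape_simps)
  moreover have "T + (length ps - j) + 1 = Suc (T + (length ps - Suc j) + 1)" using j by simp
  ultimately show ?case by simp
qed

text \<open>Invariant of the addition: the digits \<open>zs\<close> written so far, plus
  \<open>2 ^ length zs\<close> times the unread parts and the carry, make up the final sum.\<close>

lemma decides_Add:
  assumes "\<And>zs'. horner_sum of_bool 2 zs' = horner_sum of_bool 2 zs + 2 ^ length zs *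
        (digits_value (take i ps) + horner_sum of_bool 2 (drop j ks) + (of_bool y :: nat)) \<Longrightarrow>
      length zs' \<le> length zs + i + (length ks - j) + 1 \<Longrightarrow>
      decides x T (Pop z v a, I # W # U # D # (list_tape ks, Suc (length ks)) #
          (list_tape ps, 0) # (list_tape zs', length zs') # ms) P"
    and "i \<le> length ps" "j \<le> length ks"
  shows "decides x (T + i + (length ks - j) + 2) (Add y z v a, I # W # U # D # (list_tape ks, Suc j) #
          (list_tape ps, i) # (list_tape zs, Suc (length zs)) # ms) P"
  using assms
proof (induction "i + (length ks - j)" arbitrary: i j y zs rule: less_induct)
  case less
  show ?case
  proof (cases "i = 0 \<and> j = length ks")
    case True
    then have blank: "list_tape ps i = Blank" "list_tape ks (Suc j) = Blank" by auto
    have F: "decides x (Suc T) (Add False z v a, I # W # U # D # (list_tape ks, Suc j) #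
          (list_tape ps, i) # (list_tape zs', Suc (length zs')) # ms) P"
      if "horner_sum of_bool 2 zs' = horner_sum of_bool 2 zs + 2 ^ length zs * (of_bool y :: nat)"
        "length zs' \<le> Suc (length zs)" for zs'
    proof -
      have "decides x T (Pop z v a, I # W # U # D # (list_tape ks, Suc (length ks)) #
          (list_tape ps, 0) # (list_tape zs', length zs') # ms) P"
        using less.prems(1) that True by simp
      moreover have "(list_tape zs')(Suc (length zs') := Blank) = list_tape zs'"
        by (simp add: fun_upd_idem list_tape_def)
      ultimately show ?thesis using True blank by (subst decides_Suc) (simp add: fun_upd_idem)
    qed
    show ?thesis
    proof (cases y)
      case True
      have "horner_sum of_bool 2 (zs @ [True]) = horner_sum of_bool 2 zs + (2 ^ length zs :: nat)"
        by (simp add: horner_sum_append)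
      then have "decides x (Suc T) (Add False z v a, I # W # U # D # (list_tape ks, Suc j) #
          (list_tape ps, i) # (list_tape (zs @ [True]), Suc (length (zs @ [True]))) # ms) P"
        using F[of "zs @ [True]"] True by simp
      then have "decides x (Suc (Suc T)) (Add y z v a, I # W # U # D # (list_tape ks, Suc j) #
          (list_tape ps, i) # (list_tape zs, Suc (length zs)) # ms) P"
        using True blank by (subst decides_Suc) (simp add: list_tape_upd fun_upd_idem del: list_tape_simps)
      then show ?thesis using \<open>i = 0 \<and> j = length ks\<close> by simp
    next
      case False
      then show ?thesis using F[of zs] \<open>i = 0 \<and> j = length ks\<close> by (auto elim: decides_mono)
    qed
  next
    case False
    define p where "p = (0 < i \<and> ps ! (i - 1))"
    define q where "q = (j < length ks \<and> ks ! j)"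
    define t :: nat where "t = of_bool y + of_bool p + of_bool q"
    define j' where "j' = (if j < length ks then Suc j else j)"
    have sp: "list_tape ps i = (if 0 < i then Bit p else Blank)"
      using less.prems(2) by (auto simp: list_tape_def p_def)
    have sq: "list_tape ks (Suc j) = (if j < length ks then Bit q else Blank)"
      by (auto simp: q_def)
    have idem: "(list_tape ks)(Suc j := (if j < length ks then Bit q else Blank)) = list_tape ks"
      "(list_tape ps)(i := (if 0 < i then Bit p else Blank)) = list_tape ps"
      unfolding sp[symmetric] sq[symmetric] by (rule fun_upd_triv)+
    have vp: "digits_value (take i ps) = 2 * digits_value (take (i - 1) ps) + (of_bool p :: nat)"
      using less.prems(2) by (cases i) (auto simp: p_def take_Suc_conv_app_nth)
    have vq: "horner_sum of_bool 2 (drop j ks) = 2 * horner_sum of_bool 2 (drop j' ks) + (of_bool q :: nat)"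
      by (auto simp: q_def j'_def simp flip: Cons_nth_drop_Suc)
    have "decides x (T + (i - 1) + (length ks - j') + 2) (Add (t \<ge> 2) z v a, I # W # U # D # (list_tape ks, Suc j') #
          (list_tape ps, i - 1) # (list_tape (zs @ [odd t]), Suc (length (zs @ [odd t]))) # ms) P"
    proof (rule less.hyps)
      show "i - 1 + (length ks - j') < i + (length ks - j)"
        using False less.prems by (auto simp: j'_def)
      show "i - 1 \<le> length ps" "j' \<le> length ks" using less.prems by (auto simp: j'_def)
      fix zs'
      assume h: "horner_sum of_bool 2 zs' = horner_sum of_bool 2 (zs @ [odd t]) + 2 ^ length (zs @ [odd t]) *
        (digits_value (take (i - 1) ps) + horner_sum of_bool 2 (drop j' ks) + (of_bool (2 \<le> t) :: nat))"
        and l: "length zs' \<le> length (zs @ [odd t]) + (i - 1) + (length ks - j') + 1"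
      have "t = of_bool (odd t) + 2 * of_bool (2 \<le> t)"
        by (auto simp: t_def)
      then have "horner_sum of_bool 2 zs' = horner_sum of_bool 2 zs + 2 ^ length zs *
        (digits_value (take i ps) + horner_sum of_bool 2 (drop j ks) + (of_bool y :: nat))"
        unfolding h vp vq by (simp add: horner_sum_append t_def algebra_simps)
      moreover have "length zs' \<le> length zs + i + (length ks - j) + 1"
        using l False less.prems by (auto simp: j'_def split: if_splits)
      ultimately show "decides x T (Pop z v a, I # W # U # D # (list_tape ks, Suc (length ks)) #
          (list_tape ps, 0) # (list_tape zs', length zs') # ms) P"
        by (rule less.prems(1))
    qed
    then have "decides x (T + i + (length ks - j) + 1) (Add (t \<ge> 2) z v a, I # W # U # D # (list_tape ks, Suc j') #
          (list_tape ps, i - 1) # (list_tape (zs @ [odd t]), Suc (length (zs @ [odd t]))) # ms) P"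
      by (rule decides_mono) (use False less.prems in \<open>auto simp: j'_def\<close>)
    moreover have "\<not> (list_tape ps i = Blank \<and> list_tape ks (Suc j) = Blank)"
      using False less.prems unfolding sp sq by auto
    moreover have "of_bool y + of_bool (list_tape ps i = Bit True) + of_bool (list_tape ks (Suc j) = Bit True) = t"
      unfolding sp sq t_def by (auto simp: p_def q_def)
    ultimately have "decides x (Suc (T + i + (length ks - j) + 1)) (Add y z v a, I # W # U # D # (list_tape ks, Suc j) #
          (list_tape ps, i) # (list_tape zs, Suc (length zs)) # ms) P"
      unfolding decides_Suc using idem
      by (cases "0 < i"; cases "j < length ks")
         (auto simp: list_tape_upd sp sq j'_def simp del: list_tape_simps)
    then show ?thesis by simp
  qed
qed

lemma decides_Pop:
  assumes "\<And>f'. (\<And>j. j < length zs \<Longrightarrow> f' j = Bit (rev zs ! j)) \<Longrightarrow> f' (length zs) = Blank \<Longrightarrow>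
      decides x T (Final_Query z v a, (f', length zs) # W # U # D # K # S # (list_tape zs, 0) # ms) P"
    and "i \<le> length zs" "\<And>j. j < length zs - i \<Longrightarrow> f j = Bit (rev zs ! j)"
  shows "decides x (T + i + 1) (Pop z v a, (f, length zs - i) # W # U # D # K # S # (list_tape zs, i) # ms) P"
  using assms(2,3)
proof (induction i arbitrary: f)
  case 0
  then show ?case using assms(1)[of "f(length zs := Blank)"] by (simp add: decides_Suc fun_upd_idem)
next
  case (Suc i)
  have "zs ! i = rev zs ! (length zs - Suc i)" using Suc.prems(1) by (simp add: rev_nth)
  then have "decides x (T + i + 1) (Pop z v a, (f(length zs - Suc i := Bit (zs ! i)), length zs - i) # W # U # D # K # S # (list_tape zs, i) # ms) P"
    using Suc.prems by (intro Suc.IH) (auto simp: less_Suc_eq)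
  then show ?case using Suc.prems(1) by (simp add: decides_Suc Suc_diff_Suc fun_upd_idem)
qed

text \<open>The simulated machine addresses positions of \<open>x\<close>, which lie behind
  \<open>pre\<close> in the actual input. Adding \<open>length pre\<close>, held in binary by
  \<open>ks\<close>, to the simulated index leaves the observation unchanged, also when it is
  \<open>Outside\<close>.\<close>

lemma decides_leaf:
  assumes good: "sim_good (length qs) (z, ms)"
    and W: "fW 0 = Blank" "\<And>j. 0 < j \<Longrightarrow> j \<le> hI \<Longrightarrow> fW j = Mark 0"
    and y: "y = pre @ x" "length pre = horner_sum of_bool 2 ks"
    and T: "hI + 4 * length qs + 3 * length ks + 20 \<le> T"
  shows "decides y T (Simulate z v a, (fI, hI) # (fW, Suc hI) # U # (list_tape qs, Suc (length qs)) #
      (list_tape ks, Suc (length ks)) # (list_tape [], 1) # (list_tape [], 1) # ms)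
      (blk (leaf x (z, ms)) ! v = a)"
proof (cases "lf z")
  case None
  have "decides y (Suc 0) (Simulate z v a, (fI, hI) # (fW, Suc hI) # U # (list_tape qs, Suc (length qs)) #
      (list_tape ks, Suc (length ks)) # (list_tape [], 1) # (list_tape [], 1) # ms)
      (blk (leaf x (z, ms)) ! v = a)"
    unfolding decides_Suc by (simp add: None) (rule decides_answer, simp add: leaf_def None)
  then show ?thesis by (rule decides_mono) (use T in simp)
next
  case (Some ob)
  obtain t h mr where ms: "ms = (t, h) # mr" using good
    by (cases ms) (auto simp: sim_good_def)
  have h: "h \<le> length qs" and blank: "t (length qs) = Blank" using good ms by (auto simp: sim_good_def)
  \<comment> \<open>The length of the simulated index; it is at most \<open>length qs\<close>,
    because the tape is blank from there on.\<close>
  define l where "l = (LEAST n. \<forall>b. t n \<noteq> Bit b)"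
  define ps where "ps = map (\<lambda>j. t j = Bit True) [0..<l]"
  have l1: "\<forall>b. t l \<noteq> Bit b" unfolding l_def by (rule LeastI[of _ "length qs"]) (simp add: blank)
  have l2: "l \<le> length qs" unfolding l_def by (rule Least_le) (simp add: blank)
  have bits: "t j = Bit (ps ! j)" if "j < l" for j
    using not_less_Least[of j "\<lambda>n. \<forall>b. t n \<noteq> Bit b"] that by (auto simp: ps_def l_def[symmetric])
  have lps: "length ps = l" by (simp add: ps_def)
  have iv: "index_value (t, h) = digits_value ps"
    by (rule index_value_eq) (use l1 bits lps in auto)
  let ?P = "blk (leaf x (z, ms)) ! v = a"
  have fin: "decides y 1 (Final_Query z v a, (f', p) # W # U # D # K # S # Z # ms') ?P"
    if "index_value (f', p) = digits_value ps + length pre" for f' p W D K S Z ms'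
  proof -
    have "position_observation y (f', p) = position_observation x (t, h)"
      unfolding position_observation_def that iv y(1) Let_def by (simp add: nth_append)
    then have "(lf z = Some (position_observation y (f', p))) = (position_observation x (t, h) = ob)"
      using Some by auto
    then show ?thesis unfolding One_nat_def decides_Suc
      by simp (rule decides_answer, simp add: leaf_def Some ms)
  qed
  have add: "decides y (2 * l + 2 * length ks + 7) (Add False z v a, (fI, 0) # W # U # D # (list_tape ks, 1) #
      (list_tape ps, length ps) # (list_tape [], 1) # ms') ?P" for W D ms'
  proof -
    have "decides y (l + length ks + 4 + length ps + (length ks - 0) + 2) (Add False z v a, (fI, 0) # W # U # D # (list_tape ks, Suc 0) #
      (list_tape ps, length ps) # (list_tape [], Suc (length ([] :: bool list))) # ms') ?P"
    proof (rule decides_Add)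
      fix zs :: "bool list"
      assume zs: "horner_sum of_bool 2 zs = horner_sum of_bool 2 ([] :: bool list) + 2 ^ length ([] :: bool list) *
        (digits_value (take (length ps) ps) + horner_sum of_bool 2 (drop 0 ks) + (of_bool False :: nat))"
        and len: "length zs \<le> length ([] :: bool list) + length ps + (length ks - 0) + 1"
      have "decides y (1 + length zs + 1) (Pop z v a, (fI, length zs - length zs) # W # U # D # (list_tape ks, Suc (length ks)) #
          (list_tape ps, 0) # (list_tape zs, length zs) # ms') ?P"
      proof (rule decides_Pop)
        fix f' assume "\<And>j. j < length zs \<Longrightarrow> f' j = Bit (rev zs ! j)" "f' (length zs) = Blank"
        then have "index_value (f', length zs) = digits_value (rev zs)"
          by (intro index_value_eq) auto
        then show "decides y 1 (Final_Query z v a, (f', length zs) # W # U # D # (list_tape ks, Suc (length ks)) #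
          (list_tape ps, 0) # (list_tape zs, 0) # ms') ?P"
          by (intro fin) (use zs y in simp)
      qed auto
      then show "decides y (l + length ks + 4) (Pop z v a, (fI, 0) # W # U # D # (list_tape ks, Suc (length ks)) #
          (list_tape ps, 0) # (list_tape zs, length zs) # ms') ?P"
        by (auto elim!: decides_mono) (use len lps in simp)
    qed auto
    then show ?thesis by (auto elim!: decides_mono simp: lps)
  qed
  have copy: "decides y (3 * l + 2 * length ks + 8) (Copy_Index z v a, (fI, 0) # (fW, 0) # U # (list_tape qs, 0) # (list_tape ks, 1) #
      (list_tape [], 1) # (list_tape [], 1) # (t, 0) # ms') ?P" for ms'
  proof -
    have "decides y (2 * l + 2 * length ks + 7 + (length ps - 0) + 1) (Copy_Index z v a, (fI, 0) # (fW, 0) # U # (list_tape qs, 0) # (list_tape ks, 1) #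
      (list_tape (take 0 ps), Suc 0) # (list_tape [], 1) # (t, 0) # ms') ?P"
      by (rule decides_Copy_Index) (use add l1 bits lps in auto)
    then show ?thesis by (auto elim!: decides_mono simp: lps)
  qed
  have "decides y (3 * l + 2 * length ks + 8 + hI + length qs + length ks + 1) (Rewind_All z v a, (fI, hI) # (fW, hI) # U #
      (list_tape qs, length qs) # (list_tape ks, length ks) # (list_tape [], 1) # (list_tape [], 1) # (t, h) # mr) ?P"
    by (rule decides_Rewind_All) (use copy W h in auto)
  then have "decides y (Suc (3 * l + 2 * length ks + 8 + hI + length qs + length ks + 1)) (Simulate z v a, (fI, hI) # (fW, Suc hI) # U #
      (list_tape qs, Suc (length qs)) # (list_tape ks, Suc (length ks)) # (list_tape [], 1) # (list_tape [], 1) # ms) ?P"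
    unfolding decides_Suc by (simp add: Some ms fun_upd_idem)
  then show ?thesis by (rule decides_mono) (use T l2 in simp)
qed

end

section \<open>Parsing triples\<close>

abbreviation flagged :: "bool list \<Rightarrow> bool list" where
  "flagged ds \<equiv> concat (map (\<lambda>b. [True, b]) ds)"

lemma length_flagged [simp]: "length (flagged ds) = 2 * length ds"
  by (induction ds) auto

lemma flagged_eq_iff:
  "flagged ds @ False # u = flagged es @ False # v \<longleftrightarrow> ds = es \<and> u = v"
proof (induction ds arbitrary: es)
  case Nil
  then show ?case by (cases es) auto
next
  case (Cons b ds)
  then show ?case by (cases es) auto
qed

text \<open>Whatever triple the input turns out to be, the digits read so far begin its address.
  This allows rejecting before the address has been read to its end.\<close>

lemma flagged_prefix:
  assumes "flagged ds @ u = flagged es @ False # v"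
  shows "prefix ds es"
  using assms
proof (induction ds arbitrary: es)
  case (Cons b ds)
  then show ?case by (cases es) auto
qed simp

lemma binary_nonempty: "binary i \<noteq> []"
  by (subst binary.simps) simp

lemma hd_binary: "0 < i \<Longrightarrow> hd (binary i)"
proof (induction i rule: binary.induct)
  case (1 i)
  then show ?case
    by (subst binary.simps) (auto simp: binary_nonempty hd_append)
qed

lemma digits_value_binary: "digits_value (binary i) = i"
proof (induction i rule: binary.induct)
  case (1 i)
  then show ?case
    by (subst binary.simps) auto
qed

text \<open>Numerals without leading zero, and the single digit 0, are exactly the results of
  \<open>binary\<close>; so checking the first digit suffices to recognize an address.\<close>

lemma binary_digits_value: "ds \<noteq> [] \<Longrightarrow> hd ds \<or> length ds = 1 \<Longrightarrow> binary (digits_value ds) = ds"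
proof (induction ds rule: rev_induct)
  case (snoc b ds)
  show ?case
  proof (cases "ds = []")
    case True
    then show ?thesis by (subst binary.simps) simp
  next
    case False
    then have h: "hd ds" using snoc.prems by (auto simp: hd_append)
    then obtain es where "ds = True # es" using False by (cases ds) auto
    then have "digits_value ds \<ge> 1"
      using digits_value_append[of "[True]" es] by (simp add: Suc_le_eq)
    then show ?thesis using snoc.IH[OF False] h
      by (subst binary.simps) auto
  qed
qed simp

lemma prefix_binary:
  assumes "prefix ds (binary i)" "ds \<noteq> []"
  shows "hd ds \<or> i = 0 \<and> ds = [False]"
proof (cases "i = 0")
  case True
  then have "binary i = [False]" by (subst binary.simps) simp
  then show ?thesis using assms True by (auto simp: prefix_Cons)
next
  case False
  then show ?thesis using assms hd_binary[of i] by (cases ds; cases "binary i") auto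
qed

lemma nth_concat_blocks:
  assumes "\<And>x. x \<in> set xs \<Longrightarrow> length x = n" "q < length xs" "m < n"
  shows "concat xs ! (q * n + m) = xs ! q ! m"
  using assms
proof (induction xs arbitrary: q)
  case (Cons x xs)
  then show ?case by (cases q) (auto simp: nth_append algebra_simps)
qed simp

lemma length_concat_blocks:
  "(\<And>x. x \<in> set xs \<Longrightarrow> length x = n) \<Longrightarrow> length (concat xs) = length xs * n"
  by (induction xs) auto

section \<open>The addressed word and long division of addresses\<close>

context addressing
begin

abbreviation "initial_tapes \<equiv> replicate (Suc k) (\<lambda>_. Blank, 0) :: tape list"

text \<open>The answer to a query at the index consisting of \<open>g\<close> ones and
  \<open>s\<close> more digits: the triple is longer than \<open>x\<close> by
  \<open>2 * C * g\<close> and a bounded amount, and the \<open>s\<close> digits cancel the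
  latter.\<close>

definition in_range :: "nat \<Rightarrow> nat \<Rightarrow> bool" where
  "in_range n g \<longleftrightarrow> 2 ^ s * (2 ^ g - 1) \<le> n + 2 * C * g"

definition top_window :: "nat \<Rightarrow> nat" where
  "top_window n = (LEAST g. \<not> in_range n (Suc g))"

definition depth :: "nat \<Rightarrow> nat" where
  "depth n = C * Suc (top_window n)"

text \<open>Thanks to the leading blocks, the binary digits of the number of a block in the second half are
  \<open>True\<close> followed by the path to its leaf.\<close>

definition blocks :: "bool list \<Rightarrow> 'e list" where
  "blocks x = replicate (2 ^ depth (length x)) e1 @ leaves x (depth (length x)) (z0, initial_tapes)"

definition addressed_word :: "bool list \<Rightarrow> bool list" where
  "addressed_word x = concat (map blk (blocks x))"

definition target :: "bool list set" where
  "target = {triple x a i | x a i. i < length (addressed_word x) \<and> addressed_word x ! i = a}"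

lemma two_C: "2 * C \<le> 2 ^ s"
proof -
  have "2 * C \<le> 2 * C * s" using s by simp
  then show ?thesis using big by linarith
qed

lemma in_range_0: "in_range n 0"
  by (simp add: in_range_def)

text \<open>A further window adds at least \<open>2 ^ s\<close> on the left but only
  \<open>2 * C\<close> on the right.\<close>

lemma in_range_Suc_D:
  assumes "in_range n (Suc g)" shows "in_range n g"
proof -
  have "2 ^ s * (2 ^ Suc g - 1) = 2 ^ s * (2 ^ g - 1) + 2 ^ s * (2::nat) ^ g"
    by (simp add: diff_mult_distrib2 algebra_simps)
  moreover have "2 * C \<le> 2 ^ s * (2::nat) ^ g"
    using mult_le_mono[OF two_C, of 1 "2 ^ g"] by simp
  ultimately show ?thesis using assms unfolding in_range_def by simp
qed

lemma in_range_antimono: "in_range n h \<Longrightarrow> g \<le> h \<Longrightarrow> in_range n g"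
  by (induction h) (auto simp: le_Suc_eq dest: in_range_Suc_D)

text \<open>Cancelling the factor \<open>2 ^ s\<close> bounds \<open>2 ^ g\<close> linearly in
  \<open>n\<close>, up to \<open>g\<close> itself; the polynomial length of the word rests on
  this.\<close>

lemma in_range_bound:
  assumes "in_range n g" shows "2 ^ g \<le> n + Suc g"
proof -
  have "2 ^ s * (2 ^ g - 1) \<le> n + 2 ^ s * g"
    using assms two_C mult_le_mono1[OF two_C, of g] unfolding in_range_def by linarith
  then have "2 ^ s * (2 ^ g - 1 - g) \<le> n" by (simp add: diff_mult_distrib2)
  moreover have "2 ^ g - 1 - g \<le> 2 ^ s * ((2::nat) ^ g - 1 - g)" by simp
  ultimately show ?thesis by linarith
qed

lemma not_in_range_top: "\<not> in_range n (Suc (top_window n))"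
proof -
  \<comment> \<open>Some window is missing for every \<open>n\<close>, so the \<open>LEAST\<close>
    in \<open>top_window\<close> is attained.\<close>
  have "n + Suc (Suc (n + 3)) < 2 ^ Suc (n + 3)"
  proof (induction n)
    case (Suc n)
    have "(2::nat) ^ Suc (Suc n + 3) = 2 ^ Suc (n + 3) + 2 ^ Suc (n + 3)"
      unfolding add_Suc power_Suc[of _ "Suc (n + 3)"] by linarith
    moreover have "(2::nat) ^ 1 \<le> 2 ^ Suc (n + 3)" by (rule power_increasing) auto
    then have "2 \<le> (2::nat) ^ Suc (n + 3)" by (simp only: power_one_right)
    ultimately show ?case using Suc by linarith
  qed simp
  then have "\<not> in_range n (Suc (n + 3))" using in_range_bound[of n "Suc (n + 3)"] by linarith
  then show ?thesis unfolding top_window_def by (rule LeastI)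
qed

lemma in_range_iff: "in_range n g \<longleftrightarrow> g \<le> top_window n"
proof
  assume "in_range n g"
  then show "g \<le> top_window n"
    using in_range_antimono[of n g "Suc (top_window n)"] not_in_range_top[of n] by linarith
next
  assume g: "g \<le> top_window n"
  show "in_range n g"
  proof (cases g)
    case 0
    then show ?thesis by (simp add: in_range_0)
  next
    case (Suc h)
    then show ?thesis using not_less_Least[of h "\<lambda>g. \<not> in_range n (Suc g)"] g
      by (auto simp: top_window_def)
  qed
qed

lemma length_blocks: "length (blocks x) = 2 ^ Suc (depth (length x))"
  by (simp add: blocks_def length_leaves)

lemma leaf_in_EE: "fst c \<in> ZZ \<Longrightarrow> leaf x c \<in> EE"
  by (simp add: leaf_def out)

lemma leaves_in_EE: "sim_good h c \<Longrightarrow> set (leaves x n c) \<subseteq> EE"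
proof (induction n arbitrary: h c)
  case 0
  then show ?case by (simp add: leaf_in_EE sim_good_def)
next
  case (Suc n)
  have "set (leaves x n (sim_step b c)) \<subseteq> EE" for b
    using Suc.IH sim_good_step[OF Suc.prems, of b] .
  then show ?case by simp
qed

lemma sim_good_initial: "sim_good 0 (z0, initial_tapes)"
  using z0 Gamma by (auto simp: sim_good_def)

lemma blocks_in_EE: "set (blocks x) \<subseteq> EE"
  using leaves_in_EE[OF sim_good_initial] e1 by (auto simp: blocks_def)

lemma length_addressed_word: "length (addressed_word x) = 2 ^ Suc (depth (length x)) * B"
  unfolding addressed_word_def
  using blocks_in_EE blk by (subst length_concat_blocks[where n = B]) (auto simp: length_blocks)

lemma nth_addressed_word:
  "q < 2 ^ Suc (depth (length x)) \<Longrightarrow> m < B \<Longrightarrow> addressed_word x ! (q * B + m) = blk (blocks x ! q) ! m"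
  unfolding addressed_word_def
  using blocks_in_EE blk by (subst nth_concat_blocks[where n = B]) (auto simp: length_blocks)

text \<open>The state of the division after reading the digits \<open>ds\<close>: the quotient has the digits
  \<open>True # qs\<close>, and \<open>g\<close> windows are complete except for the \<open>r\<close> digits of the last one.\<close>

definition dividing :: "bool list \<Rightarrow> nat \<Rightarrow> nat \<Rightarrow> nat \<Rightarrow> nat \<Rightarrow> bool list \<Rightarrow> bool" where
  "dividing ds j m r g qs \<longleftrightarrow> length ds = j + length qs \<and> digits_value ds = digits_value (True # qs) * B + m \<and>
     m < B \<and> length qs = C * g + r \<and> r \<le> C \<and> (r = 0 \<longrightarrow> g = 0) \<and> 1 \<le> j \<and> j \<le> B \<and> hd ds"

text \<open>A step of long division. A full window is closed only when the next digit arrives; hence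
  a path that ends in a leaf is still met with \<open>r = C\<close>.\<close>

lemma dividing_next:
  assumes "dividing ds j m r g qs"
  shows "dividing (ds @ [b]) j ((2 * m + of_bool b) mod B) (if r = C then 1 else Suc r)
     (if r = C then Suc g else g) (qs @ [B \<le> 2 * m + of_bool b])"
proof -
  have "2 * m + of_bool b < 2 * B" using assms by (cases b) (auto simp: dividing_def)
  then have e: "2 * m + of_bool b = of_bool (B \<le> 2 * m + of_bool b) * B + (2 * m + of_bool b) mod B"
    by (auto simp: mod_if)
  have "digits_value (ds @ [b]) = 2 * (digits_value (True # qs) * B) + (2 * m + of_bool b)"
    using assms by (simp add: dividing_def)
  also have "\<dots> = digits_value ((True # qs) @ [B \<le> 2 * m + of_bool b]) * B + (2 * m + of_bool b) mod B"
    by (subst e) (simp add: algebra_simps)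
  finally show ?thesis using assms B C unfolding dividing_def
    by (cases ds) auto
qed

lemma dividing_div_mod:
  assumes "dividing ds j m r g qs"
  shows "digits_value ds div B = digits_value (True # qs)" "digits_value ds mod B = m"
  using assms by (auto simp: dividing_def)

lemma digits_value_True_Cons: "digits_value (True # qs) = 2 ^ length qs + digits_value qs"
  using digits_value_append[of "[True]" qs] by simp

text \<open>The number of blocks is a power of two, so the range of the quotient depends only on its
  number of digits; and \<open>depth\<close> is a multiple of \<open>C\<close>, so it depends only
  on the window in which the last digit lies.\<close>

lemma dividing_in_range:
  assumes "dividing ds j m r g qs"
  shows "digits_value ds < length (addressed_word x) \<longleftrightarrow> in_range (length x) g"
proof -
  let ?E = "depth (length x)"
  have "digits_value ds < length (addressed_word x) \<longleftrightarrow> digits_value (True # qs) < 2 ^ Suc ?E"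
    unfolding dividing_div_mod(1)[OF assms, symmetric] length_addressed_word
    using B by (simp add: less_mult_imp_div_less div_less_iff_less_mult)
  also have "\<dots> \<longleftrightarrow> length qs < Suc ?E"
  proof
    assume "digits_value (True # qs) < 2 ^ Suc ?E"
    then have "(2::nat) ^ length qs < 2 ^ Suc ?E" unfolding digits_value_True_Cons by linarith
    then show "length qs < Suc ?E" using power_less_imp_less_exp by (metis one_less_numeral_iff semiring_norm(76))
  next
    assume "length qs < Suc ?E"
    then have "(2::nat) ^ Suc (length qs) \<le> 2 ^ Suc ?E" by (intro power_increasing) auto
    then show "digits_value (True # qs) < 2 ^ Suc ?E"
      using digits_value_less[of "True # qs"] by (simp only: length_Cons)
  qed
  also have "\<dots> \<longleftrightarrow> g \<le> top_window (length x)"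
  proof -
    have q: "length qs = C * g + r" "r \<le> C" "r = 0 \<longrightarrow> g = 0" using assms by (auto simp: dividing_def)
    show ?thesis
    proof
      assume "length qs < Suc ?E"
      then have *: "C * g + r \<le> C * Suc (top_window (length x))" using q by (simp add: depth_def)
      show "g \<le> top_window (length x)"
      proof (rule ccontr)
        assume "\<not> g \<le> top_window (length x)"
        then have "C * Suc (top_window (length x)) \<le> C * g" "0 < g"
          by (auto simp del: mult_Suc_right intro: mult_le_mono2)
        then show False using * q by auto
      qed
    next
      assume "g \<le> top_window (length x)"
      then have "C * Suc g \<le> ?E" unfolding depth_def by (intro mult_le_mono) auto
      then show "length qs < Suc ?E" using q by simp
    qed
  qed
  finally show ?thesis by (simp add: in_range_iff)
qed

text \<open>A quotient with fewer digits than the largest ones lies in the leading half, where every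
  block is \<open>e1\<close>. With the maximal number of digits, those after the first are the path
  to a leaf.\<close>

lemma dividing_letter:
  assumes "dividing ds j m r g qs" "in_range (length x) g"
  shows "addressed_word x ! digits_value ds = blk
     (if r = C \<and> \<not> in_range (length x) (Suc g)
      then leaf x (foldl (\<lambda>c b. sim_step b c) (z0, initial_tapes) qs) else e1) ! m"
proof -
  let ?E = "depth (length x)"
  have q: "length qs = C * g + r" "r \<le> C" "m < B" using assms by (auto simp: dividing_def)
  have lt: "digits_value (True # qs) < 2 ^ Suc ?E"
  proof -
    have "digits_value ds < 2 ^ Suc ?E * B"
      using dividing_in_range[OF assms(1), of x] assms(2) by (simp add: length_addressed_word)
    then show ?thesis unfolding dividing_div_mod(1)[OF assms(1), symmetric]
      by (simp add: less_mult_imp_div_less)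
  qed
  have "digits_value ds = digits_value (True # qs) * B + m" using assms by (simp add: dividing_def)
  then have 1: "addressed_word x ! digits_value ds = blk (blocks x ! digits_value (True # qs)) ! m"
    using nth_addressed_word[OF lt q(3)] by simp
  have g: "g \<le> top_window (length x)" using assms(2) by (simp add: in_range_iff)
  have top: "\<not> in_range (length x) (Suc g) \<longleftrightarrow> g = top_window (length x)"
    using g by (auto simp: in_range_iff)
  show ?thesis
  proof (cases "r = C \<and> g = top_window (length x)")
    case True
    then have E: "length qs = ?E" using q by (simp add: depth_def)
    have "blocks x ! digits_value (True # qs) = leaves x (length qs) (z0, initial_tapes) ! digits_value qs"
      unfolding blocks_def digits_value_True_Cons E by (simp add: nth_append del: replicate.simps)
    then show ?thesis unfolding 1 using True top by (simp only: nth_leaves if_True simp_thms)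
  next
    case False
    have "length qs < ?E"
    proof (cases "g = top_window (length x)")
      case True
      then show ?thesis using False q by (simp add: depth_def)
    next
      case False
      then have "C * Suc (Suc g) \<le> ?E" unfolding depth_def using g by (intro mult_le_mono) auto
      then show ?thesis using q C by simp
    qed
    then have "(2::nat) ^ Suc (length qs) \<le> 2 ^ ?E" by (intro power_increasing) auto
    then have "blocks x ! digits_value (True # qs) = e1"
      using digits_value_less[of "True # qs"] unfolding blocks_def by (simp add: nth_append del: rev.simps)
    then show ?thesis unfolding 1 using False top by auto
  qed
qed

lemma small_letter:
  assumes "i < B"
  shows "i < length (addressed_word x)" "addressed_word x ! i = blk e1 ! i"
proof -
  have "B \<le> 2 ^ Suc (depth (length x)) * B" by simp
  then show "i < length (addressed_word x)" using assms unfolding length_addressed_word by linarith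
  show "addressed_word x ! i = blk e1 ! i"
    using nth_addressed_word[of 0 x i] assms by (simp add: blocks_def nth_append)
qed

lemma triple_in_target: 
  "ds \<noteq> [] \<Longrightarrow> hd ds \<or> length ds = 1 \<Longrightarrow> flagged ds @ False # a # x \<in> target \<longleftrightarrow>
     digits_value ds < length (addressed_word x) \<and> addressed_word x ! digits_value ds = a"
  using binary_digits_value[of ds] digits_value_binary
  unfolding target_def triple_def by (force simp: flagged_eq_iff)

lemma in_targetD:
  assumes "flagged ds @ rest \<in> target"
  obtains x a i where "flagged ds @ rest = flagged (binary i) @ False # a # x" "prefix ds (binary i)"
     "i < length (addressed_word x)" "addressed_word x ! i = a"
proof -
  obtain x a i where 1: "flagged ds @ rest = flagged (binary i) @ False # a # x"
     "i < length (addressed_word x)" "addressed_word x ! i = a"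
    using assms by (auto simp: target_def triple_def)
  then show ?thesis using that flagged_prefix[OF 1(1)] by blast
qed


section \<open>After the address: testing its range and evaluating the letter\<close>

text \<open>The cells before the head of the index tape hold \<open>bs\<close>, and the companion tape marks their number.\<close>

definition index_holds :: "bool list \<Rightarrow> (nat \<Rightarrow> symbol) \<Rightarrow> (nat \<Rightarrow> symbol) \<Rightarrow> bool" where
  "index_holds bs f fW \<longleftrightarrow> (\<forall>j<length bs. f j = Bit (bs ! j)) \<and>
     fW 0 = Blank \<and> (\<forall>j. 0 < j \<and> j \<le> length bs \<longrightarrow> fW j = Mark 0)"

lemma index_holds_snoc:
  "index_holds bs f fW \<Longrightarrow>
     index_holds (bs @ [b]) (f(length bs := Bit b)) (fW(Suc (length bs) := Mark 0))"
  by (auto simp: index_holds_def nth_append less_Suc_eq)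

lemma index_holds_append: "index_holds (bs @ cs) f fW \<Longrightarrow> index_holds bs f fW"
  by (auto simp: index_holds_def nth_append)

text \<open>Cells behind the head may hold leftovers of the counter; the closing blank cuts them
  off, so that the index is exactly \<open>bs @ cs\<close>.\<close>

lemma decides_Write:
  assumes "\<And>f' fW'. index_holds (bs @ cs) f' fW' \<Longrightarrow> f' (length (bs @ cs)) = Blank \<Longrightarrow>
      decides x T (q, (f', length (bs @ cs)) # (fW', Suc (length (bs @ cs))) # U # D # K # S # Z # ms) P"
    and "index_holds bs f fW"
  shows "decides x (T + length cs + 1) (Write cs q, (f, length bs) # (fW, Suc (length bs)) # U # D # K # S # Z # ms) P"
  using assms
proof (induction cs arbitrary: bs f fW)
  case Nil
  define f1 where "f1 = f(length bs := Blank)"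
  have "index_holds bs f1 fW" "f1 (length bs) = Blank"
    using Nil.prems(2) by (auto simp: index_holds_def f1_def)
  then have "decides x T (q, (f1, length bs) # (fW, Suc (length bs)) # U # D # K # S # Z # ms) P"
    using Nil.prems(1)[of f1 fW] by simp
  then show ?case by (simp add: decides_Suc f1_def)
next
  case (Cons c cs)
  define f1 fW1 where "f1 = f(length bs := Bit c)" and "fW1 = fW(Suc (length bs) := Mark 0)"
  have "index_holds (bs @ [c]) f1 fW1"
    using index_holds_snoc[OF Cons.prems(2), of c] by (simp add: f1_def fW1_def)
  then have "decides x (T + length cs + 1) (Write cs q, (f1, length (bs @ [c])) #
      (fW1, Suc (length (bs @ [c]))) # U # D # K # S # Z # ms) P"
    using Cons.prems(1) by (intro Cons.IH) simp_all
  then have "decides x (Suc (T + length cs + 1)) (Write (c # cs) q, (f, length bs) # (fW, Suc (length bs)) # U # D # K # S # Z # ms) P"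
    by (subst decides_Suc) (simp add: f1_def fW1_def)
  then show ?case by simp
qed

lemma decides_Ones:
  assumes "\<And>f' fW'. index_holds (replicate (p + u) True) f' fW' \<Longrightarrow>
      decides x T (Write (digits s (2 * r + 2 * j + 1)) (Range_Query j m r a),
        (f', p + u) # (fW', Suc (p + u)) # (tally_tape w, 0) # D # K # S # Z # ms) P"
    and "index_holds (replicate p True) f fW" "u \<le> w"
  shows "decides x (T + u + 1) (Ones j m r a, (f, p) # (fW, Suc p) # (tally_tape w, u) # D # K # S # Z # ms) P"
  using assms
proof (induction u arbitrary: p f fW)
  case 0
  then show ?case by (simp add: decides_Suc tally_tape_def fun_upd_idem)
next
  case (Suc u)
  define f1 fW1 where "f1 = f(p := Bit True)" and "fW1 = fW(Suc p := Mark 0)"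
  have "index_holds (replicate (Suc p) True) f1 fW1"
    using index_holds_snoc[OF Suc.prems(2), of True] by (simp add: replicate_append_same f1_def fW1_def)
  then have "decides x (T + u + 1) (Ones j m r a, (f1, Suc p) # (fW1, Suc (Suc p)) # (tally_tape w, u) # D # K # S # Z # ms) P"
    using Suc.prems(1,3) by (intro Suc.IH) simp_all
  moreover have "tally_tape w (Suc u) = Mark 0" using Suc.prems by (simp add: tally_tape_def)
  ultimately have "decides x (Suc (T + u + 1)) (Ones j m r a, (f, p) # (fW, Suc p) # (tally_tape w, Suc u) # D # K # S # Z # ms) P"
    by (subst decides_Suc) (simp add: fun_upd_idem f1_def fW1_def)
  then show ?case by simp
qed

lemma decides_Shift_Left:
  assumes "decides x T (q, (f, h) # (fW, Suc h) # U # D # K # S # Z # ms) P"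
  shows "decides x (T + n + 1) (Shift_Left n q, (f, h + n) # (fW, Suc (h + n)) # U # D # K # S # Z # ms) P"
proof (induction n)
  case 0
  then show ?case using assms by (simp add: decides_Suc)
next
  case (Suc n)
  then have "decides x (Suc (T + n + 1)) (Shift_Left (Suc n) q, (f, h + Suc n) # (fW, Suc (h + Suc n)) # U # D # K # S # Z # ms) P"
    by (subst decides_Suc) simp
  then show ?case by simp
qed

text \<open>Copying starts at the least significant digit, so the offset arrives reversed, in the
  order in which the addition consumes it.\<close>

lemma decides_Copy:
  assumes "decides x T (Ones j m r a, (f, 0) # (tally_tape w, 1) # (fU, u) # D #
      (list_tape (map (\<lambda>j. f (w - Suc j) = Bit True) [0..<w]), Suc w) # S # Z # ms) P"
    and "\<And>j. j < w \<Longrightarrow> f j = Bit True \<or> f j = Bit False" "i \<le> w"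
  shows "decides x (T + (w - i) + 1) (Copy j m r a, (f, w - Suc i) # (tally_tape w, w - i) # (fU, Suc u) # D #
      (list_tape (map (\<lambda>j. f (w - Suc j) = Bit True) [0..<i]), Suc i) # S # Z # ms) P"
  using assms(3)
proof (induction "w - i" arbitrary: i)
  case 0
  then have i: "i = w" by simp
  have "tally_tape w 0 = Blank" by (simp add: tally_tape_def)
  then show ?case using assms(1) unfolding i
    by (simp add: decides_Suc fun_upd_idem list_tape_def)
next
  case (Suc n)
  then have i: "i < w" by simp
  let ?K = "\<lambda>i. map (\<lambda>j. f (w - Suc j) = Bit True) [0..<i]"
  have "decides x (T + (w - Suc i) + 1) (Copy j m r a, (f, w - Suc (Suc i)) # (tally_tape w, w - Suc i) # (fU, Suc u) # D #
      (list_tape (?K (Suc i)), Suc (Suc i)) # S # Z # ms) P"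
    using Suc i by (intro Suc.hyps(1)) auto
  moreover have "f (w - Suc i) = Bit (f (w - Suc i) = Bit True)"
    using assms(2)[of "w - Suc i"] i by auto
  then have "(list_tape (?K i))(Suc i := f (w - Suc i)) = list_tape (?K (Suc i))"
    using list_tape_upd[of "?K i" "f (w - Suc i) = Bit True"] by simp
  moreover have "tally_tape w (w - i) = Mark 0" using i by (simp add: tally_tape_def)
  ultimately have "decides x (Suc (T + (w - Suc i) + 1)) (Copy j m r a, (f, w - Suc i) # (tally_tape w, w - i) # (fU, Suc u) # D #
      (list_tape (?K i), Suc i) # S # Z # ms) P"
    by (subst decides_Suc) (simp add: fun_upd_idem del: upt_Suc list_tape_simps)
  then show ?case using i by (simp add: Suc_diff_Suc)
qed

lemma decides_Rewind_Digits:
  assumes "decides x T (Simulate z0 v a, I # W # U # (list_tape qs, 1) # K # S # Z # ms) P"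
    and "h \<le> length qs"
  shows "decides x (T + h + 1) (Rewind_Digits v a, I # W # U # (list_tape qs, h) # K # S # Z # ms) P"
  using assms(2)
proof (induction h)
  case 0
  then show ?case using assms(1) by (simp add: decides_Suc fun_upd_idem)
next
  case (Suc h)
  then have "decides x (Suc (T + h + 1)) (Rewind_Digits v a, I # W # U # (list_tape qs, Suc h) # K # S # Z # ms) P"
    by (subst decides_Suc) (simp add: fun_upd_idem)
  then show ?case by simp
qed

lemma map_bit_counter:
  "map (\<lambda>j. counter_tape w v (w - Suc j) = Bit True) [0..<w] = map (bit v) [0..<w]"
  by (auto simp: counter_tape_def)

lemma position_observation_Outside:
  "index_value tp = p \<Longrightarrow> position_observation y tp = Outside \<longleftrightarrow> length y \<le> p"
  by (auto simp: position_observation_def Let_def)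

definition tail_time :: "nat \<Rightarrow> nat" where
  "tail_time w = 7 * (C * w + C) + 15 * w + 10 * s + 50"

text \<open>Both queries compare the length of the triple with a number of the form ones followed by
  \<open>s\<close> digits. The digits are chosen such that the outcomes are \<open>in_range\<close>
  for \<open>g\<close> and, if the window is full, for \<open>Suc g\<close>.\<close>

lemma decides_tail:
  assumes div: "dividing ds j m r g qs"
    and y: "y = flagged ds @ False # a # x" and w: "w = width (length y)" and g: "g \<le> w"
    and ms: "ms = initial_tapes" and fits: "2 * length ds + 2 < 2 ^ w"
  shows "decides y (tail_time w) (Copy j m r a, (counter_tape w (2 * length ds + 2), w - 1) # (tally_tape w, w) #
     (tally_tape w, Suc g) # (list_tape qs, Suc (length qs)) # (list_tape [], 1) # (list_tape [], 1) # (list_tape [], 1) #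
     ms) (y \<in> target)"
proof -
  have q: "length qs = C * g + r" "r \<le> C" "m < B" "j \<le> B" "length ds = j + length qs" "hd ds" "1 \<le> j"
    using div by (auto simp: dividing_def)
  then have tgt: "y \<in> target \<longleftrightarrow> in_range (length x) g \<and> addressed_word x ! digits_value ds = a"
    unfolding y by (subst triple_in_target) (auto simp: dividing_in_range[OF div])
  have good0: "sim_good 0 (z0, ms)" unfolding ms by (rule sim_good_initial)
  let ?v = "2 * length ds + 2"
  define ks where "ks = map (bit ?v) [0..<w]"
  have ks: "horner_sum of_bool 2 ks = ?v" "length ks = w"
    using fits by (auto simp: ks_def horner_sum_bit_eq_take_bit take_bit_nat_eq_self)
  have lq: "length qs \<le> C * w + C" using q g mult_le_mono2[OF g, of C] by linarith
  have small: "2 * r + 2 * j + 1 < 2 ^ s" "2 * j + 1 < 2 ^ s"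
  proof -
    have "2 * C \<le> 2 * C * s" using s by simp
    then show "2 * r + 2 * j + 1 < 2 ^ s" using big q by linarith
    then show "2 * j + 1 < 2 ^ s" by linarith
  qed
  \<comment> \<open>Every digit takes two letters, and the end mark with the claimed letter two
    more.\<close>
  have leny: "length y = length x + 2 * j + 2 * (C * g) + 2 * r + 2" using q y by simp
  let ?D = "(list_tape qs, Suc (length qs))" and ?K = "(list_tape ks, Suc w)" and ?e = "(list_tape [], 1) :: tape"
  let ?P = "y \<in> target"
  have sim: "decides y (w + 7 * length qs + 3 * w + s + 30) (Rewind_Digits m a, (f, Suc g + s) # (fW, Suc (Suc g + s)) # (tally_tape w, 0) #
      (list_tape qs, length qs) # ?K # ?e # ?e # ms) ?P"
    if "index_holds (replicate (Suc g) True @ digits s (2 * j + 1)) f fW"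
      and act: "r = C" "in_range (length x) g" "\<not> in_range (length x) (Suc g)" for f fW
  proof -
    obtain z' ms' where fin: "foldl (\<lambda>c b. sim_step b c) (z0, ms) qs = (z', ms')" by fastforce
    have good: "sim_good (length qs') (foldl (\<lambda>c b. sim_step b c) (z0, ms) qs')" for qs'
      by (induction qs' rule: rev_induct) (use good0 sim_good_step in auto)
    have P: "?P \<longleftrightarrow> blk (leaf x (z', ms')) ! m = a"
      using tgt dividing_letter[OF div act(2)] act fin[unfolded ms] by simp
    have "decides y (w + 4 * length qs + 3 * w + s + 25) (Simulate z' m a, (f, Suc g + s) # (fW, Suc (Suc g + s)) # (tally_tape w, 0) #
      ?D # (list_tape ks, Suc (length ks)) # ?e # ?e # ms') ?P"
      unfolding P
    proof (rule decides_leaf)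
      show "sim_good (length qs) (z', ms')" using good[of qs] fin by simp
      show "fW 0 = Blank" "\<And>j. 0 < j \<Longrightarrow> j \<le> Suc g + s \<Longrightarrow> fW j = Mark 0"
        using that(1) by (auto simp: index_holds_def)
      show "y = (flagged ds @ [False, a]) @ x" using y by simp
      show "length (flagged ds @ [False, a]) = horner_sum of_bool 2 ks" using ks by simp
      show "Suc g + s + 4 * length qs + 3 * length ks + 20 \<le> w + 4 * length qs + 3 * w + s + 25"
        using g ks by simp
    qed
    then have "decides y (w + 4 * length qs + 3 * w + s + 25) (Simulate z' m a, (f, Suc g + s) # (fW, Suc (Suc g + s)) # (tally_tape w, 0) #
      ?D # ?K # ?e # ?e # ms') ?P" using ks by simp
    then have "decides y (w + 4 * length qs + 3 * w + s + 25 + length qs) (Simulate z0 m a, (f, Suc g + s) # (fW, Suc (Suc g + s)) # (tally_tape w, 0) #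
      (list_tape qs, Suc (length ([] :: bool list))) # ?K # ?e # ?e # ms) ?P"
      using good0 fin by (intro decides_Simulate[of qs "[]" qs]) auto
    then have "decides y (w + 4 * length qs + 3 * w + s + 25 + length qs + length qs + 1) (Rewind_Digits m a, (f, Suc g + s) # (fW, Suc (Suc g + s)) # (tally_tape w, 0) #
      (list_tape qs, length qs) # ?K # ?e # ?e # ms) ?P"
      by (intro decides_Rewind_Digits) auto
    then show ?thesis by (rule decides_mono) simp
  qed
  have top: "decides y (4 * w + 7 * length qs + s + 31) (Top_Query m a, (f, Suc g + s) # (fW, Suc (Suc g + s)) # (tally_tape w, 0) #
      ?D # ?K # ?e # ?e # ms) ?P"
    if h: "index_holds (replicate (Suc g) True @ digits s (2 * j + 1)) f fW" "f (Suc g + s) = Blank"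
      and act: "r = C" "in_range (length x) g" for f fW
  proof -
    have "index_value (f, Suc g + s) = digits_value (replicate (Suc g) True @ digits s (2 * j + 1))"
      by (rule index_value_eq) (use h in \<open>auto simp: index_holds_def\<close>)
    also have "\<dots> = (2 ^ Suc g - 1) * 2 ^ s + (2 * j + 1)"
      unfolding digits_value_append using small
      by (simp only: digits_value_digits rev_replicate horner_sum_replicate_True length_digits)
    finally have "position_observation y (f, Suc g + s) = Outside \<longleftrightarrow> length y \<le> (2 ^ Suc g - 1) * 2 ^ s + (2 * j + 1)"
      by (rule position_observation_Outside)
    also have "\<dots> \<longleftrightarrow> \<not> in_range (length x) (Suc g)"
      unfolding in_range_def leny using act(1) by (auto simp: mult.commute[of "2 ^ s"] algebra_simps)
    finally have po: "position_observation y (f, Suc g + s) = Outside \<longleftrightarrow> \<not> in_range (length x) (Suc g)" .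
    have "decides y (Suc (w + 7 * length qs + 3 * w + s + 30)) (Top_Query m a, (f, Suc g + s) # (fW, Suc (Suc g + s)) # (tally_tape w, 0) #
      ?D # ?K # ?e # ?e # ms) ?P"
    proof (cases "in_range (length x) (Suc g)")
      case True
      have "?P \<longleftrightarrow> blk e1 ! m = a" using tgt dividing_letter[OF div act(2)] act True by simp
      then show ?thesis using po True by (subst decides_Suc) (auto simp: ks(2) fun_upd_idem intro: decides_answer)
    next
      case False
      have "(list_tape qs)(Suc (length qs) := Blank) = list_tape qs" by (simp add: fun_upd_idem)
      then show ?thesis using po False sim[OF h(1) act False] by (subst decides_Suc) (simp add: ks(2) fun_upd_idem del: replicate.simps)
    qed
    then show ?thesis by (rule decides_mono) simp
  qed
  have range: "decides y (5 * w + 7 * length qs + 3 * s + 40) (Range_Query j m r a, (f, g + s) # (fW, Suc (g + s)) # (tally_tape w, 0) #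
      ?D # ?K # ?e # ?e # ms) ?P"
    if h: "index_holds (replicate g True @ digits s (2 * r + 2 * j + 1)) f fW" "f (g + s) = Blank" for f fW
  proof -
    have "index_value (f, g + s) = digits_value (replicate g True @ digits s (2 * r + 2 * j + 1))"
      by (rule index_value_eq) (use h in \<open>auto simp: index_holds_def\<close>)
    also have "\<dots> = (2 ^ g - 1) * 2 ^ s + (2 * r + 2 * j + 1)"
      unfolding digits_value_append using small
      by (simp only: digits_value_digits rev_replicate horner_sum_replicate_True length_digits)
    finally have "position_observation y (f, g + s) = Outside \<longleftrightarrow> length y \<le> (2 ^ g - 1) * 2 ^ s + (2 * r + 2 * j + 1)"
      by (rule position_observation_Outside)
    also have "\<dots> \<longleftrightarrow> \<not> in_range (length x) g"
      unfolding in_range_def leny by (auto simp: mult.commute[of "2 ^ s"] algebra_simps)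
    finally have po: "position_observation y (f, g + s) = Outside \<longleftrightarrow> \<not> in_range (length x) g" .
    have "decides y (Suc (4 * w + 7 * length qs + s + 31 + Suc s + 1 + s + 1)) (Range_Query j m r a, (f, g + s) # (fW, Suc (g + s)) # (tally_tape w, 0) #
      ?D # ?K # ?e # ?e # ms) ?P"
    proof (cases "in_range (length x) g")
      case False
      then show ?thesis using po tgt by (subst decides_Suc) simp
    next
      case True
      show ?thesis
      proof (cases "r = C")
        case False
        have "?P \<longleftrightarrow> blk e1 ! m = a" using tgt dividing_letter[OF div True] True False by simp
        then show ?thesis using po True False by (subst decides_Suc) (auto simp: ks(2) fun_upd_idem intro: decides_answer)
      next
        case r: True
        have g1: "index_holds (replicate g True) f fW" using h(1) by (rule index_holds_append)
        have l: "length (replicate (Suc g) True @ digits s (2 * j + 1)) = Suc g + s" by simp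
        \<comment> \<open>Going back over the \<open>s\<close> digits and writing one more
          \<open>True\<close> in front of new ones turns the first index into the second.\<close>
        have e: "replicate g True @ True # digits s (2 * j + 1) = replicate (Suc g) True @ digits s (2 * j + 1)"
          by (simp add: replicate_app_Cons_same)
        have "decides y (4 * w + 7 * length qs + s + 31 + length (True # digits s (2 * j + 1)) + 1)
          (Write (True # digits s (2 * j + 1)) (Top_Query m a), (f, length (replicate g True)) # (fW, Suc (length (replicate g True))) # (tally_tape w, 0) #
            ?D # ?K # ?e # ?e # ms) ?P"
          by (rule decides_Write[OF _ g1], unfold e l) (rule top[OF _ _ r True])
        then have "decides y (4 * w + 7 * length qs + s + 31 + Suc s + 1)
          (Write (True # digits s (2 * j + 1)) (Top_Query m a), (f, g) # (fW, Suc g) # (tally_tape w, 0) #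
            ?D # ?K # ?e # ?e # ms) ?P"
          by simp
        from decides_Shift_Left[OF this, of s] show ?thesis using po True r
          by (subst decides_Suc) (simp add: ks(2) fun_upd_idem)
      qed
    qed
    then show ?thesis by (rule decides_mono) simp
  qed
  have ones: "decides y (5 * w + 7 * length qs + 3 * s + 40 + s + 1 + g + 1) (Ones j m r a, (counter_tape w ?v, 0) # (tally_tape w, 1) # (tally_tape w, g) #
      ?D # ?K # ?e # ?e # ms) ?P"
  proof -
    have l: "length (replicate (0 + g) True @ digits s (2 * r + 2 * j + 1)) = g + s" by simp
    have "decides y (5 * w + 7 * length qs + 3 * s + 40 + s + 1 + g + 1) (Ones j m r a, (counter_tape w ?v, 0) # (tally_tape w, Suc 0) # (tally_tape w, g) #
      ?D # ?K # ?e # ?e # ms) ?P"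
    proof (rule decides_Ones)
      fix f fW assume h: "index_holds (replicate (0 + g) True) f fW"
      have "decides y (5 * w + 7 * length qs + 3 * s + 40 + length (digits s (2 * r + 2 * j + 1)) + 1)
        (Write (digits s (2 * r + 2 * j + 1)) (Range_Query j m r a), (f, length (replicate (0 + g) True)) # (fW, Suc (length (replicate (0 + g) True))) # (tally_tape w, 0) #
          ?D # ?K # ?e # ?e # ms) ?P"
        by (rule decides_Write[OF _ h], unfold l) (rule range, simp_all)
      then show "decides y (5 * w + 7 * length qs + 3 * s + 40 + s + 1)
        (Write (digits s (2 * r + 2 * j + 1)) (Range_Query j m r a), (f, 0 + g) # (fW, Suc (0 + g)) # (tally_tape w, 0) #
          ?D # ?K # ?e # ?e # ms) ?P" by simp
    qed (use g in \<open>auto simp: index_holds_def tally_tape_def\<close>)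
    then show ?thesis by simp
  qed
  have "decides y (5 * w + 7 * length qs + 3 * s + 40 + s + 1 + g + 1 + (w - 0) + 1) (Copy j m r a, (counter_tape w ?v, w - Suc 0) # (tally_tape w, w - 0) #
     (tally_tape w, Suc g) # ?D #
     (list_tape (map (\<lambda>j. counter_tape w ?v (w - Suc j) = Bit True) [0..<0]), Suc 0) # ?e # ?e # ms) ?P"
    by (rule decides_Copy)
       (unfold map_bit_counter ks_def[symmetric], rule ones, auto simp: counter_tape_def)
  then have "decides y (5 * w + 7 * length qs + 3 * s + 40 + s + 1 + g + 1 + (w - 0) + 1) (Copy j m r a, (counter_tape w ?v, w - 1) # (tally_tape w, w) #
     (tally_tape w, Suc g) # ?D # ?e # ?e # ?e # ms) ?P" by simp
  then show ?thesis by (rule decides_mono) (use g lq in \<open>simp add: tail_time_def\<close>)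
qed


section \<open>Reading the address digit by digit\<close>

lemma width_fits:
  assumes "s \<le> w" shows "2 * C * w + 2 * B + 4 < 2 ^ w"
  using assms
proof (induction rule: dec_induct)
  case base
  then show ?case using big .
next
  case (step n)
  \<comment> \<open>Passing to the next width adds \<open>2 * C\<close> on the left and doubles the
    right side. The result keeps the counter from overflowing on the positions that are
    read.\<close>
  have "2 * C \<le> (2::nat) ^ n" using two_C power_increasing[OF step(1), of "2::nat"] by linarith
  then show ?case using step.IH by simp
qed

lemma observe_counter:
  "c < 2 ^ w \<Longrightarrow> position_observation y (counter_tape w c, h) = (if c < length y then Letter (y ! c) else Outside)"
  by (simp add: position_observation_def index_value_counter Let_def)

lemma decides_Inc_amortized:
  assumes "decides y (T + 2 * ones_count (Suc c)) (q, (counter_tape w (Suc c), w - 1) # (g, w) # U # D # K # S # Z # ms) P"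
    and "Suc c < 2 ^ w"
  shows "decides y (T + 4 + 2 * ones_count c) (Inc q, (counter_tape w c, w - 1) # (g, w) # U # D # K # S # Z # ms) P"
proof (rule decides_Inc[OF assms])
  show "0 < w" using assms(2) by (cases w) auto
qed simp

text \<open>The common shape of the reading states: look at the letter under the counter, act on it,
  and advance the counter, in five steps after amortization. The term \<open>2 * ones_count\<close>
  is the potential that is handed on.\<close>

lemma decides_read:
  assumes "delta0 q (if c < length y then Letter (y ! c) else Outside) (counter_tape w c (w - 1)) (g w)
     (scanned U) (scanned D) (scanned K) (scanned S) (scanned Z) (map scanned ms) =
       Some (Inc q', [st (counter_tape w c (w - 1)), st (g w), (scanned U, mU), (sD, mD), st (scanned K), st (scanned S),
         st (scanned Z)] @ idle (map scanned ms))"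
    and "queries q" and c: "Suc c < 2 ^ w"
    and "decides y (T + 2 * ones_count (Suc c)) (q', (counter_tape w (Suc c), w - 1) # (g, w) #
       act (scanned U, mU) U # act (sD, mD) D # K # S # Z # ms) P"
  shows "decides y (T + 5 + 2 * ones_count c) (q, (counter_tape w c, w - 1) # (g, w) # U # D # K # S # Z # ms) P"
proof -
  have c': "c < 2 ^ w" using c by simp
  have "decides y (T + 4 + 2 * ones_count c) (Inc q', (counter_tape w c, w - 1) # (g, w) #
       act (scanned U, mU) U # act (sD, mD) D # K # S # Z # ms) P"
    by (rule decides_Inc_amortized[OF assms(4) c])
  then have "decides y (Suc (T + 4 + 2 * ones_count c)) (q, (counter_tape w c, w - 1) # (g, w) # U # D # K # S # Z # ms) P"
    unfolding decides_Suc using assms(1,2) by (simp add: observe_counter[OF c'])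
  then show ?thesis by (rule decides_mono) simp
qed

text \<open>The number of windows cannot decrease as digits follow, so an overrun is final.\<close>

lemma dividing_extend:
  "dividing ds j m r g qs \<Longrightarrow> \<exists>m' r' g' qs'. dividing (ds @ es) j m' r' g' qs' \<and> g \<le> g'"
proof (induction es arbitrary: ds m r g qs)
  case Nil
  then show ?case by auto
next
  case (Cons b es)
  from Cons.IH[OF dividing_next[OF Cons.prems, of b]] show ?case
    by (auto split: if_splits) (meson Suc_leD)+
qed

lemma in_target_rest:
  assumes "flagged ds @ rest \<in> target"
  shows "(\<exists>b rest'. rest = True # b # rest') \<or> (\<exists>a x. rest = False # a # x)"
proof -
  obtain x a i where 1: "flagged ds @ rest = flagged (binary i) @ False # a # x" "prefix ds (binary i)"
    using assms by (rule in_targetD)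
  then obtain es where "binary i = ds @ es" by (auto simp: prefix_def)
  then show ?thesis using 1(1) by (cases es) auto
qed

text \<open>Justifies a fuel of \<open>w\<close> windows: a word for an \<open>x\<close> that fits
  into the input has no window \<open>w\<close>.\<close>

lemma not_in_range_width:
  assumes "w = width (length y)" "length x \<le> length y" shows "\<not> in_range (length x) w"
proof
  assume "in_range (length x) w"
  then have "2 ^ s * (2 ^ w - 1) \<le> length x + 2 * C * w" by (simp add: in_range_def)
  moreover have "2 * (2 ^ w - 1) \<le> 2 ^ s * ((2::nat) ^ w - 1)"
    using s power_increasing[of 1 s "2::nat"] by (intro mult_le_mono1) simp
  moreover have "2 * C * w + 2 * B + 4 < 2 ^ w"
    using width_greater[of "length y"] assms by (intro width_fits) simp
  moreover have "length x < 2 ^ w" using width_bound[of "length y"] assms by simp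
  ultimately show False by linarith
qed

abbreviation "empty_tape \<equiv> (list_tape [], 1) :: tape"

definition after_time :: "nat \<Rightarrow> nat \<Rightarrow> nat" where
  "after_time w n = tail_time w + 10 + 10 * (C * w + 2 - n)"

text \<open>Induction on the unread rest of the input. A digit costs two reads of five steps each,
  and \<open>C * w + 2\<close> exceeds the number of digits for which there is fuel.\<close>

lemma decides_After:
  assumes "dividing ds j m r g qs" "y = flagged ds @ rest" and w: "w = width (length y)"
    and "g \<le> w" "length qs \<le> C * w + 1"
  shows "decides y (after_time w (length qs) + 2 * ones_count (2 * length ds))
    (Flag (After j m r), (counter_tape w (2 * length ds), w - 1) # (tally_tape w, w) # (tally_tape w, Suc g) #
       (list_tape qs, Suc (length qs)) # empty_tape # empty_tape # empty_tape # initial_tapes) (y \<in> target)"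
  using assms(1,2,4,5)
proof (induction "length rest" arbitrary: ds m r g qs rest rule: less_induct)
  case less
  let ?c = "2 * length ds"
  have q: "length qs = C * g + r" "r \<le> C" "j \<le> B" "length ds = j + length qs"
    using less.prems(1) by (auto simp: dividing_def)
  have ly: "length y = ?c + length rest" using less.prems(2) by simp
  have fits: "2 * length ds + 2 < 2 ^ w"
  proof -
    have "2 * length ds + 2 \<le> 2 * C * w + 2 * B + 4" using q less.prems(4) by (simp add: algebra_simps)
    also have "\<dots> < 2 ^ w" using width_greater[of "length y"] w by (intro width_fits) simp
    finally show ?thesis .
  qed
  have y0: "y ! ?c = rest ! 0" if "rest \<noteq> []" unfolding less.prems(2) using that by (simp add: nth_append)
  have y1: "y ! Suc ?c = rest ! 1" if "1 < length rest"
    unfolding less.prems(2) using that by (simp add: nth_append)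
  let ?T = "\<lambda>n. after_time w n"
  have T: "?T (length qs) = ?T (Suc (length qs)) + 10" "tail_time w + 10 \<le> ?T (length qs)"
    using less.prems(4) by (auto simp: after_time_def Suc_diff_le algebra_simps)
  let ?I = "\<lambda>c. (counter_tape w c, w - 1) :: tape" and ?W = "(tally_tape w, w) :: tape"
    and ?e = empty_tape
  show ?case
  proof (cases "\<exists>b rest'. rest = b # rest'")
    case False
    then have "rest = []" by (cases rest) auto
    moreover from this have "y \<notin> target" using in_target_rest[of ds rest] less.prems(2) by auto
    ultimately show ?thesis using ly fits
      by (intro decides_halt) (auto simp: next_config_def delta_def obs_def observe_counter)
  next
    case True
    then obtain b rest' where rest: "rest = b # rest'" by blast
    have "decides y (?T (length qs) - 5 + 2 * ones_count (Suc ?c)) (if b then Digit (After j m r) else Claim (After j m r),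
        ?I (Suc ?c) # ?W # (tally_tape w, Suc g) # (list_tape qs, Suc (length qs)) # ?e # ?e # ?e # initial_tapes) (y \<in> target)"
    proof (cases "rest' = []")
      case True
      then have "y \<notin> target" using in_target_rest[of ds rest] less.prems(2) rest by auto
      then show ?thesis using True ly fits rest
        by (intro decides_halt) (auto simp: next_config_def delta_def obs_def observe_counter)
    next
      case False
      then obtain a x where x: "rest' = a # x" by (cases rest') auto
      then have ya: "y ! Suc ?c = a" using y1 rest by simp
      have lt: "Suc ?c < length y" using ly rest x by simp
      show ?thesis
      proof (cases b)
        case b: False
        have tail: "decides y (tail_time w) (Copy j m r a, ?I (2 * length ds + 2) # ?W #
           (tally_tape w, Suc g) # (list_tape qs, Suc (length qs)) # ?e # ?e # ?e # initial_tapes) (y \<in> target)"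
          using less.prems b rest x fits w by (intro decides_tail) auto
        have "decides y (tail_time w + 5 + 2 * ones_count (Suc ?c)) (Claim (After j m r),
          ?I (Suc ?c) # ?W # (tally_tape w, Suc g) # (list_tape qs, Suc (length qs)) # ?e # ?e # ?e # initial_tapes) (y \<in> target)"
        proof (rule decides_read)
          show "decides y (tail_time w + 2 * ones_count (Suc (Suc ?c))) (Copy j m r a, ?I (Suc (Suc ?c)) # ?W #
            act (scanned (tally_tape w, Suc g), Stay) (tally_tape w, Suc g) #
            act (scanned (list_tape qs, Suc (length qs)), Stay) (list_tape qs, Suc (length qs)) #
            ?e # ?e # ?e # initial_tapes) (y \<in> target)"
            unfolding act_Stay by (rule decides_mono[OF tail[unfolded add_2_eq_Suc']]) simp
        qed (use lt ya fits in auto)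
        then have "decides y (?T (length qs) - 5 + 2 * ones_count (Suc ?c)) (Claim (After j m r),
          ?I (Suc ?c) # ?W # (tally_tape w, Suc g) # (list_tape qs, Suc (length qs)) # ?e # ?e # ?e # initial_tapes) (y \<in> target)"
          by (rule decides_mono) (use T in linarith)
        then show ?thesis using b by simp
      next
        case b: True
        have y': "y = flagged (ds @ [a]) @ x" using less.prems(2) rest x b by simp
        show ?thesis
        \<comment> \<open>The fuel is spent: every address that begins with the digits read is out
          of range.\<close>
        proof (cases "g = w")
          case True
          have "y \<notin> target"
          proof
            assume "y \<in> target"
            then obtain x' a' i where i: "y = flagged (binary i) @ False # a' # x'"
              "prefix (ds @ [a]) (binary i)" "i < length (addressed_word x')"
              unfolding y' by (rule in_targetD) (auto simp: y')
            then obtain es where "binary i = ds @ es" by (auto simp: prefix_def)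
            moreover obtain m' r' g' qs' where d: "dividing (ds @ es) j m' r' g' qs'" "g \<le> g'"
              using dividing_extend[OF less.prems(1)] by blast
            ultimately have "in_range (length x') g'"
              using dividing_in_range[OF d(1), of x'] i(3) digits_value_binary[of i] by simp
            then have "in_range (length x') w" using d(2) True by (auto intro: in_range_antimono)
            moreover have "\<not> in_range (length x') w"
              using w i(1) by (intro not_in_range_width[of w y]) auto
            ultimately show False by contradiction
          qed
          moreover have "tally_tape w (Suc g) = Blank" using True by (simp add: tally_tape_def)
          ultimately have "decides y (?T (length qs) - 5 + 2 * ones_count (Suc ?c)) (Digit (After j m r),
            ?I (Suc ?c) # ?W # (tally_tape w, Suc g) # (list_tape qs, Suc (length qs)) # ?e # ?e # ?e # initial_tapes) (y \<in> target)"
            using fits lt by (intro decides_halt) (auto simp: next_config_def delta_def obs_def observe_counter)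
          then show ?thesis using b by simp
        next
          case False
          then have gw: "g < w" using less.prems(3) by simp
          then have t: "tally_tape w (Suc g) = Mark 0" by (simp add: tally_tape_def)
          let ?q = "B \<le> 2 * m + of_bool a"
          let ?r = "if r = C then 1 else Suc r" and ?g = "if r = C then Suc g else g"
          have "C * Suc g \<le> C * w" using gw by (intro mult_le_mono) auto
          then have lq: "length (qs @ [?q]) \<le> C * w + 1" using q by simp
          have "decides y (?T (length (qs @ [?q])) + 2 * ones_count (2 * length (ds @ [a])))
            (Flag (After j ((2 * m + of_bool a) mod B) ?r), ?I (2 * length (ds @ [a])) # ?W # (tally_tape w, Suc ?g) #
             (list_tape (qs @ [?q]), Suc (length (qs @ [?q]))) # ?e # ?e # ?e # initial_tapes) (y \<in> target)"
            using gw lq rest x by (intro less.hyps[OF _ dividing_next[OF less.prems(1)] y']) auto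
          then have next': "decides y (?T (Suc (length qs)) + 2 * ones_count (Suc (Suc ?c)))
            (Flag (After j ((2 * m + of_bool a) mod B) ?r), ?I (Suc (Suc ?c)) # ?W # (tally_tape w, Suc ?g) #
             (list_tape (qs @ [?q]), Suc (Suc (length qs))) # ?e # ?e # ?e # initial_tapes) (y \<in> target)"
            by (simp del: if_distrib)
          have "decides y (?T (Suc (length qs)) + 5 + 2 * ones_count (Suc ?c)) (Digit (After j m r),
            ?I (Suc ?c) # ?W # (tally_tape w, Suc g) # (list_tape qs, Suc (length qs)) # ?e # ?e # ?e # initial_tapes) (y \<in> target)"
          proof (rule decides_read[where mU = "if r = C then direction.Right else Stay"
                and sD = "Bit ?q" and mD = direction.Right])
            show "decides y (?T (Suc (length qs)) + 2 * ones_count (Suc (Suc ?c)))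
              (Flag (After j ((2 * m + of_bool a) mod B) ?r), ?I (Suc (Suc ?c)) # ?W #
               act (scanned (tally_tape w, Suc g), if r = C then direction.Right else Stay) (tally_tape w, Suc g) #
               act (Bit ?q, direction.Right) (list_tape qs, Suc (length qs)) # ?e # ?e # ?e # initial_tapes) (y \<in> target)"
              using next' by (cases "r = C") (simp_all add: list_tape_upd)
            show "delta0 (Digit (After j m r)) (if Suc ?c < length y then Letter (y ! Suc ?c) else Outside)
              (counter_tape w (Suc ?c) (w - 1)) (tally_tape w w) (scanned (tally_tape w, Suc g))
              (scanned (list_tape qs, Suc (length qs))) (scanned ?e) (scanned ?e) (scanned ?e) (map scanned initial_tapes) =
              Some (Inc (Flag (After j ((2 * m + of_bool a) mod B) ?r)),
                [st (counter_tape w (Suc ?c) (w - 1)), st (tally_tape w w),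
                 (scanned (tally_tape w, Suc g), if r = C then direction.Right else Stay),
                 (Bit ?q, direction.Right), st (scanned ?e), st (scanned ?e), st (scanned ?e)] @ idle (map scanned initial_tapes))"
              using lt ya t by simp
          qed (use fits in auto)
          then have "decides y (?T (length qs) - 5 + 2 * ones_count (Suc ?c)) (Digit (After j m r),
            ?I (Suc ?c) # ?W # (tally_tape w, Suc g) # (list_tape qs, Suc (length qs)) # ?e # ?e # ?e # initial_tapes) (y \<in> target)"
            by (rule decides_mono) (use T in simp)
          then show ?thesis using b by simp
        qed
      qed
    qed
    then have "decides y (?T (length qs) - 5 + 5 + 2 * ones_count ?c)
      (Flag (After j m r), ?I ?c # ?W # (tally_tape w, Suc g) #
       (list_tape qs, Suc (length qs)) # ?e # ?e # ?e # initial_tapes) (y \<in> target)"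
      using ly y0 rest fits
      by (intro decides_read[where mU = Stay and mD = Stay and sD = "list_tape qs (Suc (length qs))"
            and q' = "if b then Digit (After j m r) else Claim (After j m r)"]) (auto simp: fun_upd_idem)
    then show ?thesis by (rule decides_mono) (use T in simp)
  qed
qed


definition before_time :: "nat \<Rightarrow> nat \<Rightarrow> nat" where
  "before_time w n = after_time w 0 + 10 + 10 * (B + 1 - n)"

text \<open>In this phase the value stays below \<open>B\<close> and at least doubles with every
  digit after a leading 1, so only a bounded number of digits is read, and the control can hold the
  value.\<close>

lemma decides_Before:
  assumes "digits_value ds < B" "ds = [] \<or> hd ds \<or> ds = [False]" "y = flagged ds @ rest"
    and w: "w = width (length y)"
  shows "decides y (before_time w (length ds) + 2 * ones_count (2 * length ds))
    (Flag (Before (length ds) (digits_value ds)), (counter_tape w (2 * length ds), w - 1) # (tally_tape w, w) #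
       (tally_tape w, 1) # empty_tape # empty_tape # empty_tape # empty_tape # initial_tapes) (y \<in> target)"
  using assms(1-3)
proof (induction "length rest" arbitrary: ds rest rule: less_induct)
  case less
  let ?c = "2 * length ds" and ?v = "digits_value ds"
  have lds: "length ds \<le> B" and hd: "hd ds \<Longrightarrow> ds \<noteq> [] \<Longrightarrow> Suc (length ds) \<le> B \<and> 0 < ?v"
  proof -
    have *: "Suc (length ds) \<le> B \<and> 0 < ?v" if h: "hd ds" "ds \<noteq> []"
    proof -
      obtain es where es: "ds = True # es" using h by (cases ds) auto
      have "2 ^ length es \<le> ?v" unfolding es digits_value_True_Cons by simp
      moreover have "length es < 2 ^ length es" by (rule less_exp)
      moreover have "length ds = Suc (length es)" using es by simp
      ultimately show ?thesis using less.prems(1) by linarith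
    qed
    then show "hd ds \<Longrightarrow> ds \<noteq> [] \<Longrightarrow> Suc (length ds) \<le> B \<and> 0 < ?v" by blast
    show "length ds \<le> B" using * less.prems(2) B by (cases "ds = []") auto
  qed
  have ly: "length y = ?c + length rest" using less.prems(3) by simp
  have fits: "2 * length ds + 2 < 2 ^ w"
  proof -
    have "2 * length ds + 2 \<le> 2 * C * w + 2 * B + 4" using lds by simp
    also have "\<dots> < 2 ^ w" using width_greater[of "length y"] w by (intro width_fits) simp
    finally show ?thesis .
  qed
  have y0: "y ! ?c = rest ! 0" if "rest \<noteq> []" unfolding less.prems(3) using that by (simp add: nth_append)
  have y1: "y ! Suc ?c = rest ! 1" if "1 < length rest"
    unfolding less.prems(3) using that by (simp add: nth_append)
  let ?T = "before_time w"
  have T: "?T (length ds) = ?T (Suc (length ds)) + 10" "after_time w 0 + 10 \<le> ?T (length ds)"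
    using lds by (auto simp: before_time_def Suc_diff_le algebra_simps)
  let ?I = "\<lambda>c. (counter_tape w c, w - 1) :: tape" and ?W = "(tally_tape w, w) :: tape"
    and ?e = empty_tape
  show ?case
  proof (cases "\<exists>b rest'. rest = b # rest'")
    case False
    then have "rest = []" by (cases rest) auto
    moreover from this have "y \<notin> target" using in_target_rest[of ds rest] less.prems(3) by auto
    ultimately show ?thesis using ly fits
      by (intro decides_halt) (auto simp: next_config_def delta_def obs_def observe_counter)
  next
    case True
    then obtain b rest' where rest: "rest = b # rest'" by blast
    let ?d = "Before (length ds) ?v"
    have "decides y (?T (length ds) - 5 + 2 * ones_count (Suc ?c)) (if b then Digit ?d else Claim ?d,
        ?I (Suc ?c) # ?W # (tally_tape w, 1) # ?e # ?e # ?e # ?e # initial_tapes) (y \<in> target)"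
    proof (cases "rest' = []")
      case True
      then have "y \<notin> target" using in_target_rest[of ds rest] less.prems(3) rest by auto
      then show ?thesis using True ly fits rest
        by (intro decides_halt) (auto simp: next_config_def delta_def obs_def observe_counter)
    next
      case False
      then obtain a x where x: "rest' = a # x" by (cases rest') auto
      then have ya: "y ! Suc ?c = a" using y1 rest by simp
      have lt: "Suc ?c < length y" using ly rest x by simp
      show ?thesis
      proof (cases b)
        case b: False
        then have y: "y = flagged ds @ False # a # x" using less.prems(3) rest x by simp
        have "decides y (Suc 0) (Claim ?d,
          ?I (Suc ?c) # ?W # (tally_tape w, 1) # ?e # ?e # ?e # ?e # initial_tapes) (y \<in> target)"
        proof (cases "ds = []")
          case True
          have "y \<notin> target"
          proof
            assume "y \<in> target"
            then obtain a' x' i where "flagged [] @ y = flagged (binary i) @ False # a' # x'"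
              by (metis append_Nil concat.simps(1) in_targetD list.map(1))
            then have "binary i = []"
              unfolding y True flagged_eq_iff by (cases "binary i") auto
            then show False by (simp add: binary_nonempty)
          qed
          then show ?thesis using True lt fits
            by (intro decides_halt) (auto simp: next_config_def delta_def obs_def observe_counter)
        next
          case False
          then have "y \<in> target \<longleftrightarrow> blk e1 ! ?v = a"
            unfolding y using less.prems(2) small_letter[OF less.prems(1), of x]
            by (subst triple_in_target) auto
          then show ?thesis unfolding decides_Suc using False lt ya fits
            by (auto simp: observe_counter intro: decides_answer)
        qed
        then have "decides y (?T (length ds) - 5 + 2 * ones_count (Suc ?c)) (Claim ?d,
          ?I (Suc ?c) # ?W # (tally_tape w, 1) # ?e # ?e # ?e # ?e # initial_tapes) (y \<in> target)"
          by (rule decides_mono) (use T in linarith)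
        then show ?thesis using b by simp
      next
        case b: True
        have y': "y = flagged (ds @ [a]) @ x" using less.prems(3) rest x b by simp
        show ?thesis
        proof (cases "ds = [False]")
          case True
          have "y \<notin> target"
          proof
            assume "y \<in> target"
            then obtain i where "prefix (ds @ [a]) (binary i)"
              unfolding y' by (rule in_targetD)
            from prefix_binary[OF this] show False using True by simp
          qed
          then have "decides y (?T (length ds) - 5 + 2 * ones_count (Suc ?c)) (Digit ?d,
            ?I (Suc ?c) # ?W # (tally_tape w, 1) # ?e # ?e # ?e # ?e # initial_tapes) (y \<in> target)"
            using fits lt True by (intro decides_halt) (auto simp: next_config_def delta_def obs_def observe_counter)
          then show ?thesis using b by simp
        next
          case False
          let ?v' = "2 * ?v + of_bool a"
          let ?d' = "if ?v' < B then Before (Suc (length ds)) ?v' else After (Suc (length ds)) (?v' - B) 0"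
          have ok: "\<not> (B < length ds \<or> 0 < length ds \<and> ?v = 0)"
          proof (cases "ds = []")
            case ne: False
            then have "hd ds" using less.prems(2) False by blast
            from hd[OF this ne] show ?thesis by linarith
          qed simp
          have next': "decides y (?T (Suc (length ds)) + 2 * ones_count (Suc (Suc ?c)))
            (Flag ?d', ?I (Suc (Suc ?c)) # ?W # (tally_tape w, 1) # ?e # ?e # ?e # ?e # initial_tapes) (y \<in> target)"
          proof (cases "?v' < B")
            case True
            have "decides y (?T (length (ds @ [a])) + 2 * ones_count (2 * length (ds @ [a])))
              (Flag (Before (length (ds @ [a])) (digits_value (ds @ [a]))), ?I (2 * length (ds @ [a])) # ?W #
               (tally_tape w, 1) # ?e # ?e # ?e # ?e # initial_tapes) (y \<in> target)"
              using True rest x less.prems(2) False by (intro less.hyps[OF _ _ _ y']) (auto simp: hd_append)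
            then show ?thesis using True by (simp add: add.commute)
          next
            case v: False
            have h: "hd (ds @ [a])" and l: "Suc (length ds) \<le> B"
            proof -
              have "hd (ds @ [a]) \<and> Suc (length ds) \<le> B"
              proof (cases "ds = []")
                case True
                then show ?thesis using v B by (cases a) auto
              next
                case ne: False
                then have "hd ds" using less.prems(2) False by blast
                with hd[OF this ne] ne show ?thesis by simp
              qed
              then show "hd (ds @ [a])" "Suc (length ds) \<le> B" by blast+
            qed
            have "dividing (ds @ [a]) (Suc (length ds)) (?v' - B) 0 0 []"
              using h l v less.prems(1) by (cases a) (auto simp: dividing_def)
            from decides_After[OF this y' w]
            have "decides y (after_time w 0 + 2 * ones_count (Suc (Suc ?c)))
              (Flag (After (Suc (length ds)) (?v' - B) 0), ?I (Suc (Suc ?c)) # ?W # (tally_tape w, 1) #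
               ?e # ?e # ?e # ?e # initial_tapes) (y \<in> target)"
              by simp
            then have "decides y (?T (Suc (length ds)) + 2 * ones_count (Suc (Suc ?c)))
              (Flag (After (Suc (length ds)) (?v' - B) 0), ?I (Suc (Suc ?c)) # ?W # (tally_tape w, 1) #
               ?e # ?e # ?e # ?e # initial_tapes) (y \<in> target)"
              by (rule decides_mono) (simp add: before_time_def)
            then show ?thesis using v by simp
          qed
          have "decides y (?T (Suc (length ds)) + 5 + 2 * ones_count (Suc ?c)) (Digit ?d,
            ?I (Suc ?c) # ?W # (tally_tape w, 1) # ?e # ?e # ?e # ?e # initial_tapes) (y \<in> target)"
          proof (rule decides_read[where mU = Stay and sD = Blank and mD = Stay])
            have e: "act (Blank, Stay) ?e = ?e" by (simp add: fun_upd_idem)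
            show "decides y (?T (Suc (length ds)) + 2 * ones_count (Suc (Suc ?c)))
              (Flag ?d', ?I (Suc (Suc ?c)) # ?W # act (scanned (tally_tape w, 1), Stay) (tally_tape w, 1) #
               act (Blank, Stay) ?e # ?e # ?e # ?e # initial_tapes) (y \<in> target)"
              unfolding act_Stay e by (rule next')
            show "delta0 (Digit ?d) (if Suc ?c < length y then Letter (y ! Suc ?c) else Outside)
              (counter_tape w (Suc ?c) (w - 1)) (tally_tape w w) (scanned (tally_tape w, 1))
              (scanned ?e) (scanned ?e) (scanned ?e) (scanned ?e) (map scanned initial_tapes) =
              Some (Inc (Flag ?d'),
                [st (counter_tape w (Suc ?c) (w - 1)), st (tally_tape w w),
                 (scanned (tally_tape w, 1), Stay),
                 (Blank, Stay), st (scanned ?e), st (scanned ?e), st (scanned ?e)] @ idle (map scanned initial_tapes))"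
              using lt ya ok by simp
          qed (use fits in auto)
          then have "decides y (?T (length ds) - 5 + 2 * ones_count (Suc ?c)) (Digit ?d,
            ?I (Suc ?c) # ?W # (tally_tape w, 1) # ?e # ?e # ?e # ?e # initial_tapes) (y \<in> target)"
            by (rule decides_mono) (use T in simp)
          then show ?thesis using b by simp
        qed
      qed
    qed
    then have "decides y (?T (length ds) - 5 + 5 + 2 * ones_count ?c)
      (Flag ?d, ?I ?c # ?W # (tally_tape w, 1) #
       ?e # ?e # ?e # ?e # initial_tapes) (y \<in> target)"
      using ly y0 rest fits
      by (intro decides_read[where mU = Stay and mD = Stay and sD = Blank
            and q' = "if b then Digit ?d else Claim ?d"]) (auto simp: fun_upd_idem)
    then show ?thesis by (rule decides_mono) (use T in simp)
  qed
qed

section \<open>Running time and length of the word\<close>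

definition total_time :: "nat \<Rightarrow> nat" where
  "total_time w = (19 + 17 * C) * w + (10 * B + 7 * C + 10 * s + 200)"

lemma decides_target:
  "decides y (total_time (width (length y))) (Start, replicate (Suc (k + 7)) (\<lambda>_. Blank, 0)) (y \<in> target)"
proof -
  let ?w = "width (length y)"
  have "decides y (before_time ?w 0) (Flag (Before 0 0), (counter_tape ?w 0, ?w - 1) # (tally_tape ?w, ?w) #
       (tally_tape ?w, 1) # empty_tape # empty_tape # empty_tape # empty_tape # initial_tapes) (y \<in> target)"
    using decides_Before[of "[]" y y ?w] B by simp
  from decides_Start[OF this[unfolded list_tape_Nil] refl] have "decides y (total_time ?w) (Start, (\<lambda>_. Blank, 0) # (\<lambda>_. Blank, 0) # (\<lambda>_. Blank, 0) #
        (\<lambda>_. Blank, 0) # (\<lambda>_. Blank, 0) # (\<lambda>_. Blank, 0) # (\<lambda>_. Blank, 0) # initial_tapes) (y \<in> target)"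
    by (simp add: total_time_def before_time_def after_time_def tail_time_def algebra_simps)
  then show ?thesis by (simp add: eval_nat_numeral)
qed

lemma width_log:
  assumes "3 \<le> n" shows "real (width n) \<le> (real s + 4) * ln (real n)"
proof -
  have e: "exp 1 \<le> real n" using exp_le assms by linarith
  have ln1: "1 \<le> ln (real n)"
    using ln_mono[of "exp 1" "real n"] e by simp
  have ln2: "1 / 2 \<le> ln (2::real)"
    using ln2_ge_two_thirds by linarith
  show ?thesis
  proof (cases "width n = Suc s")
    case True
    have "real s + 1 \<le> (real s + 4) * 1" by simp
    also have "\<dots> \<le> (real s + 4) * ln (real n)" using ln1 by (intro mult_left_mono) auto
    finally show ?thesis using True by simp
  next
    case False
    then have "2 ^ (width n - 1) \<le> n"
      using width_greater[of n] by (intro width_least) auto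
    then have "real (2 ^ (width n - 1)) \<le> real n" by (simp only: of_nat_le_iff)
    then have "ln (2 ^ (width n - 1)) \<le> ln (real n)"
      using assms by (subst ln_le_cancel_iff) auto
    then have "real (width n - 1) * ln 2 \<le> ln (real n)" by (simp add: ln_realpow)
    moreover have "real (width n - 1) * (1 / 2) \<le> real (width n - 1) * ln 2"
      using ln2 by (intro mult_left_mono) auto
    ultimately have "real (width n) \<le> 3 * ln (real n)" using ln1 by linarith
    also have "\<dots> \<le> (real s + 4) * ln (real n)" using ln1 by (intro mult_right_mono) auto
    finally show ?thesis .
  qed
qed

lemma total_time_log: "(\<lambda>n. real (total_time (width n))) \<in> O(\<lambda>n. ln (real n))"
proof -
  define a b where "a = real (19 + 17 * C)" and "b = real (10 * B + 7 * C + 10 * s + 200)"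
  have "real (total_time (width n)) \<le> (a * (real s + 4) + b) * ln (real n)" if "3 \<le> n" for n
  proof -
    have "exp 1 \<le> real n" using exp_le that by linarith
    then have ln1: "1 \<le> ln (real n)" using ln_mono[of "exp 1" "real n"] by simp
    have "real (total_time (width n)) = a * real (width n) + b"
      by (simp add: total_time_def a_def b_def algebra_simps)
    also have "\<dots> \<le> a * ((real s + 4) * ln (real n)) + b * ln (real n)"
      using width_log[OF that] ln1 by (intro add_mono mult_left_mono) (auto simp: a_def b_def)
    finally show ?thesis by (simp add: algebra_simps)
  qed
  then show ?thesis
    by (intro bigoI[of _ "a * (real s + 4) + b"] eventually_sequentiallyI[of 3])
       (smt (verit, best) abs_of_nat abs_ge_self mult_left_mono of_nat_0_le_iff a_def b_def add_nonneg_nonneg mult_nonneg_nonneg real_norm_def)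
qed

text \<open>\<open>2 ^ depth\<close> is the \<open>C\<close>-th power of
  \<open>2 ^ Suc top_window\<close>, and \<open>in_range_bound\<close> makes the latter linear in
  the length of \<open>x\<close>.\<close>

lemma length_addressed_word_poly:
  "length (addressed_word x) \<le> poly (smult (2 * B) ([:8, 4:] ^ C)) (length x)"
proof -
  let ?n = "length x" and ?g = "top_window (length x)"
  have "in_range ?n ?g" by (simp add: in_range_iff)
  then have 1: "2 ^ ?g \<le> ?n + Suc ?g" by (rule in_range_bound)
  have "2 * Suc g \<le> 2 ^ g + 4" for g :: nat
  proof (cases g)
    case (Suc h)
    have "h < 2 ^ h" by (rule less_exp)
    then have "2 * h \<le> 2 * 2 ^ h" by simp
    then show ?thesis by (simp add: Suc)
  qed simp
  from this[of ?g] 1 have "2 ^ Suc ?g \<le> 4 * ?n + 8" by simp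
  then have "(2 ^ Suc ?g) ^ C \<le> (4 * ?n + 8) ^ C" by (rule power_mono) simp
  moreover have "(2::nat) ^ depth ?n = (2 ^ Suc ?g) ^ C"
    unfolding depth_def by (simp only: power_mult[symmetric] mult.commute)
  ultimately have "2 ^ depth ?n \<le> (4 * ?n + 8) ^ C" by (simp only:)
  then show ?thesis by (simp add: length_addressed_word poly_power algebra_simps)
qed

theorem DLOGTIME_computable_addressed_word: "DLOGTIME_computable addressed_word"
proof -
  interpret finite_program "\<lambda>q. q = Accept" queries delta "k + 7" controls \<Gamma> Start
    by (rule finite_program_addressing)
  have "target \<in> DLOGTIME"
    by (rule decidable_in_DLOGTIME[OF total_time_log]) (rule decides_target)
  then show ?thesis
    unfolding DLOGTIME_computable_def target_def using length_addressed_word_poly by blast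
qed

end

section \<open>Alternating machines as games\<close>

text \<open>\<open>Guess\<close> and \<open>Verify\<close>: the existential player announces the answer to a query; the universal
  player either accepts the announcement and continues, or freezes the configuration to have it
  checked at the very end. So every play needs at most one query.\<close>

datatype game =
    At nat | Guess nat "observation list" | Verify nat observation
  | Choose bool "(nat \<times> (symbol \<times> direction) list) list" | Frozen observation | Dead

definition half :: "bool \<Rightarrow> 'a list \<Rightarrow> 'a list" where
  "half b xs = (if b then drop (length xs div 2) xs else take (length xs div 2) xs)"

lemma half_append: "length us = length vs \<Longrightarrow> half b (us @ vs) = (if b then vs else us)"
  by (simp add: half_def)

lemma set_half: "set (half b xs) \<subseteq> set xs"
  by (auto simp: half_def dest: in_set_takeD in_set_dropD)

lemma length_half: "length (half b xs) \<le> length xs"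
  by (auto simp: half_def)

lemma power_length_cases:
  assumes "length xs = 2 ^ Suc l"
  obtains us vs where "xs = us @ vs" "length us = 2 ^ l" "length vs = 2 ^ l"
  using that[of "take (2 ^ l) xs" "drop (2 ^ l) xs"] assms by auto

locale alternating =
  fixes M :: machine
  assumes alternating: "alternating_machine M"
begin

definition table :: "((nat \<times> observation \<times> symbol list) \<times> (nat \<times> (symbol \<times> direction) list)) list" where
  "table = (SOME xs. set xs = transitions M)"

lemma set_table: "set table = transitions M"
  unfolding table_def
  by (rule someI_ex, rule finite_list) (use alternating in \<open>simp add: alternating_machine_def\<close>)

definition choices :: nat where
  "choices = Suc (length table)"

text \<open>Repeating the first entry brings every nonempty list to \<open>2 ^ choices\<close>
  entries, so each move of the machine takes exactly \<open>choices\<close> bits; repetitions change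
  neither a conjunction nor a disjunction.\<close>

definition candidates :: "nat \<Rightarrow> observation \<Rightarrow> symbol list \<Rightarrow> (nat \<times> (symbol \<times> direction) list) list" where
  "candidates q ob rs =
     (let cs = map snd (filter (\<lambda>t. fst t = (q, ob, rs)) table)
      in if cs = [] then [] else cs @ replicate (2 ^ choices - length cs) (hd cs))"

lemma set_candidates: "set (candidates q ob rs) = {r. ((q, ob, rs), r) \<in> transitions M}"
proof -
  define cs where "cs = map snd (filter (\<lambda>t. fst t = (q, ob, rs)) table)"
  have "set (candidates q ob rs) = set cs"
    unfolding candidates_def Let_def cs_def[symmetric]
    by (cases cs) (auto simp: set_replicate_conv_if)
  also have "\<dots> = {r. ((q, ob, rs), r) \<in> transitions M}"
    unfolding set_table[symmetric] cs_def by force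
  finally show ?thesis .
qed

lemma length_candidates:
  assumes "candidates q ob rs \<noteq> []" shows "length (candidates q ob rs) = 2 ^ choices"
proof -
  let ?cs = "map snd (filter (\<lambda>t. fst t = (q, ob, rs)) table)"
  have "length ?cs \<le> length table" by simp
  also have "\<dots> < choices" by (simp add: choices_def)
  also have "\<dots> < 2 ^ choices" by (rule less_exp)
  finally show ?thesis using assms unfolding candidates_def Let_def by (auto split: if_splits)
qed

text \<open>A stuck configuration is lost even in a universal state, where the empty conjunction
  would count as won; this agrees with \<open>accepting\<close>.\<close>

definition enter :: "nat \<Rightarrow> observation \<Rightarrow> symbol list \<Rightarrow> game" where
  "enter q ob rs = (if candidates q ob rs = [] then Dead
     else Choose (q \<in> universal_states M) (candidates q ob rs))"

text \<open>A round hands over one bit of each player, and the bits that a position does not ask for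
  are ignored. \<open>Letter True\<close> occurs twice to make four announcements, that is, two
  bits. Accepting, frozen and dead positions stay as they are, so surplus rounds do no harm.\<close>

fun micro :: "bool \<Rightarrow> bool \<Rightarrow> game \<Rightarrow> symbol list \<Rightarrow> game \<times> (symbol \<times> direction) list" where
  "micro a b (At q) rs =
     (if q \<in> accepting_states M then At q
      else if q \<in> query_states M then Guess q [Outside, Letter False, Letter True, Letter True]
      else enter q No_Query rs, idle rs)"
| "micro a b (Guess q obs) rs =
     (if length (half b obs) = 1 then Verify q (hd (half b obs)) else Guess q (half b obs), idle rs)"
| "micro a b (Verify q ob) rs = (if a then Frozen ob else enter q ob rs, idle rs)"
| "micro a b (Choose u cs) rs =
     (let cs' = half (if u then a else b) cs
      in if length cs' = 1 then (At (fst (hd cs')), snd (hd cs')) else (Choose u cs', idle rs))"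
| "micro a b (Frozen ob) rs = (Frozen ob, idle rs)"
| "micro a b Dead rs = (Dead, idle rs)"

definition game_step :: "bool \<Rightarrow> bool \<Rightarrow> game \<times> tape list \<Rightarrow> game \<times> tape list" where
  "game_step a b c = (fst (micro a b (fst c) (map scanned (snd c))),
     map2 act (snd (micro a b (fst c) (map scanned (snd c)))) (snd c))"

definition won :: "bool list \<Rightarrow> game \<times> tape list \<Rightarrow> bool" where
  "won x c = (case fst c of
      At q \<Rightarrow> q \<in> accepting_states M
    | Frozen ob \<Rightarrow> position_observation x (hd (snd c)) = ob
    | _ \<Rightarrow> False)"

primrec game_value :: "bool list \<Rightarrow> nat \<Rightarrow> game \<times> tape list \<Rightarrow> bool" where
  "game_value x 0 c = won x c"
| "game_value x (Suc p) c = (\<forall>a. \<exists>b. game_value x p (game_step a b c))"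

lemma game_value_accepting: "q \<in> accepting_states M \<Longrightarrow> game_value x p (At q, ts)"
  by (induction p) (auto simp: won_def game_step_def)

lemma game_value_Frozen: "game_value x p (Frozen ob, ts) \<longleftrightarrow> position_observation x (hd ts) = ob"
  by (induction p) (auto simp: won_def game_step_def)

lemma game_value_Dead: "\<not> game_value x p (Dead, ts)"
  by (induction p) (auto simp: won_def game_step_def)

lemma game_value_Choose:
  assumes "length cs = 2 ^ Suc l"
  shows "game_value x (Suc l + p) (Choose u cs, ts) \<longleftrightarrow>
    (if u then \<forall>c\<in>set cs. game_value x p (At (fst c), map2 act (snd c) ts)
     else \<exists>c\<in>set cs. game_value x p (At (fst c), map2 act (snd c) ts))"
  using assms
proof (induction l arbitrary: cs)
  case 0
  then obtain c d where "cs = [c, d]"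
    by (auto simp: length_Suc_conv numeral_2_eq_2)
  then show ?case by (cases u) (auto simp: game_step_def half_def all_bool_eq ex_bool_eq)
next
  case (Suc l)
  obtain us vs where cs: "cs = us @ vs" "length us = 2 ^ Suc l" "length vs = 2 ^ Suc l"
    using Suc.prems by (rule power_length_cases)
  have ne: "2 ^ Suc l \<noteq> Suc 0" by simp
  have h: "game_step a b (Choose u cs, ts) = (Choose u (if (if u then a else b) then vs else us), ts)" for a b
    using cs ne by (auto simp: game_step_def half_append Let_def)
  show ?case
    unfolding add_Suc[of "Suc l"] game_value.simps h
    using Suc.IH[OF cs(2)] Suc.IH[OF cs(3)] cs(1)
    by (cases u) (auto simp: all_bool_eq ex_bool_eq)
qed

lemma game_value_enter:
  "game_value x (choices + p) (enter q ob rs, ts) \<longleftrightarrow>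
    candidates q ob rs \<noteq> [] \<and>
    (if q \<in> universal_states M
     then \<forall>c\<in>set (candidates q ob rs). game_value x p (At (fst c), map2 act (snd c) ts)
     else \<exists>c\<in>set (candidates q ob rs). game_value x p (At (fst c), map2 act (snd c) ts))"
proof (cases "candidates q ob rs = []")
  case True
  then show ?thesis by (simp add: enter_def game_value_Dead)
next
  case False
  from game_value_Choose[OF length_candidates[OF False, unfolded choices_def], of x p] False
  show ?thesis by (simp add: enter_def choices_def)
qed

lemma game_value_Verify:
  "game_value x (Suc p) (Verify q ob, ts) \<longleftrightarrow>
     position_observation x (hd ts) = ob \<and> game_value x p (enter q ob (map scanned ts), ts)"
  by (auto simp: game_step_def all_bool_eq game_value_Frozen)

lemma game_value_Guess:
  "game_value x (Suc (Suc p)) (Guess q [o1, o2, o3, o4], ts) \<longleftrightarrow>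
     (\<exists>ob\<in>{o1, o2, o3, o4}. game_value x p (Verify q ob, ts))"
  by (auto simp: game_step_def half_def all_bool_eq ex_bool_eq)

text \<open>Announcing and verifying an answer costs three rounds, which are left over when the
  state makes no query; so the remaining number of rounds is only known up to 3. In the query case a
  false announcement is refuted by freezing, so only the true one can win.\<close>

lemma game_value_At:
  assumes "q \<notin> accepting_states M"
  shows "\<exists>r. 4 + choices + p \<le> r + 4 \<and> r \<le> choices + p + 3 \<and>
    game_value x (4 + choices + p) (At q, ts) =
    game_value x r (enter q (observe M x (q, ts)) (map scanned ts), ts)"
proof (cases "q \<in> query_states M")
  case True
  have ob: "observe M x (q, ts) = position_observation x (hd ts)"
    using True by (simp add: observe_def position_observation_def)
  have "position_observation x (hd ts) \<in> {Outside, Letter False, Letter True}"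
    by (auto simp: position_observation_def Let_def)
  moreover have "game_value x (4 + choices + p) (At q, ts) =
      game_value x (Suc (Suc (Suc (choices + p)))) (Guess q [Outside, Letter False, Letter True, Letter True], ts)"
    using assms True by (simp add: game_step_def eval_nat_numeral)
  ultimately have "game_value x (4 + choices + p) (At q, ts) =
    game_value x (choices + p) (enter q (observe M x (q, ts)) (map scanned ts), ts)"
    unfolding game_value_Guess game_value_Verify ob by auto
  then show ?thesis by (intro exI[of _ "choices + p"]) auto
next
  case False
  have "game_value x (4 + choices + p) (At q, ts) =
      game_value x (choices + p + 3) (enter q No_Query (map scanned ts), ts)"
    using assms False by (simp add: game_step_def eval_nat_numeral)
  then show ?thesis using False by (intro exI[of _ "choices + p + 3"]) (auto simp: observe_def)
qed

lemma successor_candidates: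
  "successor M x (q, ts) d \<longleftrightarrow>
     (\<exists>c\<in>set (candidates q (observe M x (q, ts)) (map scanned ts)). d = (fst c, map2 act (snd c) ts))"
  unfolding set_candidates successor_def by (cases d) auto

lemma ex_successor:
  "(\<exists>d. successor M x (q, ts) d) \<longleftrightarrow> candidates q (observe M x (q, ts)) (map scanned ts) \<noteq> []"
  unfolding successor_candidates by (cases "candidates q (observe M x (q, ts)) (map scanned ts)") auto

lemma accepting_iff:
  assumes "q \<notin> accepting_states M"
  shows "accepting M x (q, ts) \<longleftrightarrow>
    (\<exists>d. successor M x (q, ts) d) \<and>
    (if q \<in> universal_states M then \<forall>d. successor M x (q, ts) d \<longrightarrow> accepting M x d
     else \<exists>d. successor M x (q, ts) d \<and> accepting M x d)"
  by (subst accepting.simps) (use assms in auto)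

lemma accepting_candidates:
  fixes x :: "bool list" and ts :: "tape list"
  assumes "q \<notin> accepting_states M"
  defines "cs \<equiv> candidates q (observe M x (q, ts)) (map scanned ts)"
  shows "accepting M x (q, ts) \<longleftrightarrow> cs \<noteq> [] \<and>
    (if q \<in> universal_states M then \<forall>c\<in>set cs. accepting M x (fst c, map2 act (snd c) ts)
     else \<exists>c\<in>set cs. accepting M x (fst c, map2 act (snd c) ts))"
proof -
  have 1: "(\<forall>d. (\<exists>c\<in>A. d = f c) \<longrightarrow> P d) \<longleftrightarrow> (\<forall>c\<in>A. P (f c))"
    "(\<exists>d. (\<exists>c\<in>A. d = f c) \<and> P d) \<longleftrightarrow> (\<exists>c\<in>A. P (f c))"
    for A :: "'x set" and f :: "'x \<Rightarrow> 'y" and P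
    by blast+
  show ?thesis
    unfolding accepting_iff[OF assms(1)] ex_successor successor_candidates 1 cs_def ..
qed

text \<open>A step of the machine uses at most \<open>4 + choices\<close> rounds: one to look at the
  state, two to announce, one to verify, and \<open>choices\<close> to move. The inequality absorbs
  the rounds saved where there is no query.\<close>

theorem game_value_accepting_iff:
  assumes "halts_within M x t (q, ts)" "(4 + choices) * Suc t \<le> p"
  shows "game_value x p (At q, ts) \<longleftrightarrow> accepting M x (q, ts)"
  using assms
proof (induction t arbitrary: q ts p)
  case (0 q ts p)
  show ?case
  proof (cases "q \<in> accepting_states M")
    case True
    then show ?thesis by (simp add: game_value_accepting accepting.final)
  next
    case False
    obtain p' where p: "p = 4 + choices + p'" using 0 by (auto simp: le_iff_add)
    obtain r where r: "4 + choices + p' \<le> r + 4" "game_value x p (At q, ts) =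
      game_value x r (enter q (observe M x (q, ts)) (map scanned ts), ts)"
      using game_value_At[OF False, of p'] unfolding p by blast
    obtain r' where "r = choices + r'" using r(1) by (auto simp: le_iff_add)
    then show ?thesis using 0(1) r(2) accepting_candidates[OF False, of x ts]
      unfolding halts_within.simps ex_successor by (simp add: game_value_enter)
  qed
next
  case (Suc t q ts p)
  show ?case
  proof (cases "q \<in> accepting_states M")
    case True
    then show ?thesis by (simp add: game_value_accepting accepting.final)
  next
    case False
    obtain p' where p: "p = 4 + choices + p'" "(4 + choices) * Suc t \<le> p'"
    proof (rule that[of "p - (4 + choices)"])
      have "(4 + choices) + (4 + choices) * Suc t \<le> p" using Suc.prems(2) by simp
      then show "p = 4 + choices + (p - (4 + choices))" "(4 + choices) * Suc t \<le> p - (4 + choices)"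
        by linarith+
    qed
    obtain r where r: "4 + choices + p' \<le> r + 4" "game_value x p (At q, ts) =
      game_value x r (enter q (observe M x (q, ts)) (map scanned ts), ts)"
      using game_value_At[OF False, of p'] unfolding p by blast
    obtain r' where r': "r = choices + r'" using r(1) by (auto simp: le_iff_add)
    have "game_value x r' (At (fst c), map2 act (snd c) ts) = accepting M x (fst c, map2 act (snd c) ts)"
      if "c \<in> set (candidates q (observe M x (q, ts)) (map scanned ts))" for c
    proof (rule Suc.IH)
      show "halts_within M x t (fst c, map2 act (snd c) ts)"
        using Suc.prems(1) that by (auto simp: successor_candidates)
      show "(4 + choices) * Suc t \<le> r'" using r(1) r' p(2) by simp
    qed
    then show ?thesis using r(2) accepting_candidates[OF False, of x ts] unfolding r'
      by (simp add: game_value_enter cong: ball_cong bex_cong)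
  qed
qed

section \<open>The game as a tree of NOR gates\<close>

text \<open>The same game fed bit by bit; the first bit of every pair is the universal player's.\<close>

definition feed :: "bool \<Rightarrow> bool option \<times> game \<Rightarrow> symbol list \<Rightarrow> (bool option \<times> game) \<times> (symbol \<times> direction) list" where
  "feed b c rs = (case fst c of
      None \<Rightarrow> ((Some b, snd c), idle rs)
    | Some a \<Rightarrow> ((None, fst (micro a b (snd c) rs)), snd (micro a b (snd c) rs)))"

definition feed_step :: "bool \<Rightarrow> (bool option \<times> game) \<times> tape list \<Rightarrow> (bool option \<times> game) \<times> tape list" where
  "feed_step b c = (fst (feed b (fst c) (map scanned (snd c))),
     map2 act (snd (feed b (fst c) (map scanned (snd c)))) (snd c))"

primrec nor_value :: "bool list \<Rightarrow> nat \<Rightarrow> (bool option \<times> game) \<times> tape list \<Rightarrow> bool" where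
  "nor_value x 0 c = won x (snd (fst c), snd c)"
| "nor_value x (Suc j) c \<longleftrightarrow> \<not> nor_value x j (feed_step False c) \<and> \<not> nor_value x j (feed_step True c)"

text \<open>A round, \<open>\<forall>a. \<exists>b.\<close>, is a NOR of two NORs, so it takes two
  levels of gates.\<close>

lemma nor_value_game: "nor_value x (2 * p) ((None, c), ts) = game_value x p (c, ts)"
proof (induction p arbitrary: c ts)
  case (Suc p)
  have 1: "feed_step a ((None, c), ts) = ((Some a, c), ts)" for a
    by (simp add: feed_step_def feed_def)
  have 2: "feed_step b ((Some a, c), ts) = ((None, fst (game_step a b (c, ts))), snd (game_step a b (c, ts)))" for a b
    by (simp add: feed_step_def feed_def game_step_def)
  show ?case using Suc by (auto simp: 1 2 all_bool_eq ex_bool_eq)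
qed (simp add: won_def)

definition game_states :: "nat set" where
  "game_states = insert (initial_state M) (fst ` snd ` transitions M)"

definition games :: "game set" where
  "games = {Dead} \<union> At ` game_states \<union> Frozen ` UNIV
     \<union> (\<lambda>(q, obs). Guess q obs) ` (game_states \<times> {obs. set obs \<subseteq> UNIV \<and> length obs \<le> 4})
     \<union> (\<lambda>(q, ob). Verify q ob) ` (game_states \<times> UNIV)
     \<union> (\<lambda>(u, cs). Choose u cs) ` (UNIV \<times> {cs. set cs \<subseteq> snd ` transitions M \<and> length cs \<le> 2 ^ choices})"

lemma finite_transitions: "finite (transitions M)"
  using alternating by (simp add: alternating_machine_def)

lemma finite_observation: "finite (UNIV :: observation set)"
proof (rule finite_subset)
  show "UNIV \<subseteq> {No_Query, Outside, Letter True, Letter False}"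
  proof
    fix ob :: observation
    show "ob \<in> {No_Query, Outside, Letter True, Letter False}" by (cases ob) auto
  qed
qed simp

lemma finite_games: "finite games"
proof -
  have "finite game_states" using finite_transitions by (simp add: game_states_def)
  moreover have "finite {obs :: observation list. set obs \<subseteq> UNIV \<and> length obs \<le> 4}"
    by (rule finite_lists_length_le) (rule finite_observation)
  moreover have "finite {cs. set cs \<subseteq> snd ` transitions M \<and> length cs \<le> 2 ^ choices}"
    by (rule finite_lists_length_le) (simp add: finite_transitions)
  ultimately show ?thesis
    unfolding games_def using finite_observation
    by (intro finite_UnI finite_imageI finite_cartesian_product) auto
qed

lemma games_simps [simp]:
  "Dead \<in> games" "Frozen ob \<in> games"
  "At q \<in> games \<longleftrightarrow> q \<in> game_states"
  "Guess q obs \<in> games \<longleftrightarrow> q \<in> game_states \<and> length obs \<le> 4"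
  "Verify q ob \<in> games \<longleftrightarrow> q \<in> game_states"
  "Choose u cs \<in> games \<longleftrightarrow> set cs \<subseteq> snd ` transitions M \<and> length cs \<le> 2 ^ choices"
  by (auto simp: games_def image_iff)

definition machine_symbols :: "symbol set" where
  "machine_symbols = (\<Union>r\<in>transitions M. fst ` set (snd (snd r)))"

lemma finite_machine_symbols: "finite machine_symbols"
  unfolding machine_symbols_def using finite_transitions by auto

lemma enter_games: "enter q ob rs \<in> games"
proof (cases "candidates q ob rs = []")
  case False
  then show ?thesis using set_candidates[of q ob rs] length_candidates[OF False]
    by (force simp: enter_def)
qed (simp add: enter_def)

lemma micro_closed:
  assumes "c \<in> games" "length rs = Suc (work_tapes M)"
  shows "fst (micro a b c rs) \<in> games \<and> length (snd (micro a b c rs)) = Suc (work_tapes M) \<and>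
    fst ` set (snd (micro a b c rs)) \<subseteq> set rs \<union> machine_symbols"
proof (cases c)
  case (Choose u cs)
  let ?cs = "half (if u then a else b) cs"
  have cs: "set ?cs \<subseteq> snd ` transitions M" "length ?cs \<le> 2 ^ choices"
    using assms(1) Choose set_half[of "if u then a else b" cs] length_half[of "if u then a else b" cs] by auto
  show ?thesis
  proof (cases "length ?cs = 1")
    case True
    then have "hd ?cs \<in> snd ` transitions M" using cs(1) by (cases ?cs) auto
    then obtain t where t: "t \<in> transitions M" "hd ?cs = snd t" by auto
    then have "length (snd (hd ?cs)) = Suc (work_tapes M)"
      using alternating unfolding alternating_machine_def by (cases t) fastforce
    moreover have "fst (hd ?cs) \<in> game_states" using t by (auto simp: game_states_def)
    moreover have "fst ` set (snd (hd ?cs)) \<subseteq> machine_symbols" using t by (auto simp: machine_symbols_def)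
    ultimately show ?thesis using Choose True by (cases u) (simp_all add: Let_def le_supI2)
  next
    case False
    then show ?thesis using Choose cs assms(2) by (auto simp: Let_def idle_def)
  qed
next
  case (Guess q obs)
  then show ?thesis using assms length_half[of b obs] by (auto simp: idle_def)
qed (use assms enter_games in \<open>auto simp: idle_def\<close>)

lemma feed_closed:
  assumes "snd c \<in> games" "length rs = Suc (work_tapes M)"
  shows "snd (fst (feed b c rs)) \<in> games \<and> length (snd (feed b c rs)) = Suc (work_tapes M) \<and>
    fst ` set (snd (feed b c rs)) \<subseteq> set rs \<union> machine_symbols"
  using micro_closed[OF assms] assms
  by (cases "fst c") (auto simp: feed_def idle_def)

end

section \<open>Evaluating Boolean formulas in groups\<close>

text \<open>The first Boolean of a \<open>Gate\<close> tells whether it depends on its truth value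
  or constantly stands for \<open>level j\<close>; the second one marks an inverse.\<close>

datatype 'g item = Const 'g | Gate bool bool

text \<open>\<open>shift\<close> is an endomorphism of the subgroup generated by the finite set
  \<open>E\<close>, so it is determined by words for the images of finitely many letters.\<close>

locale tower = group G for G (structure) +
  fixes E :: "'a set" and shift :: "'a \<Rightarrow> 'a" and a0 y z :: 'a
  assumes finite_E: "finite E" and E_carrier: "E \<subseteq> carrier G"
    and a0: "a0 \<in> E" and y: "y \<in> E" and z: "z \<in> E"
    and shift_closed: "\<And>u. u \<in> generate G E \<Longrightarrow> shift u \<in> generate G E"
    and shift_mult: "\<And>u v. u \<in> generate G E \<Longrightarrow> v \<in> generate G E \<Longrightarrow> shift (u \<otimes> v) = shift u \<otimes> shift v"
begin

definition comm :: "'a \<Rightarrow> 'a \<Rightarrow> 'a" where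
  "comm u v = inv u \<otimes> inv v \<otimes> u \<otimes> v"

primrec level :: "nat \<Rightarrow> 'a" where
  "level 0 = a0"
| "level (Suc j) = comm (comm (level j) ((shift ^^ j) y)) (comm (level j) ((shift ^^ j) z))"

abbreviation "product ws \<equiv> foldr (\<otimes>) ws \<one>"

lemma product_closed: "set ws \<subseteq> carrier G \<Longrightarrow> product ws \<in> carrier G"
  by (induction ws) auto

lemma product_append:
  "set us \<subseteq> carrier G \<Longrightarrow> set vs \<subseteq> carrier G \<Longrightarrow> product (us @ vs) = product us \<otimes> product vs"
  by (induction us) (auto simp: m_assoc product_closed)

lemma product_ones: "set ws \<subseteq> {\<one>} \<Longrightarrow> product ws = \<one>"
  by (induction ws) auto

lemma product_rev_inv:
  "set ws \<subseteq> carrier G \<Longrightarrow> product (rev (map (\<lambda>w. inv w) ws)) = inv (product ws)"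
proof (induction ws)
  case (Cons w ws)
  have "product (rev (map (\<lambda>w. inv w) ws) @ [inv w]) = inv (product ws) \<otimes> inv w"
    using Cons by (subst product_append) auto
  then show ?case using Cons.prems by (simp add: inv_mult_group product_closed del: foldr_append)
qed simp

lemma generate_E_carrier: "generate G E \<subseteq> carrier G"
  using generate_in_carrier[OF E_carrier] by blast

lemma generate_mult: "u \<in> generate G E \<Longrightarrow> v \<in> generate G E \<Longrightarrow> u \<otimes> v \<in> generate G E"
  by (rule generate.eng)

lemma generate_inv: "u \<in> generate G E \<Longrightarrow> inv u \<in> generate G E"
  using generate_m_inv_closed[OF E_carrier] .

lemma shift_one: "shift \<one> = \<one>"
proof -
  have 1: "\<one> \<in> generate G E" by (rule generate.one)
  then have c: "shift \<one> \<in> carrier G" using shift_closed generate_E_carrier by blast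
  have "shift \<one> \<otimes> shift \<one> = shift \<one>" using shift_mult[OF 1 1] by simp
  then show ?thesis using c l_cancel_one by blast
qed

lemma shift_inv: assumes "u \<in> generate G E" shows "shift (inv u) = inv (shift u)"
proof -
  have c: "u \<in> carrier G" "shift u \<in> carrier G" "shift (inv u) \<in> carrier G"
    using assms shift_closed generate_inv generate_E_carrier by blast+
  have "shift (inv u) \<otimes> shift u = \<one>"
    using shift_mult[OF generate_inv[OF assms] assms] c shift_one by simp
  then show ?thesis using c by (simp add: inv_equality)
qed

lemma shift_pow_closed: "u \<in> generate G E \<Longrightarrow> (shift ^^ j) u \<in> generate G E"
  by (induction j) (auto simp: shift_closed)

lemma shift_pow_carrier: "u \<in> generate G E \<Longrightarrow> (shift ^^ j) u \<in> carrier G"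
  using shift_pow_closed generate_E_carrier by blast

lemma shift_pow_mult: "u \<in> generate G E \<Longrightarrow> v \<in> generate G E \<Longrightarrow>
    (shift ^^ j) (u \<otimes> v) = (shift ^^ j) u \<otimes> (shift ^^ j) v"
  by (induction j) (auto simp: shift_mult shift_pow_closed)

lemma shift_pow_inv: "u \<in> generate G E \<Longrightarrow> (shift ^^ j) (inv u) = inv ((shift ^^ j) u)"
  by (induction j) (auto simp: shift_inv shift_pow_closed)

lemma shift_pow_one: "(shift ^^ j) \<one> = \<one>"
  by (induction j) (auto simp: shift_one)

lemma shift_pow_product:
  "set ws \<subseteq> generate G E \<Longrightarrow> (shift ^^ j) (product ws) = product (map (shift ^^ j) ws)"
proof (induction ws)
  case (Cons w ws)
  have "product ws \<in> generate G E" using Cons.prems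
    by (induction ws) (auto simp: generate.one generate_mult)
  then show ?case using Cons by (simp add: shift_pow_mult)
qed (simp add: shift_pow_one)

lemma comm_closed: "u \<in> carrier G \<Longrightarrow> v \<in> carrier G \<Longrightarrow> comm u v \<in> carrier G"
  by (simp add: comm_def)

lemma E_generate: "e \<in> E \<Longrightarrow> e \<in> generate G E"
  by (rule generate.incl)

lemma level_closed: "level j \<in> carrier G"
  using a0 y z E_carrier by (induction j) (auto simp: comm_closed shift_pow_carrier E_generate)

lemma comm_one: "u \<in> carrier G \<Longrightarrow> comm \<one> u = \<one>" "u \<in> carrier G \<Longrightarrow> comm u \<one> = \<one>"
  by (simp_all add: comm_def)

definition alphabet :: "'a set" where
  "alphabet = insert \<one> (E \<union> (\<lambda>e. inv e) ` E)"

lemma finite_alphabet: "finite alphabet"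
  by (simp add: alphabet_def finite_E)

lemma alphabet_generate: "alphabet \<subseteq> generate G E"
  using generate_inv by (auto simp: alphabet_def generate.one E_generate)

lemma alphabet_carrier: "alphabet \<subseteq> carrier G"
  using alphabet_generate generate_E_carrier by blast

lemma alphabet_inv: "e \<in> alphabet \<Longrightarrow> inv e \<in> alphabet"
  using E_carrier by (auto simp: alphabet_def)

lemma generate_product:
  "u \<in> generate G E \<Longrightarrow> \<exists>ws. set ws \<subseteq> alphabet \<and> product ws = u"
proof (induction rule: generate.induct)
  case one
  then show ?case by (intro exI[of _ "[]"]) auto
next
  case (incl h)
  then show ?case using E_carrier by (intro exI[of _ "[h]"]) (auto simp: alphabet_def)
next
  case (inv h)
  then show ?case using E_carrier by (intro exI[of _ "[inv h]"]) (auto simp: alphabet_def)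
next
  case (eng h1 h2)
  then obtain us vs where "set us \<subseteq> alphabet" "product us = h1" "set vs \<subseteq> alphabet" "product vs = h2"
    by blast
  then show ?case using alphabet_carrier
    by (intro exI[of _ "us @ vs"]) (subst product_append; auto)
qed

definition substitution :: "'a \<Rightarrow> 'a list" where
  "substitution e = (SOME ws. set ws \<subseteq> alphabet \<and> product ws = shift e)"

lemma substitution:
  assumes "e \<in> alphabet"
  shows "set (substitution e) \<subseteq> alphabet" "product (substitution e) = shift e"
proof -
  have "\<exists>ws. set ws \<subseteq> alphabet \<and> product ws = shift e"
    using assms alphabet_generate by (intro generate_product shift_closed) auto
  from someI_ex[OF this] show "set (substitution e) \<subseteq> alphabet" "product (substitution e) = shift e"
    by (auto simp: substitution_def)
qed

text \<open>32 is the number of items in two double commutators, as needed for a negated gate; and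
  \<open>n \<le> 2 ^ n\<close> turns any bound on the lengths into a power of two.\<close>

definition beta :: nat where
  "beta = Max ((\<lambda>e. length (substitution e)) ` alphabet) + 32"

lemma length_substitution: "e \<in> alphabet \<Longrightarrow> length (substitution e) \<le> 2 ^ beta"
proof -
  assume "e \<in> alphabet"
  then have "length (substitution e) \<le> beta"
    unfolding beta_def using finite_alphabet by (intro trans_le_add1 Max_ge) auto
  also have "beta \<le> 2 ^ beta" by (rule less_imp_le[OF less_exp])
  finally show ?thesis .
qed

lemma beta_large: "32 \<le> (2::nat) ^ beta" "0 < beta"
proof -
  have "32 \<le> beta" by (simp add: beta_def)
  also have "beta \<le> 2 ^ beta" by (rule less_imp_le[OF less_exp])
  finally show "32 \<le> (2::nat) ^ beta" .
  show "0 < beta" by (simp add: beta_def)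
qed

section \<open>Expanding one item into the items of the next lower level\<close>

fun inv_item :: "'a item \<Rightarrow> 'a item" where
  "inv_item (Const e) = Const (inv e)"
| "inv_item (Gate a i) = Gate a (\<not> i)"

definition inv_items :: "('a item \<times> bool) list \<Rightarrow> ('a item \<times> bool) list" where
  "inv_items xs = rev (map (apfst inv_item) xs)"

text \<open>The 16 factors of \<open>comm (comm v y) (comm u z)\<close>, where \<open>v\<close> and
  \<open>u\<close> are the gates of the children \<open>False\<close> and \<open>True\<close>. The
  Boolean paired with an item names the child whose truth value it refers to; for a constant it is
  arbitrary.\<close>

definition comm_items :: "bool \<Rightarrow> ('a item \<times> bool) list" where
  "comm_items a =
     [(Const (inv y), False), (Gate a True, False), (Const y, False), (Gate a False, False),
      (Const (inv z), False), (Gate a True, True), (Const z, False), (Gate a False, True),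
      (Gate a True, False), (Const (inv y), False), (Gate a False, False), (Const y, False),
      (Gate a True, True), (Const (inv z), False), (Gate a False, True), (Const z, False)]"

definition pad :: "('a item \<times> bool) list \<Rightarrow> ('a item \<times> bool) list" where
  "pad xs = xs @ replicate (2 ^ beta - length xs) (Const \<one>, False)"

text \<open>A gate of truth value \<open>t\<close> at height \<open>j\<close> stands for \<open>\<one>\<close> if \<open>t\<close> holds and for \<open>level j\<close>
  otherwise. Then the double commutator of two gates computes their disjunction, and multiplying
  \<open>level (Suc j)\<close> by the inverse of the commutator negates it.\<close>

fun expand :: "'a item \<Rightarrow> ('a item \<times> bool) list" where
  "expand (Const e) = pad (map (\<lambda>e. (Const e, False)) (substitution e))"
| "expand (Gate a i) = (if i then inv_items else id)
     (pad (if a then comm_items False @ inv_items (comm_items True) else comm_items False))"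

fun item_value :: "nat \<Rightarrow> 'a item \<Rightarrow> bool \<Rightarrow> 'a" where
  "item_value j (Const e) t = (shift ^^ j) e"
| "item_value j (Gate a i) t =
     (let v = (if a \<and> t then \<one> else level j) in if i then inv v else v)"

definition items :: "'a item set" where
  "items = Const ` alphabet \<union> range (\<lambda>(a, i). Gate a i)"

lemma finite_items: "finite items"
  by (simp add: items_def finite_alphabet)

lemma items_simps [simp]: "Const e \<in> items \<longleftrightarrow> e \<in> alphabet" "Gate a i \<in> items"
  by (auto simp: items_def)

lemma item_value_closed: "it \<in> items \<Longrightarrow> item_value j it t \<in> carrier G"
  using alphabet_generate by (cases it) (auto simp: Let_def level_closed shift_pow_carrier)

lemma inv_item_items: "it \<in> items \<Longrightarrow> inv_item it \<in> items"
  by (cases it) (auto simp: alphabet_inv)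

lemma item_value_inv:
  "it \<in> items \<Longrightarrow> item_value j (inv_item it) t = inv (item_value j it t)"
  using alphabet_generate by (cases it) (auto simp: Let_def level_closed shift_pow_inv)

abbreviation item_values :: "nat \<Rightarrow> (bool \<Rightarrow> bool) \<Rightarrow> ('a item \<times> bool) list \<Rightarrow> 'a list" where
  "item_values j n xs \<equiv> map (\<lambda>x. item_value j (fst x) (n (snd x))) xs"

lemma values_closed: "fst ` set xs \<subseteq> items \<Longrightarrow> set (item_values j n xs) \<subseteq> carrier G"
  using item_value_closed by auto

lemma inv_items_items: "fst ` set xs \<subseteq> items \<Longrightarrow> fst ` set (inv_items xs) \<subseteq> items"
  using inv_item_items by (auto simp: inv_items_def)

lemma product_inv_items:
  assumes "fst ` set xs \<subseteq> items"
  shows "product (item_values j n (inv_items xs)) = inv (product (item_values j n xs))"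
proof -
  have "item_values j n (inv_items xs) = rev (map (\<lambda>w. inv w) (item_values j n xs))"
    using assms item_value_inv by (auto simp: inv_items_def rev_map image_subset_iff)
  then show ?thesis using product_rev_inv[OF values_closed[OF assms]] by simp
qed

lemma one_alphabet: "\<one> \<in> alphabet"
  by (simp add: alphabet_def)

lemma comm_items_items: "fst ` set (comm_items a) \<subseteq> items"
  using y z by (auto simp: comm_items_def alphabet_def)

lemma pad_items: "fst ` set xs \<subseteq> items \<Longrightarrow> fst ` set (pad xs) \<subseteq> items"
  by (auto simp: pad_def one_alphabet)

lemma product_pad:
  assumes "fst ` set xs \<subseteq> items"
  shows "product (item_values j n (pad xs)) = product (item_values j n xs)"
proof -
  have 1: "product (item_values j n (replicate m (Const \<one>, False))) = \<one>" for m
    by (rule product_ones) (auto simp: shift_pow_one)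
  have "set (item_values j n (replicate (2 ^ beta - length xs) (Const \<one>, False))) \<subseteq> carrier G"
    by (auto simp: shift_pow_one)
  then show ?thesis
    unfolding pad_def map_append using values_closed[OF assms] 1
    by (subst product_append) (auto simp: product_closed)
qed

lemma product_comm_items:
  "product (item_values j n (comm_items a)) = (if a \<and> (n False \<or> n True) then \<one> else level (Suc j))"
proof -
  define v where "v = (if a \<and> n False then \<one> else level j)"
  define u where "u = (if a \<and> n True then \<one> else level j)"
  define p where "p = (shift ^^ j) y"
  define q where "q = (shift ^^ j) z"
  have c: "v \<in> carrier G" "u \<in> carrier G" "p \<in> carrier G" "q \<in> carrier G"
    using y z by (auto simp: v_def u_def p_def q_def level_closed shift_pow_carrier E_generate)
  have i: "(shift ^^ j) (inv y) = inv p" "(shift ^^ j) (inv z) = inv q"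
    using y z by (auto simp: p_def q_def shift_pow_inv E_generate)
  have "item_values j n (comm_items a) = [inv p, inv v, p, v, inv q, inv u, q, u, inv v, inv p, v, p, inv u, inv q, u, q]"
    by (auto simp: comm_items_def Let_def v_def u_def i) (simp_all add: p_def q_def)
  moreover have "product [inv p, inv v, p, v, inv q, inv u, q, u, inv v, inv p, v, p, inv u, inv q, u, q] =
      comm (comm v p) (comm u q)"
    using c by (simp add: comm_def inv_mult_group m_assoc)
  moreover have "comm (comm v p) (comm u q) = (if a \<and> (n False \<or> n True) then \<one> else level (Suc j))"
    using c by (auto simp: v_def u_def p_def q_def comm_one comm_closed)
  ultimately show ?thesis by simp
qed

lemma expand_items: "it \<in> items \<Longrightarrow> fst ` set (expand it) \<subseteq> items"
proof (cases it)
  case (Const e)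
  assume "it \<in> items"
  then have "fst ` set (map (\<lambda>e. (Const e, False)) (substitution e)) \<subseteq> items"
    using substitution(1)[of e] Const by auto
  then show ?thesis unfolding Const expand.simps by (rule pad_items)
next
  case (Gate a i)
  have "fst ` set (if a then comm_items False @ inv_items (comm_items True) else comm_items False) \<subseteq> items"
    using comm_items_items inv_items_items[OF comm_items_items] by (simp add: image_Un)
  from pad_items[OF this] inv_items_items[OF pad_items[OF this]] show ?thesis
    by (simp add: Gate)
qed

lemma length_expand: "it \<in> items \<Longrightarrow> length (expand it) = 2 ^ beta"
  using length_substitution beta_large
  by (cases it) (auto simp: pad_def inv_items_def comm_items_def)

lemma product_expand:
  assumes "it \<in> items"
  shows "product (item_values j n (expand it)) = item_value (Suc j) it (\<not> n False \<and> \<not> n True)"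
proof (cases it)
  case (Const e)
  then have e: "e \<in> alphabet" using assms by simp
  let ?xs = "map (\<lambda>e. (Const e, False)) (substitution e)"
  have "product (item_values j n (expand it)) = product (item_values j n ?xs)"
    unfolding Const expand.simps using substitution(1)[OF e] by (intro product_pad) auto
  also have "item_values j n ?xs = map (shift ^^ j) (substitution e)" by simp
  also have "product \<dots> = (shift ^^ j) (product (substitution e))"
    using substitution(1)[OF e] alphabet_generate by (subst shift_pow_product) auto
  \<comment> \<open>Substituting once before \<open>j\<close> shifts amounts to \<open>Suc j\<close>
    shifts of the letter.\<close>
  finally show ?thesis using Const substitution(2)[OF e] by (simp add: funpow_swap1)
next
  case (Gate a i)
  let ?xs = "if a then comm_items False @ inv_items (comm_items True) else comm_items False"
  let ?t = "\<not> n False \<and> \<not> n True"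
  have xs: "fst ` set ?xs \<subseteq> items"
    using comm_items_items inv_items_items[OF comm_items_items] by (simp add: image_Un)
  have "product (item_values j n ?xs) = (if a \<and> ?t then \<one> else level (Suc j))"
  proof (cases a)
    case True
    have "product (item_values j n ?xs) = level (Suc j) \<otimes> inv (if n False \<or> n True then \<one> else level (Suc j))"
      using True values_closed[OF comm_items_items] values_closed[OF inv_items_items[OF comm_items_items]]
      by (simp only: if_True map_append product_append product_inv_items[OF comm_items_items] product_comm_items) simp
    then show ?thesis using True level_closed[of "Suc j"] by auto
  next
    case False
    then show ?thesis by (simp only: if_False product_comm_items) simp
  qed
  moreover have "product (item_values j n (expand it)) =
      (if i then inv (product (item_values j n ?xs)) else product (item_values j n ?xs))"
    unfolding Gate expand.simps
    using product_inv_items[OF pad_items[OF xs]] product_pad[OF xs] by (cases i) simp_all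
  ultimately show ?thesis unfolding Gate by (simp add: Let_def)
qed

end

section \<open>The reduction to the word problem\<close>

lemma subset_Times_UNIV: "X \<subseteq> A \<times> UNIV \<longleftrightarrow> fst ` X \<subseteq> A"
  by (auto simp: mem_Times_iff image_subset_iff subset_eq)

text \<open>The items of the current level that the bits read so far leave open, together with the
  game that has been fed with the chosen children.\<close>

type_synonym 'g evaluation = "('g item \<times> bool) list \<times> bool option \<times> game"

locale reduction = tower G E shift a0 y z + alternating M
  for G (structure) and E :: "'g set" and shift and a0 y z :: 'g and M +
  fixes S :: "'s set" and \<sigma> :: "'s \<Rightarrow> 'g" and code :: "'s letter \<Rightarrow> bool list"
    and wd :: "'g \<Rightarrow> 's letter list" and L N :: nat and s p :: nat
  assumes \<sigma>: "\<sigma> \<in> S \<rightarrow> carrier G" and inj_code: "inj_on code (letters S)"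
    and length_code: "\<And>a. a \<in> letters S \<Longrightarrow> length (code a) = N" and N: "1 \<le> N"
    and wd: "\<And>e. e \<in> alphabet \<Longrightarrow> wd e \<in> lists (letters S) \<and> word_value G \<sigma> (wd e) = e"
    and length_wd: "\<And>e. e \<in> alphabet \<Longrightarrow> length (wd e) = L" and L: "1 \<le> L"
    and p: "1 \<le> p" and s: "1 \<le> s" and large: "2 * (2 * beta * p) * s + 2 * (L * N) + 4 < 2 ^ s"
begin

definition block :: "'g \<Rightarrow> bool list" where
  "block e = concat (map code (wd e))"

text \<open>Every bit halves the list. When one item remains, its child bit is fed to the game, and
  the next bit expands it; so one level of gates takes \<open>beta\<close> bits.\<close>

definition bit_step :: "bool \<Rightarrow> 'g evaluation \<Rightarrow> symbol list \<Rightarrow> 'g evaluation \<times> (symbol \<times> direction) list" where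
  "bit_step b c rs =
     (let xs = half b (if length (fst c) = 1 then expand (fst (hd (fst c))) else fst c)
      in if length xs = 1
         then ((xs, fst (feed (snd (hd xs)) (snd c) rs)), snd (feed (snd (hd xs)) (snd c) rs))
         else ((xs, snd c), idle rs))"

text \<open>Only at a leaf with a truth-dependent gate and a frozen game does the letter depend on
  the input; everywhere else the path determines it.\<close>

definition pending :: "'g evaluation \<Rightarrow> observation option" where
  "pending c = (case (fst (hd (fst c)), snd (snd c)) of
      (Gate True i, Frozen ob) \<Rightarrow> Some ob
    | _ \<Rightarrow> None)"

definition result :: "'g evaluation \<Rightarrow> bool \<Rightarrow> 'g" where
  "result c t = item_value 0 (fst (hd (fst c)))
     (case snd (snd c) of At q \<Rightarrow> q \<in> accepting_states M | Frozen ob \<Rightarrow> t | _ \<Rightarrow> False)"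

definition evaluations :: "'g evaluation set" where
  "evaluations = ({xs. set xs \<subseteq> items \<times> UNIV \<and> length xs \<le> 2 ^ beta} \<inter> {xs. xs \<noteq> []}) \<times> UNIV \<times> games"

definition symbols :: "symbol set" where
  "symbols = {Blank, Bit False, Bit True, Mark 0} \<union> machine_symbols"

definition start :: "'g evaluation" where
  "start = ([(Gate True False, False)], None, At (initial_state M))"

lemma item_value_alphabet: "it \<in> items \<Longrightarrow> item_value 0 it t \<in> alphabet"
  using a0 alphabet_inv one_alphabet
  by (cases it) (auto simp: Let_def alphabet_def)

lemma bit_step_closed:
  assumes c: "c \<in> evaluations" and rs: "set rs \<subseteq> symbols" "length rs = Suc (work_tapes M)"
  shows "fst (bit_step b c rs) \<in> evaluations \<and> length (snd (bit_step b c rs)) = Suc (work_tapes M) \<and>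
     fst ` set (snd (bit_step b c rs)) \<subseteq> symbols"
proof -
  obtain xs o' g where ceq: "c = (xs, o', g)" by (cases c) auto
  have xs: "set xs \<subseteq> items \<times> UNIV" "length xs \<le> 2 ^ beta" "xs \<noteq> []" and g: "g \<in> games"
    using c by (auto simp: evaluations_def ceq)
  define us where "us = (if length xs = 1 then expand (fst (hd xs)) else xs)"
  have hd: "fst (hd xs) \<in> items" using xs by (cases xs) auto
  have us: "set us \<subseteq> items \<times> UNIV" "length us \<le> 2 ^ beta" "2 \<le> length us"
  proof -
    show "set us \<subseteq> items \<times> UNIV" using xs(1) expand_items[OF hd] by (simp add: us_def subset_Times_UNIV)
    show "length us \<le> 2 ^ beta" using xs length_expand[OF hd] by (auto simp: us_def)
    show "2 \<le> length us"
      using xs(3) length_expand[OF hd] beta_large(1) by (cases xs; cases "tl xs") (auto simp: us_def)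
  qed
  define vs where "vs = half b us"
  have vs: "set vs \<subseteq> items \<times> UNIV" "length vs \<le> 2 ^ beta" "vs \<noteq> []"
    using us set_half[of b us] length_half[of b us] by (auto simp: vs_def half_def)
  have step: "bit_step b c rs =
     (if length vs = 1 then ((vs, fst (feed (snd (hd vs)) (o', g) rs)), snd (feed (snd (hd vs)) (o', g) rs))
      else ((vs, o', g), idle rs))"
    by (simp add: bit_step_def ceq us_def vs_def Let_def)
  have f: "snd (fst (feed b' (o', g) rs)) \<in> games \<and> length (snd (feed b' (o', g) rs)) = Suc (work_tapes M) \<and>
    fst ` set (snd (feed b' (o', g) rs)) \<subseteq> set rs \<union> machine_symbols" for b'
    using feed_closed[of "(o', g)" rs b'] g rs by simp
  show ?thesis
  proof (cases "length vs = 1")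
    case True
    then show ?thesis using vs f[of "snd (hd vs)"] rs unfolding step
      by (auto simp: evaluations_def symbols_def mem_Times_iff)
  next
    case False
    then show ?thesis using vs g rs unfolding step
      by (auto simp: evaluations_def idle_def)
  qed
qed

lemma length_block: "e \<in> alphabet \<Longrightarrow> length (block e) = L * N"
  unfolding block_def using wd length_wd length_code
  by (subst length_concat_blocks[where n = N]) (auto simp: lists_eq_set)

text \<open>A block encodes one group element by \<open>L\<close> letters of \<open>N\<close> bits.
  A window holds \<open>p\<close> rounds, each consisting of two levels of gates with
  \<open>beta\<close> bits.\<close>

sublocale addressing "L * N" s "2 * beta * p" block \<one> start bit_step pending result "work_tapes M"
  evaluations symbols alphabet
proof
  show "1 \<le> L * N" using L N by simp
  show "1 \<le> 2 * beta * p" using p beta_large by simp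
  show "1 \<le> s" by (rule s)
  show "2 * (2 * beta * p) * s + 2 * (L * N) + 4 < 2 ^ s" by (rule large)
  have "finite {xs :: ('g item \<times> bool) list. set xs \<subseteq> items \<times> UNIV \<and> length xs \<le> 2 ^ beta}"
    by (rule finite_lists_length_le) (simp add: finite_items)
  then show "finite evaluations"
    unfolding evaluations_def using finite_games
    by (intro finite_cartesian_product finite_Int) auto
  show "finite symbols" by (simp add: symbols_def finite_machine_symbols)
  show "{Blank, Bit False, Bit True, Mark 0} \<subseteq> symbols" by (simp add: symbols_def)
  show "start \<in> evaluations"
    using beta_large by (auto simp: evaluations_def start_def game_states_def)
  show "\<one> \<in> alphabet" by (rule one_alphabet)
  show "length (block e) = L * N" if "e \<in> alphabet" for e using that by (rule length_block)
  show "result c b \<in> alphabet" if "c \<in> evaluations" for c b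
  proof -
    have "fst (hd (fst c)) \<in> items" using that by (cases "fst c") (auto simp: evaluations_def)
    then show ?thesis unfolding result_def by (rule item_value_alphabet)
  qed
qed (use bit_step_closed in blast)+

lemma leaf_value:
  "leaf x ((xs, c), ts) = item_value 0 (fst (hd xs)) (won x (snd c, ts))"
proof (cases "fst (hd xs)")
  case (Const e)
  then show ?thesis by (simp add: leaf_def result_def)
next
  case (Gate a i)
  then show ?thesis
    by (cases a; cases "snd c") (auto simp: leaf_def result_def pending_def won_def)
qed

lemma sim_step_bit_step:
  "sim_step b ((xs, c), ts) =
     (let us = half b (if length xs = 1 then expand (fst (hd xs)) else xs)
      in if length us = 1 then let r = feed_step (snd (hd us)) (c, ts) in ((us, fst r), snd r)
         else ((us, c), ts))"
  by (auto simp: sim_step_def bit_step_def feed_step_def Let_def)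

lemma leaves_carrier: "sim_good h c \<Longrightarrow> set (leaves x n c) \<subseteq> carrier G"
  using leaves_in_EE[of h c x n] alphabet_carrier by blast

text \<open>Halving a list splits the product of the leaves into two consecutive factors, down to
  single items. The function \<open>f\<close> stands for the value below one item, supplied later by
  the induction on the height.\<close>

lemma product_leaves_list:
  assumes single: "\<And>u g ts h. fst u \<in> items \<Longrightarrow> sim_good h (([u], g), ts) \<Longrightarrow>
      product (leaves x n (([u], g), ts)) = f (fst u) (g, ts)"
    and f: "\<And>it c. it \<in> items \<Longrightarrow> f it c \<in> carrier G"
    and "fst ` set xs \<subseteq> items" "length xs = 2 ^ Suc l" "sim_good h ((xs, g), ts)"
  shows "product (leaves x (Suc l + n) ((xs, g), ts)) =
    product (map (\<lambda>u. f (fst u) (feed_step (snd u) (g, ts))) xs)"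
  using assms(3-)
proof (induction l arbitrary: xs h)
  case 0
  then obtain u v where xs: "xs = [u, v]"
    by (auto simp: length_Suc_conv numeral_2_eq_2)
  let ?r = "\<lambda>w. feed_step (snd w) (g, ts)"
  have F: "sim_step False ((xs, g), ts) = (([u], fst (?r u)), snd (?r u))"
    and T: "sim_step True ((xs, g), ts) = (([v], fst (?r v)), snd (?r v))"
    by (simp_all add: xs sim_step_bit_step half_def Let_def)
  have good: "sim_good (Suc h) (([u], fst (?r u)), snd (?r u))" "sim_good (Suc h) (([v], fst (?r v)), snd (?r v))"
    using sim_good_step[OF 0(3), of False] sim_good_step[OF 0(3), of True] F T by auto
  have "product (leaves x (Suc n) ((xs, g), ts)) = f (fst u) (?r u) \<otimes> f (fst v) (?r v)"
    using single[OF _ good(1)] single[OF _ good(2)] 0(1)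
    unfolding leaves.simps F T
    by (subst product_append) (auto simp: xs leaves_carrier[OF good(1)] leaves_carrier[OF good(2)] simp del: foldr_append)
  then show ?case using 0(1) f by (simp add: xs)
next
  case (Suc l)
  obtain us vs where xs: "xs = us @ vs" "length us = 2 ^ Suc l" "length vs = 2 ^ Suc l"
    using Suc.prems(2) by (rule power_length_cases)
  have ne: "2 ^ Suc l \<noteq> (1::nat)" "length xs \<noteq> 1" using xs by auto
  have F: "sim_step False ((xs, g), ts) = ((us, g), ts)" and T: "sim_step True ((xs, g), ts) = ((vs, g), ts)"
    using ne xs by (simp_all add: sim_step_bit_step half_append Let_def del: power_Suc)
  have good: "sim_good (Suc h) ((us, g), ts)" "sim_good (Suc h) ((vs, g), ts)"
    using sim_good_step[OF Suc.prems(3), of False] sim_good_step[OF Suc.prems(3), of True] F T by auto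
  have it: "fst ` set us \<subseteq> items" "fst ` set vs \<subseteq> items" using Suc.prems(1) xs by auto
  have cl: "set (map (\<lambda>u. f (fst u) (feed_step (snd u) (g, ts))) ws) \<subseteq> carrier G" if "fst ` set ws \<subseteq> items" for ws
    using that by (auto intro!: f)
  have "product (leaves x (Suc (Suc l + n)) ((xs, g), ts)) =
      product (leaves x (Suc l + n) ((us, g), ts)) \<otimes> product (leaves x (Suc l + n) ((vs, g), ts))"
    unfolding leaves.simps(2)[of x "Suc l + n"] F T
    using leaves_carrier[OF good(1)] leaves_carrier[OF good(2)] by (rule product_append)
  also have "\<dots> = product (map (\<lambda>u. f (fst u) (feed_step (snd u) (g, ts))) us) \<otimes>
      product (map (\<lambda>u. f (fst u) (feed_step (snd u) (g, ts))) vs)"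
    using Suc.IH[OF it(1) xs(2) good(1)] Suc.IH[OF it(2) xs(3) good(2)] by simp
  also have "\<dots> = product (map (\<lambda>u. f (fst u) (feed_step (snd u) (g, ts))) xs)"
    unfolding xs(1) map_append by (rule product_append[OF cl[OF it(1)] cl[OF it(2)], symmetric])
  finally show ?case by simp
qed

lemma product_leaves:
  "it \<in> items \<Longrightarrow> sim_good h (([(it, c)], g), ts) \<Longrightarrow>
    product (leaves x (beta * j) (([(it, c)], g), ts)) = item_value j it (nor_value x j (g, ts))"
proof (induction j arbitrary: it h c g ts)
  case 0
  then show ?case using item_value_closed[of it 0] by (simp add: leaf_value)
next
  case (Suc j)
  obtain l where l: "beta = Suc l" using beta_large(2) by (cases beta) auto
  have len: "length (expand it) = 2 ^ Suc l" using length_expand[OF Suc.prems(1)] l by simp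
  then have "length (expand it) \<noteq> 1" using beta_large(1) l by auto
  \<comment> \<open>A single item is expanded before it is halved, so from here on it can be
    replaced by its expansion.\<close>
  then have "sim_step b (([(it, c)], g), ts) = sim_step b ((expand it, g), ts)" for b
    by (simp add: sim_step_bit_step)
  moreover have n: "beta * Suc j = Suc (l + beta * j)" by (simp add: l)
  ultimately have e: "leaves x (beta * Suc j) (([(it, c)], g), ts) = leaves x (Suc l + beta * j) ((expand it, g), ts)"
    by simp
  have ne: "expand it \<noteq> []" using len by auto
  have "g \<in> UNIV \<times> games"
    using Suc.prems(2) unfolding sim_good_def by (auto simp: evaluations_def)
  then have "(expand it, g) \<in> evaluations"
    using expand_items[OF Suc.prems(1)] length_expand[OF Suc.prems(1)] ne
    by (auto simp: evaluations_def subset_Times_UNIV)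
  then have good: "sim_good h ((expand it, g), ts)"
    using Suc.prems(2) by (simp add: sim_good_def)
  have "product (leaves x (beta * Suc j) (([(it, c)], g), ts)) =
      product (map (\<lambda>u. item_value j (fst u) (nor_value x j (feed_step (snd u) (g, ts)))) (expand it))"
    unfolding e
    by (rule product_leaves_list[where f = "\<lambda>it c. item_value j it (nor_value x j c)", OF _ _ expand_items[OF Suc.prems(1)] len good])
       (use Suc.IH item_value_closed in auto)
  also have "\<dots> = item_value (Suc j) it (nor_value x (Suc j) (g, ts))"
    using product_expand[OF Suc.prems(1), of j "\<lambda>b. nor_value x j (feed_step b (g, ts))"] by simp
  finally show ?case .
qed

section \<open>From group elements back to encoded words\<close>

lemma letter_value_closed: "a \<in> letters S \<Longrightarrow> letter_value G \<sigma> a \<in> carrier G"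
  using \<sigma> by (auto simp: letters_def Pi_iff intro!: inv_closed)

lemma word_value_append:
  assumes "u \<in> lists (letters S)" "v \<in> lists (letters S)"
  shows "word_value G \<sigma> (u @ v) = word_value G \<sigma> u \<otimes> word_value G \<sigma> v"
    and "word_value G \<sigma> u \<in> carrier G"
proof -
  have c: "w \<in> lists (letters S) \<Longrightarrow> word_value G \<sigma> w \<in> carrier G" for w
    by (induction w) (auto simp: word_value_def letter_value_closed)
  show "word_value G \<sigma> u \<in> carrier G" by (rule c) (rule assms(1))
  show "word_value G \<sigma> (u @ v) = word_value G \<sigma> u \<otimes> word_value G \<sigma> v"
    using assms c[OF assms(2)] c
    by (induction u) (auto simp: word_value_def letter_value_closed m_assoc)
qed

lemma word_value_concat:
  "set es \<subseteq> alphabet \<Longrightarrow>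
     concat (map wd es) \<in> lists (letters S) \<and> word_value G \<sigma> (concat (map wd es)) = product es"
proof (induction es)
  case (Cons e es)
  then show ?case using wd[of e] by (simp add: word_value_append)
qed (simp add: word_value_def)

text \<open>The codes have a common positive length \<open>N\<close>, so the length of an encoding
  reveals the number of letters, and the encodings can be compared block by block.\<close>

lemma code_words_eq_iff:
  assumes "u \<in> lists (letters S)" "v \<in> lists (letters S)"
  shows "concat (map code u) = concat (map code v) \<longleftrightarrow> u = v"
proof
  assume e: "concat (map code u) = concat (map code v)"
  have len: "length (concat (map code w)) = length w * N" if "w \<in> lists (letters S)" for w
    using length_concat_blocks[of "map code w" N] that length_code by (auto simp: lists_eq_set)
  have "length u = length v" using len[OF assms(1)] len[OF assms(2)] e N by simp
  moreover have "length a = length b" if "(a, b) \<in> set (zip (map code u) (map code v))" for a b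
    using set_zip_leftD[OF that] set_zip_rightD[OF that] assms length_code by (auto simp: lists_eq_set)
  ultimately have "map code u = map code v"
    using e by (subst concat_eq_concat_iff[symmetric]) auto
  then show "u = v"
    using assms inj_on_subset[OF inj_code, of "set u \<union> set v"]
    by (intro map_inj_on[of code u v]) (auto simp: lists_eq_set)
qed simp

lemma addressed_word_in_word_problem:
  "addressed_word x \<in> encode_language code (word_problem G S \<sigma>) \<longleftrightarrow> product (blocks x) = \<one>"
proof -
  let ?w = "concat (map wd (blocks x))"
  have w: "?w \<in> lists (letters S)" "word_value G \<sigma> ?w = product (blocks x)"
    using word_value_concat[OF blocks_in_EE] by auto
  have "concat (map block es) = concat (map code (concat (map wd es)))" for es
    by (induction es) (auto simp: block_def)
  then have "addressed_word x = concat (map code ?w)"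
    by (simp add: addressed_word_def)
  then have "addressed_word x \<in> encode_language code (word_problem G S \<sigma>) \<longleftrightarrow> ?w \<in> word_problem G S \<sigma>"
    using code_words_eq_iff[OF w(1)] by (auto simp: encode_language_def word_problem_def)
  then show ?thesis using w by (simp add: word_problem_def)
qed

text \<open>The leading blocks are the identity: they shape the addresses and leave the product
  unchanged.\<close>

lemma product_blocks:
  "product (blocks x) = (if game_value x (p * Suc (top_window (length x))) (At (initial_state M), initial_tapes)
     then \<one> else level (2 * (p * Suc (top_window (length x)))))"
proof -
  let ?p = "p * Suc (top_window (length x))"
  have d: "depth (length x) = beta * (2 * ?p)" unfolding depth_def by (simp only: ac_simps)
  have "product (blocks x) = product (leaves x (depth (length x)) (start, initial_tapes))"
  proof -
    have "product (replicate (2 ^ depth (length x)) \<one>) = \<one>" by (rule product_ones) auto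
    moreover have "set (replicate (2 ^ depth (length x)) \<one>) \<subseteq> carrier G" by auto
    ultimately show ?thesis
      unfolding blocks_def using leaves_carrier[OF sim_good_initial, of x "depth (length x)"]
      by (simp only: product_append product_closed l_one)
  qed
  also have "\<dots> = item_value (2 * ?p) (Gate True False) (nor_value x (2 * ?p) ((None, At (initial_state M)), initial_tapes))"
    unfolding d start_def by (rule product_leaves) (use sim_good_initial in \<open>auto simp: start_def\<close>)
  finally show ?thesis unfolding nor_value_game by (simp only: item_value.simps Let_def if_False simp_thms)
qed

theorem addressed_word_reduces:
  assumes "\<And>j. level j \<noteq> \<one>" and "halts_within M x t (initial_configuration M)"
    and "(4 + choices) * Suc t \<le> p * Suc (top_window (length x))"
  shows "x \<in> accepted_language M \<longleftrightarrow> addressed_word x \<in> encode_language code (word_problem G S \<sigma>)"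
  using game_value_accepting_iff[OF _ assms(3), of x "initial_state M" initial_tapes] assms(1,2)
  unfolding addressed_word_in_word_problem product_blocks
  by (simp add: accepted_language_def initial_configuration_def)

end

text \<open>Expressed by exponents, the running time can be compared with the number of windows. The
  finitely many lengths below the threshold of the bound, and the length 0, are absorbed by the
  maximum \<open>m\<close>.\<close>

lemma logarithmic_bound:
  fixes t :: "nat \<Rightarrow> nat"
  assumes "(\<lambda>n. real (t n)) \<in> O(\<lambda>n. ln (real n))"
  shows "\<exists>A. \<forall>n g. n < 2 ^ g \<longrightarrow> t n \<le> A * Suc g"
proof -
  obtain c where "eventually (\<lambda>n. norm (real (t n)) \<le> c * norm (ln (real n))) at_top"
    using assms by (rule landau_o.bigE) auto
  then obtain n0 where n0: "\<And>n. n0 \<le> n \<Longrightarrow> real (t n) \<le> c * \<bar>ln (real n)\<bar>"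
    by (auto simp: eventually_at_top_linorder)
  define m where "m = Max (insert 0 (t ` {..n0}))"
  define A where "A = m + nat \<lceil>\<bar>c\<bar>\<rceil>"
  have "t n \<le> A * Suc g" if n: "n < 2 ^ g" for n g
  proof (cases "n \<le> n0 \<or> n = 0")
    case True
    then have "t n \<le> m" unfolding m_def by (intro Max_ge) auto
    also have "\<dots> \<le> A * Suc g" by (simp add: A_def)
    finally show ?thesis .
  next
    case False
    then have n1: "1 \<le> n" by simp
    have "ln (real n) \<le> ln (2 ^ g)"
      using n n1 by (subst ln_le_cancel_iff) (auto simp flip: of_nat_power simp del: of_nat_le_iff simp: less_imp_le)
    also have "\<dots> = real g * ln 2" by (simp add: ln_realpow)
    also have "\<dots> \<le> real g * 1" using ln_2_less_1 by (intro mult_left_mono) auto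
    finally have l: "\<bar>ln (real n)\<bar> \<le> real g" using n1 by simp
    have "real (t n) \<le> c * \<bar>ln (real n)\<bar>" by (rule n0) (use False in simp)
    also have "\<dots> \<le> \<bar>c\<bar> * real g" using l by (intro mult_mono) auto
    also have "\<dots> \<le> real (nat \<lceil>\<bar>c\<bar>\<rceil>) * real (Suc g)" by (intro mult_mono) auto
    also have "\<dots> = real (nat \<lceil>\<bar>c\<bar>\<rceil> * Suc g)" by (rule of_nat_mult[symmetric])
    finally have "t n \<le> nat \<lceil>\<bar>c\<bar>\<rceil> * Suc g" by (simp only: of_nat_le_iff)
    also have "\<dots> \<le> A * Suc g" unfolding A_def by (intro mult_le_mono1) simp
    finally show ?thesis .
  qed
  then show ?thesis by blast
qed

text \<open>Breaks the circle between \<open>s\<close> and \<open>p\<close>: the number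
  \<open>p\<close> is linear in \<open>s\<close>, so the condition on \<open>s\<close> is a
  quadratic polynomial against \<open>2 ^ s\<close>.\<close>

lemma exponential_dominates:
  fixes K :: nat
  shows "\<exists>s\<ge>1. K * (s + 2) ^ 2 < 2 ^ s"
proof -
  have "eventually (\<lambda>s::nat. real K * (real s + 2) ^ 2 < 2 ^ s) at_top"
  proof (cases "K = 0")
    case False
    then have "real K > 0" by simp
    then show ?thesis by real_asymp
  qed simp
  from eventually_conj[OF this eventually_ge_at_top[of 1]]
  obtain s where "real K * (real s + 2) ^ 2 < 2 ^ s" "1 \<le> s"
    by (auto simp: eventually_at_top_linorder)
  then have "real (K * (s + 2) ^ 2) < real (2 ^ s)" by (simp add: add.commute)
  then show ?thesis using \<open>1 \<le> s\<close> by (metis of_nat_less_iff)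
qed

context tower
begin

lemma word_exists:
  assumes "\<sigma> \<in> S \<rightarrow> carrier G" "u \<in> generate G (\<sigma> ` S)"
  shows "\<exists>w \<in> lists (letters S). word_value G \<sigma> w = u"
  using assms(2)
proof (induction rule: generate.induct)
  case one
  then show ?case by (intro bexI[of _ "[]"]) (auto simp: word_value_def)
next
  case (incl h)
  then obtain a where "a \<in> S" "h = \<sigma> a" by auto
  then show ?case using assms(1)
    by (intro bexI[of _ "[Generator a]"]) (auto simp: word_value_def letters_def Pi_iff)
next
  case (inv h)
  then obtain a where "a \<in> S" "h = \<sigma> a" by auto
  then show ?case using assms(1)
    by (intro bexI[of _ "[Inverse a]"]) (auto simp: word_value_def letters_def Pi_iff)
next
  case (eng h1 h2)
  then obtain u v where uv: "u \<in> lists (letters S)" "word_value G \<sigma> u = h1"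
    "v \<in> lists (letters S)" "word_value G \<sigma> v = h2" by blast
  have cl: "letter_value G \<sigma> a \<in> carrier G" if "a \<in> letters S" for a
    using assms(1) that by (auto simp: letters_def Pi_iff intro!: inv_closed)
  have c: "w \<in> lists (letters S) \<Longrightarrow> word_value G \<sigma> w \<in> carrier G" for w
    by (induction w) (auto simp: word_value_def cl)
  have "word_value G \<sigma> (u @ v) = word_value G \<sigma> u \<otimes> word_value G \<sigma> v"
    using uv(1) c[OF uv(3)] c by (induction u) (auto simp: word_value_def cl m_assoc)
  then show ?case using uv by (intro bexI[of _ "u @ v"]) auto
qed

lemma word_value_pad:
  assumes "w \<in> lists (letters S)" "\<sigma> \<in> S \<rightarrow> carrier G"
  shows "word_value G \<sigma> (w @ replicate n Identity) = word_value G \<sigma> w"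
proof -
  have "word_value G \<sigma> (replicate n Identity) = \<one>"
    by (induction n) (auto simp: word_value_def)
  then show ?thesis by (simp add: word_value_def)
qed

theorem word_problem_hard:
  assumes gen: "generating_map G S \<sigma>" and code: "block_code code (letters S)"
    and nontrivial: "\<And>j. level j \<noteq> \<one>"
  shows "ALOGTIME_hard (encode_language code (word_problem G S \<sigma>))"
  unfolding ALOGTIME_hard_def
proof
  fix A assume "A \<in> ALOGTIME"
  then obtain M t where M: "A = accepted_language M" "alternating_machine M"
    and t: "(\<lambda>n. real (t n)) \<in> O(\<lambda>n. ln (real n))"
    and halts: "\<And>x. halts_within M x (t (length x)) (initial_configuration M)"
    by (auto simp: ALOGTIME_def logarithmic_time_def)
  interpret alternating M by unfold_locales (rule M(2))
  obtain a where a: "\<And>n g. n < 2 ^ g \<Longrightarrow> t n \<le> a * Suc g"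
    using logarithmic_bound[OF t] by blast
  have \<sigma>: "\<sigma> \<in> S \<rightarrow> carrier G" and full: "generate G (\<sigma> ` S) = carrier G"
    using gen by (auto simp: generating_map_def)
  obtain N where inj: "inj_on code (letters S)" and N: "\<And>l. l \<in> letters S \<Longrightarrow> length (code l) = N"
    using code by (auto simp: block_code_def)
  \<comment> \<open>A trivial group would contradict the nontriviality of \<open>level 0\<close>. So
    there is a second letter besides \<open>Identity\<close>, and an injective code cannot have
    length 0.\<close>
  have "S \<noteq> {}"
  proof
    assume "S = {}"
    then have "carrier G = {\<one>}" using full generate_empty by simp
    then show False using nontrivial[of 0] level_closed[of 0] by blast
  qed
  then obtain a' where a': "Identity \<in> letters S" "Generator a' \<in> letters S"
    by (auto simp: letters_def)
  have N1: "1 \<le> N"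
  proof (rule ccontr)
    assume "\<not> 1 \<le> N"
    then have "N = 0" by simp
    then have "code Identity = code (Generator a')" using N[OF a'(1)] N[OF a'(2)] by simp
    then show False using inj a' by (auto dest: inj_onD)
  qed
  have "\<forall>e\<in>alphabet. \<exists>w. w \<in> lists (letters S) \<and> word_value G \<sigma> w = e"
    using word_exists[OF \<sigma>] full alphabet_carrier by blast
  then obtain wd where wd: "\<And>e. e \<in> alphabet \<Longrightarrow> wd e \<in> lists (letters S) \<and> word_value G \<sigma> (wd e) = e"
    by (auto dest!: bchoice)
  define L where "L = Suc (Max ((\<lambda>e. length (wd e)) ` alphabet))"
  have L: "length (wd e) \<le> L" if "e \<in> alphabet" for e
    unfolding L_def using finite_alphabet that by (intro le_SucI Max_ge) auto
  \<comment> \<open>\<open>Identity\<close> is a letter, so words can be padded to the common length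
    \<open>L\<close> without changing their values.\<close>
  define wd' where "wd' e = wd e @ replicate (L - length (wd e)) Identity" for e
  have wd': "wd' e \<in> lists (letters S) \<and> word_value G \<sigma> (wd' e) = e" "length (wd' e) = L"
    if "e \<in> alphabet" for e
    using wd[OF that] L[OF that] a'(1) \<sigma> by (auto simp: wd'_def word_value_pad lists_eq_set)
  define K where "K = 4 * beta * (4 + choices) * (a + 1) + 2 * (L * N) + 4"
  obtain s where s: "1 \<le> s" "K * (s + 2) ^ 2 < 2 ^ s"
    using exponential_dominates by blast
  \<comment> \<open>If \<open>g\<close> is the last window, then
    \<open>length x < 2 ^ (s + g + 1)\<close>, so the machine makes at most
    \<open>a * (s + g + 2)\<close> steps; spread over the \<open>g + 1\<close> windows these are at
    most \<open>a * (s + 2)\<close> per window. The extra 1 pays for the final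
    configuration.\<close>
  define p where "p = (4 + choices) * (a * (s + 2) + 1)"
  have large: "2 * (2 * beta * p) * s + 2 * (L * N) + 4 < 2 ^ s"
  proof -
    have "a * (s + 2) + 1 \<le> (a + 1) * (s + 2)" by simp
    then have "p \<le> (4 + choices) * ((a + 1) * (s + 2))"
      unfolding p_def by (rule mult_le_mono2)
    then have "4 * beta * p * s \<le> 4 * beta * ((4 + choices) * ((a + 1) * (s + 2))) * (s + 2)"
      by (intro mult_le_mono) auto
    also have "\<dots> = 4 * beta * (4 + choices) * (a + 1) * (s + 2) ^ 2"
      by (simp only: power2_eq_square ac_simps)
    finally have 1: "4 * beta * p * s \<le> 4 * beta * (4 + choices) * (a + 1) * (s + 2) ^ 2" .
    have "2 * (L * N) + 4 \<le> (2 * (L * N) + 4) * (s + 2) ^ 2" by simp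
    with 1 have "4 * beta * p * s + (2 * (L * N) + 4) \<le> K * (s + 2) ^ 2"
      unfolding K_def add_mult_distrib by linarith
    moreover have "2 * (2 * beta * p) * s = 4 * beta * p * s" by simp
    ultimately show ?thesis using s(2) by linarith
  qed
  interpret reduction G E shift a0 y z M S \<sigma> code wd' L N s p
    by unfold_locales (use \<sigma> inj N N1 wd' s large in \<open>auto simp: L_def p_def\<close>)
  have "x \<in> A \<longleftrightarrow> addressed_word x \<in> encode_language code (word_problem G S \<sigma>)" for x
    unfolding M(1)
  proof (rule addressed_word_reduces[OF nontrivial halts])
    let ?g = "top_window (length x)"
    have "\<not> in_range (length x) (Suc ?g)" by (rule not_in_range_top)
    then have "length x < 2 ^ s * (2 ^ Suc ?g - 1)" by (simp add: in_range_def not_le)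
    also have "\<dots> \<le> 2 ^ s * 2 ^ Suc ?g" by (intro mult_le_mono2) simp
    also have "\<dots> = 2 ^ (s + Suc ?g)" by (simp add: power_add)
    finally have "t (length x) \<le> a * Suc (s + Suc ?g)" by (rule a)
    then have "Suc (t (length x)) \<le> (a * (s + 2) + 1) * Suc ?g" by (simp add: algebra_simps)
    then show "(4 + choices) * Suc (t (length x)) \<le> p * Suc ?g"
      unfolding p_def mult.assoc by (rule mult_le_mono2)
  qed
  then show "DLOGTIME_reducible A (encode_language code (word_problem G S \<sigma>))"
    unfolding DLOGTIME_reducible_def using DLOGTIME_computable_addressed_word by blast
qed

end

section \<open>Towers of commutators in transformation groups\<close>

locale transformations = group G for G :: "('p \<Rightarrow> 'p, 'm) monoid_scheme" (structure) +
  assumes mult_eq: "\<And>f g. f \<otimes> g = g \<circ> f" and one_eq: "\<one> = id"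
begin

lemma inv_apply [simp]: "f \<in> carrier G \<Longrightarrow> (inv f) (f p) = p" "f \<in> carrier G \<Longrightarrow> f ((inv f) p) = p"
  using fun_cong[OF r_inv[of f, unfolded mult_eq one_eq]] fun_cong[OF l_inv[of f, unfolded mult_eq one_eq]]
  by auto

lemma inv_fixed: "f \<in> carrier G \<Longrightarrow> f p = p \<Longrightarrow> (inv f) p = p"
  by (metis inv_apply(1))

lemma inj_carrier: "f \<in> carrier G \<Longrightarrow> f p = f q \<Longrightarrow> p = q"
  by (metis inv_apply(1))

lemma conjugate_closed_support:
  assumes "f \<in> carrier G" "\<And>p. p \<notin> I \<Longrightarrow> f p = p" "p \<in> I"
  shows "f p \<in> I" "(inv f) p \<in> I"
proof -
  show *: "f p \<in> I" using assms by (metis inj_carrier)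
  show "(inv f) p \<in> I" using assms by (metis inv_apply(2))
qed

end

locale transformation_tower = tower G E shift a0 y z + transformations G
  for G :: "('p \<Rightarrow> 'p, 'm) monoid_scheme" (structure) and E shift a0 y z
begin

lemma comm_apply: "f \<in> carrier G \<Longrightarrow> g \<in> carrier G \<Longrightarrow> comm f g p = g (f ((inv g) ((inv f) p)))"
  by (simp add: comm_def mult_eq)

text \<open>If \<open>g\<close> moves \<open>I\<close> off itself, then on \<open>I\<close> the commutator of \<open>g\<close> with a transformation
  supported in \<open>I\<close> agrees with the latter.\<close>

lemma comm_on_support:
  assumes g: "g \<in> carrier G" "\<And>p. p \<in> I \<Longrightarrow> g p \<notin> I"
    and f: "f \<in> carrier G" "\<And>p. p \<notin> I \<Longrightarrow> f p = p" and p: "p \<in> I"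
  shows "comm g f p = f p" "(inv (comm g f)) p = (inv f) p"
proof -
  have 1: "comm g f q = f q" if "q \<in> I" for q
  proof -
    have "(inv g) q \<notin> I" using g that by (metis inv_apply(2))
    then show ?thesis using f g by (simp add: comm_apply inv_fixed)
  qed
  then show "comm g f p = f p" using p .
  have "comm g f ((inv f) p) = p"
    using 1[of "(inv f) p"] conjugate_closed_support(2)[OF f p] f(1) by simp
  then show "(inv (comm g f)) p = (inv f) p"
    using inv_apply(1)[OF comm_closed[OF g(1) f(1)]] by metis
qed

text \<open>The outer commutator is evaluated along points that never leave \<open>I\<close>, and
  there both inner commutators and their inverses act as \<open>f\<close>, \<open>h\<close> and
  their inverses.\<close>

lemma comm_comm_on_support:
  assumes g: "g \<in> carrier G" "\<And>p. p \<in> I \<Longrightarrow> g p \<notin> I"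
    and f: "f \<in> carrier G" "\<And>p. p \<notin> I \<Longrightarrow> f p = p"
    and h: "h \<in> carrier G" "\<And>p. p \<notin> I \<Longrightarrow> h p = p" and p: "p \<in> I"
  shows "comm (comm g f) (comm g h) p = comm f h p"
proof -
  have F: "comm g f r = f r" "(inv (comm g f)) r = (inv f) r" if "r \<in> I" for r
    using comm_on_support[of g I f r] g f that by blast+
  have H: "comm g h r = h r" "(inv (comm g h)) r = (inv h) r" if "r \<in> I" for r
    using comm_on_support[of g I h r] g h that by blast+
  define q where "q = (inv f) p"
  have q: "q \<in> I" "(inv h) q \<in> I" "f ((inv h) q) \<in> I"
    using conjugate_closed_support[OF f] conjugate_closed_support[OF h] p by (auto simp: q_def)
  have "comm (comm g f) (comm g h) p =
      comm g h (comm g f ((inv (comm g h)) ((inv (comm g f)) p)))"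
    by (rule comm_apply) (simp_all add: comm_closed f(1) g(1) h(1))
  also have "\<dots> = h (f ((inv h) q))"
    unfolding F(2)[OF p] q_def[symmetric] H(2)[OF q(1)] F(1)[OF q(2)] H(1)[OF q(3)] ..
  also have "\<dots> = comm f h p"
    unfolding q_def by (rule comm_apply[symmetric]) (rule f(1) h(1))+
  finally show ?thesis .
qed

lemma level_moves:
  assumes support: "\<And>j p. p \<notin> I j \<Longrightarrow> (shift ^^ j) y p = p \<and> (shift ^^ j) z p = p"
    and sub: "\<And>j. I (Suc j) \<subseteq> I j"
    and moves: "\<And>j p. p \<in> I (Suc j) \<Longrightarrow> comm ((shift ^^ j) y) ((shift ^^ j) z) p \<notin> I (Suc j)"
    and base: "\<And>p. p \<in> I 0 \<Longrightarrow> a0 p \<notin> I 0"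
  shows "p \<in> I j \<Longrightarrow> level j p \<notin> I j"
proof (induction j arbitrary: p)
  case (Suc j)
  have c: "(shift ^^ j) y \<in> carrier G" "(shift ^^ j) z \<in> carrier G"
    using y z by (auto simp: shift_pow_carrier E_generate)
  have "p \<in> I j" using Suc.prems sub by blast
  then have "level (Suc j) p = comm ((shift ^^ j) y) ((shift ^^ j) z) p"
    unfolding level.simps using Suc.IH support level_closed c
    by (intro comm_comm_on_support[where I = "I j"]) auto
  then show ?case using moves Suc.prems by simp
qed (use base in simp)

lemma level_nontrivial:
  assumes "\<And>j p. p \<notin> I j \<Longrightarrow> (shift ^^ j) y p = p \<and> (shift ^^ j) z p = p"
    and "\<And>j. I (Suc j) \<subseteq> I j"
    and "\<And>j p. p \<in> I (Suc j) \<Longrightarrow> comm ((shift ^^ j) y) ((shift ^^ j) z) p \<notin> I (Suc j)"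
    and "\<And>p. p \<in> I 0 \<Longrightarrow> a0 p \<notin> I 0" and ne: "\<And>j. I j \<noteq> {}"
  shows "level j \<noteq> \<one>"
proof
  assume "level j = \<one>"
  moreover obtain p where "p \<in> I j" using ne by blast
  ultimately show False using level_moves[of I p j, OF assms(1-4)] by (simp add: one_eq)
qed

end

context transformations
begin

text \<open>A contraction \<open>c\<close> of \<open>I\<close> into a part \<open>J\<close> which the commutator of \<open>y\<close> and \<open>z\<close> moves off
  itself: the conjugates by the powers of \<open>c\<close> act on ever smaller parts of \<open>I\<close>.\<close>

theorem word_problem_hard_contraction:
  assumes carrier: "g \<in> carrier G" "y \<in> carrier G" "z \<in> carrier G" "c \<in> carrier G"
    and y_support: "\<And>p. p \<notin> I \<Longrightarrow> y p = p" and z_support: "\<And>p. p \<notin> I \<Longrightarrow> z p = p"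
    and g_moves: "\<And>p. p \<in> I \<Longrightarrow> g p \<notin> I" and c_contracts: "\<And>p. p \<in> I \<Longrightarrow> c p \<in> J"
    and J: "J \<subseteq> I" and moves: "\<And>p. p \<in> J \<Longrightarrow> z (y ((inv z) ((inv y) p))) \<notin> J" and ne: "I \<noteq> {}"
    and gen: "generating_map G S \<sigma>" and code: "block_code code (letters S)"
  shows "ALOGTIME_hard (encode_language code (word_problem G S \<sigma>))"
proof -
  \<comment> \<open>\<open>c\<close> is included in order that conjugation by it maps the generated
    subgroup into itself.\<close>
  define E where "E = {g, y, z, c}"
  define conj where "conj u = inv c \<otimes> u \<otimes> c" for u
  have E: "E \<subseteq> carrier G" using carrier by (simp add: E_def)
  have gc: "u \<in> carrier G" if "u \<in> generate G E" for u
    using that generate_in_carrier[OF E] by blast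
  interpret transformation_tower G E conj g y z
  proof unfold_locales
    show "finite E" "E \<subseteq> carrier G" "g \<in> E" "y \<in> E" "z \<in> E" using E by (auto simp: E_def)
    show "conj u \<in> generate G E" if "u \<in> generate G E" for u
    proof -
      have "c \<in> generate G E" "inv c \<in> generate G E"
        by (auto simp: E_def intro: generate.incl generate.inv)
      then show ?thesis using that unfolding conj_def by (blast intro: generate.eng)
    qed
    show "conj (u \<otimes> v) = conj u \<otimes> conj v" if "u \<in> generate G E" "v \<in> generate G E" for u v
    proof -
      have "conj u \<otimes> conj v = inv c \<otimes> u \<otimes> (c \<otimes> inv c) \<otimes> v \<otimes> c"
        unfolding conj_def using that[THEN gc] carrier by (simp only: m_assoc m_closed inv_closed)
      then show ?thesis unfolding conj_def using that[THEN gc] carrier by (simp add: m_assoc)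
    qed
  qed
  have conj_apply: "(conj ^^ j) u ((c ^^ j) p) = (c ^^ j) (u p)" if "u \<in> carrier G" for j u p
  proof (induction j)
    case (Suc j)
    have "conj f (c q) = c (f q)" for f q
      using carrier by (simp add: conj_def mult_eq)
    then show ?case using Suc by simp
  qed simp
  have c_inj: "(c ^^ j) p = (c ^^ j) q \<Longrightarrow> p = q" for j p q
    using carrier(4) by (induction j arbitrary: p q) (auto dest: inj_carrier)
  have c_surj: "\<exists>q. p = (c ^^ j) q" for j p
  proof (induction j arbitrary: p)
    case (Suc j)
    obtain q where "(inv c) p = (c ^^ j) q" using Suc by blast
    then have "c ((inv c) p) = (c ^^ Suc j) q" by simp
    then show ?case using carrier(4) by auto
  qed simp
  have comm_conj: "comm ((conj ^^ j) y) ((conj ^^ j) z) = (conj ^^ j) (comm y z)" for j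
  proof -
    have gen: "y \<in> generate G E" "z \<in> generate G E" by (auto simp: E_def generate.incl)
    then show ?thesis
      unfolding comm_def by (simp add: shift_pow_mult shift_pow_inv generate_mult generate_inv)
  qed
  define D where "D j = (c ^^ j) ` I" for j
  \<comment> \<open>The commutator at height \<open>j\<close> is a conjugate by
    \<open>c ^^ j\<close>, so it moves the copy of \<open>J\<close> under \<open>c ^^ j\<close> off
    itself; the next region lies in that copy.\<close>
  have D: "D (Suc j) \<subseteq> (c ^^ j) ` J" for j
  proof
    fix p assume "p \<in> D (Suc j)"
    then obtain q where "q \<in> I" "p = (c ^^ Suc j) q" by (auto simp only: D_def)
    then have "p = (c ^^ j) (c q)" "c q \<in> J" using c_contracts by (auto simp: funpow_swap1)
    then show "p \<in> (c ^^ j) ` J" by blast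
  qed
  have sub: "D (Suc j) \<subseteq> D j" for j
    using D[of j] J unfolding D_def by blast
  have support: "(conj ^^ j) y p = p \<and> (conj ^^ j) z p = p" if "p \<notin> D j" for j p
  proof -
    obtain q where q: "p = (c ^^ j) q" using c_surj by blast
    then have "q \<notin> I" using that unfolding D_def by blast
    then show ?thesis unfolding q using y_support z_support carrier by (simp add: conj_apply)
  qed
  have off: "comm ((conj ^^ j) y) ((conj ^^ j) z) p \<notin> D (Suc j)" if "p \<in> D (Suc j)" for j p
  proof
    assume a: "comm ((conj ^^ j) y) ((conj ^^ j) z) p \<in> D (Suc j)"
    obtain q where q: "q \<in> J" "p = (c ^^ j) q" using \<open>p \<in> D (Suc j)\<close> D[of j] by blast
    have "(c ^^ j) (comm y z q) \<in> (c ^^ j) ` J"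
      using a D unfolding comm_conj q(2) using carrier by (auto simp: conj_apply comm_closed)
    then have "comm y z q \<in> J" using c_inj by blast
    then show False using moves[OF q(1)] carrier by (simp add: comm_apply)
  qed
  have "level j \<noteq> \<one>" for j
    by (rule level_nontrivial[of D, OF support sub off])
       (use g_moves ne in \<open>auto simp: D_def\<close>)
  then show ?thesis by (rule word_problem_hard[OF gen code])
qed

end

lemma group_transformations:
  assumes "id \<in> C" "\<And>f g. f \<in> C \<Longrightarrow> g \<in> C \<Longrightarrow> g \<circ> f \<in> C"
    and "\<And>f. f \<in> C \<Longrightarrow> \<exists>g\<in>C. g \<circ> f = id \<and> f \<circ> g = id"
  shows "transformations (transformation_group C)"
proof -
  have "group (transformation_group C)"
  proof (rule groupI)
    fix f assume "f \<in> carrier (transformation_group C)"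
    then show "\<exists>g\<in>carrier (transformation_group C).
        g \<otimes>\<^bsub>transformation_group C\<^esub> f = \<one>\<^bsub>transformation_group C\<^esub>"
      using assms(3) by (auto simp: transformation_group_def)
  qed (use assms in \<open>auto simp: transformation_group_def comp_assoc\<close>)
  then show ?thesis
    by (simp add: transformations_def transformations_axioms_def transformation_group_def)
qed

section \<open>Weakly branched groups\<close>

lemma carrier_tree_aut:
  "carrier tree_aut = {g. bij g \<and> g [] = [] \<and> (\<forall>u v. tree_edge (g u) (g v) \<longleftrightarrow> tree_edge u v)}"
  by (simp add: tree_aut_def transformation_group_def)

lemma transformations_tree_aut: "transformations tree_aut"
  unfolding tree_aut_def
proof (rule group_transformations)
  fix f :: "'x list \<Rightarrow> 'x list"
  assume "f \<in> {g. bij g \<and> g [] = [] \<and> (\<forall>u v. tree_edge (g u) (g v) \<longleftrightarrow> tree_edge u v)}"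
  then have f: "bij f" "f [] = []" "\<And>u v. tree_edge (f u) (f v) \<longleftrightarrow> tree_edge u v" by auto
  have i: "f (Hilbert_Choice.inv f u) = u" for u using f(1) by (simp add: bij_is_surj surj_f_inv_f)
  have "Hilbert_Choice.inv f [] = []" using f by (metis bij_inv_eq_iff)
  moreover have "tree_edge (Hilbert_Choice.inv f u) (Hilbert_Choice.inv f v) \<longleftrightarrow> tree_edge u v" for u v
    using f(3)[of "Hilbert_Choice.inv f u" "Hilbert_Choice.inv f v"] by (simp add: i)
  ultimately show "\<exists>g\<in>{g. bij g \<and> g [] = [] \<and> (\<forall>u v. tree_edge (g u) (g v) \<longleftrightarrow> tree_edge u v)}.
      g \<circ> f = id \<and> f \<circ> g = id"
    using f(1) by (intro bexI[of _ "Hilbert_Choice.inv f"])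
      (auto simp: bij_imp_bij_inv bij_is_inj bij_is_surj surj_iff[symmetric])
qed (auto intro: bij_comp)

lemma tree_aut_edge: "g \<in> carrier tree_aut \<Longrightarrow> tree_edge u v \<Longrightarrow> tree_edge (g u) (g v)"
  by (simp add: carrier_tree_aut)

text \<open>The image of a child of \<open>v\<close> is adjacent to the image of \<open>v\<close>.
  It cannot be the parent there, since by induction the parent is the image of the parent of
  \<open>v\<close>, and \<open>g\<close> is injective.\<close>

lemma tree_aut_snoc:
  assumes "g \<in> carrier tree_aut" shows "\<exists>y. g (v @ [x]) = g v @ [y]"
proof (induction v arbitrary: x rule: rev_induct)
  case Nil
  have "tree_edge (g [x]) (g [])" using assms by (rule tree_aut_edge) (simp add: tree_edge_def)
  moreover have "g [] = []" using assms by (simp add: carrier_tree_aut)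
  ultimately show ?case by (auto simp: tree_edge_def)
next
  case (snoc z v)
  obtain z' where z': "g (v @ [z]) = g v @ [z']" using snoc by blast
  have "tree_edge (g ((v @ [z]) @ [x])) (g (v @ [z]))"
    using assms by (rule tree_aut_edge) (simp add: tree_edge_def)
  then consider y where "g ((v @ [z]) @ [x]) = g (v @ [z]) @ [y]"
    | y where "g (v @ [z]) = g ((v @ [z]) @ [x]) @ [y]"
    by (auto simp: tree_edge_def)
  then show ?case
  proof cases
    case 2
    then have "g ((v @ [z]) @ [x]) = g v" using z' by simp
    moreover have "inj g" using assms by (simp add: carrier_tree_aut bij_is_inj)
    ultimately have "(v @ [z]) @ [x] = v" by (blast dest: injD)
    then show ?thesis by simp
  qed blast
qed

lemma tree_aut_append:
  assumes "g \<in> carrier tree_aut" shows "\<exists>w'. g (v @ w) = g v @ w' \<and> length w' = length w"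
proof (induction w rule: rev_induct)
  case (snoc x w)
  then obtain w' where w: "g (v @ w) = g v @ w'" "length w' = length w" by blast
  obtain y where "g ((v @ w) @ [x]) = g (v @ w) @ [y]" using tree_aut_snoc[OF assms] by blast
  then show ?case using w by (intro exI[of _ "w' @ [y]"]) simp
qed simp

lemma tree_aut_length: "g \<in> carrier tree_aut \<Longrightarrow> length (g v) = length v"
  using tree_aut_append[of g "[]" v] by (auto simp: carrier_tree_aut)

text \<open>Prefixes and lengths are preserved, so the prefix of length \<open>length u\<close> of
  the image is \<open>g u\<close>.\<close>

lemma tree_aut_moves_subtree:
  assumes "g \<in> carrier tree_aut" "g u \<noteq> u" shows "\<not> prefix u (g (u @ v))"
proof
  assume "prefix u (g (u @ v))"
  moreover obtain v' where "g (u @ v) = g u @ v'" using tree_aut_append[OF assms(1)] by blast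
  ultimately have "prefix u (g u @ v')" by simp
  then have "g u = u" using tree_aut_length[OF assms(1), of u] by (auto simp: prefix_def)
  then show False using assms(2) by contradiction
qed

abbreviation on_prefix :: "'x list \<Rightarrow> ('x list \<Rightarrow> 'x list) \<Rightarrow> 'x list \<Rightarrow> 'x list" where
  "on_prefix u k \<equiv> foldr on_subtree u k"

lemma on_prefix_append: "on_prefix u k (u @ v) = u @ k v"
  by (induction u) auto

lemma on_prefix_other: "\<not> prefix u v \<Longrightarrow> on_prefix u k v = v"
proof (induction u arbitrary: v)
  case (Cons x u)
  then show ?case by (cases v) auto
qed simp

lemma on_prefix_comp: "on_prefix u (k \<circ> l) = on_prefix u k \<circ> on_prefix u l"
proof
  fix v show "on_prefix u (k \<circ> l) v = (on_prefix u k \<circ> on_prefix u l) v"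
  proof (cases "prefix u v")
    case True
    then show ?thesis by (auto simp: prefix_def on_prefix_append)
  next
    case False
    then show ?thesis by (simp add: on_prefix_other)
  qed
qed

lemma on_prefix_power: "(on_prefix u ^^ j) k = on_prefix (concat (replicate j u)) k"
  by (induction j) simp_all

theorem word_problem_hard_weakly_branched:
  fixes G :: "('x list \<Rightarrow> 'x list) set"
  assumes G: "self_similar G" and K: "branching_subgroup G K"
    and fg: "finitely_generated (tree_aut\<lparr>carrier := K\<rparr>)"
    and gen: "generating_map (tree_aut\<lparr>carrier := G\<rparr>) S \<sigma>" and code: "block_code code (letters S)"
  shows "ALOGTIME_hard (encode_language code (word_problem (tree_aut\<lparr>carrier := G\<rparr>) S \<sigma>))"
proof -
  let ?G = "tree_aut\<lparr>carrier := G\<rparr>"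
  interpret T: transformations tree_aut by (rule transformations_tree_aut)
  have subG: "subgroup G tree_aut" using G by (simp add: self_similar_def)
  have subK: "subgroup K tree_aut" and KG: "K \<subseteq> G" and ne: "K \<noteq> {id}"
    and branch: "\<And>k x. k \<in> K \<Longrightarrow> on_subtree x k \<in> K"
    using K by (auto simp: branching_subgroup_def)
  have "group ?G" using subG T.is_group by (rule subgroup.subgroup_is_group)
  then interpret transformations ?G
    by (simp add: transformations_def transformations_axioms_def T.mult_eq T.one_eq)
  have prefixK: "on_prefix u k \<in> K" if "k \<in> K" for u k
    using that branch by (induction u) auto
  have aut: "k \<in> carrier tree_aut" if "k \<in> K" for k
    using that subK by (rule subgroup.mem_carrier[rotated])
  have "id \<in> K" using subgroup.one_closed[OF subK] by (simp add: T.one_eq)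
  with ne obtain f where f: "f \<in> K" "f \<noteq> id" by blast
  then obtain w where w: "f w \<noteq> w" by (auto simp: fun_eq_iff)
  \<comment> \<open>The copy of \<open>f\<close> below \<open>w\<close>. As \<open>f\<close> carries
    the subtree at \<open>w\<close> elsewhere, it does not commute with \<open>m\<close>; the vertex
    \<open>w @ w\<close> shows this.\<close>
  define m where "m = on_prefix w f"
  have m: "m \<in> K" unfolding m_def using f(1) by (rule prefixK)
  have noncommuting: "m (f (w @ w)) \<noteq> f (m (w @ w))"
  proof
    assume "m (f (w @ w)) = f (m (w @ w))"
    moreover have "\<not> prefix w (f (w @ w))" using aut[OF f(1)] w by (rule tree_aut_moves_subtree)
    ultimately have "f (w @ w) = f (w @ f w)" by (simp add: m_def on_prefix_other on_prefix_append)
    then have "w @ w = w @ f w" using T.inj_carrier[OF aut[OF f(1)]] by blast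
    then show False using w by simp
  qed
  obtain E0 where E0: "finite E0" "E0 \<subseteq> K" "generate tree_aut E0 = K"
    using fg T.generate_consistent[OF _ subK] by (auto simp: finitely_generated_def)
  \<comment> \<open>This commutator has a double role: it is level 0 of the tower, and its copies in
    deeper subtrees are the commutators of the shifted \<open>y\<close> and
    \<open>z\<close>.\<close>
  define h where "h = inv\<^bsub>?G\<^esub> f \<otimes>\<^bsub>?G\<^esub> inv\<^bsub>?G\<^esub> m \<otimes>\<^bsub>?G\<^esub> f \<otimes>\<^bsub>?G\<^esub> m"
  have genK: "generate ?G X = K" if "E0 \<subseteq> X" "X \<subseteq> K" for X
  proof -
    have "generate ?G X = generate tree_aut X"
      using that KG by (intro T.generate_consistent[OF _ subG]) auto
    moreover have "generate tree_aut X \<subseteq> K" by (rule T.generate_subgroup_incl[OF that(2) subK])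
    moreover have "generate tree_aut E0 \<subseteq> generate tree_aut X" by (rule T.mono_generate[OF that(1)])
    ultimately show ?thesis using E0(3) by blast
  qed
  have inG: "f \<in> carrier ?G" "m \<in> carrier ?G" using f m KG by auto
  have "h \<in> generate ?G K"
    unfolding h_def using f(1) m by (intro generate.eng generate.inv generate.incl)
  then have hK: "h \<in> K" by (simp only: genK[OF E0(2) order_refl])
  have "\<exists>u. h u \<noteq> u"
  proof (rule ccontr)
    assume "\<not> (\<exists>u. h u \<noteq> u)"
    then have "h (m (f (w @ w))) = m (f (w @ w))" by blast
    moreover have "h v = m (f ((inv\<^bsub>?G\<^esub> m) ((inv\<^bsub>?G\<^esub> f) v)))" for v
      unfolding h_def mult_eq by simp
    ultimately have "m (f ((inv\<^bsub>?G\<^esub> m) ((inv\<^bsub>?G\<^esub> f) (m (f (w @ w)))))) = m (f (w @ w))" by simp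
    then have "(inv\<^bsub>?G\<^esub> m) ((inv\<^bsub>?G\<^esub> f) (m (f (w @ w)))) = w @ w"
      using inj_carrier[OF inG(1)] inj_carrier[OF inG(2)] by blast
    then have "(inv\<^bsub>?G\<^esub> f) (m (f (w @ w))) = m (w @ w)" using inv_apply(2)[OF inG(2)] by metis
    then have "m (f (w @ w)) = f (m (w @ w))" using inv_apply(2)[OF inG(1)] by metis
    then show False using noncommuting by contradiction
  qed
  then obtain u where u: "h u \<noteq> u" by blast
  \<comment> \<open>With the finitely many generators of \<open>K\<close> included, the generated
    subgroup is all of \<open>K\<close>, which is closed under copying to subtrees; this makes
    \<open>on_prefix u\<close> an admissible shift.\<close>
  define E where "E = insert h (insert (on_prefix u f) (insert (on_prefix u m) E0))"
  have EK: "E \<subseteq> K" and E: "finite E" "E0 \<subseteq> E"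
    using hK prefixK f(1) m E0 by (auto simp: E_def)
  have gE: "generate ?G E = K" using E EK by (intro genK) auto
  interpret transformation_tower ?G E "on_prefix u" h "on_prefix u f" "on_prefix u m"
  proof unfold_locales
    show "finite E" by (rule E)
    show "E \<subseteq> carrier ?G" using EK KG by auto
    show "h \<in> E" "on_prefix u f \<in> E" "on_prefix u m \<in> E" by (auto simp: E_def)
    show "on_prefix u v \<in> generate ?G E" if "v \<in> generate ?G E" for v
      using that unfolding gE by (rule prefixK)
    show "on_prefix u (v \<otimes>\<^bsub>?G\<^esub> v') = on_prefix u v \<otimes>\<^bsub>?G\<^esub> on_prefix u v'" for v v'
      by (simp only: mult_eq on_prefix_comp)
  qed
  define U where "U j = concat (replicate j u)" for j
  have U: "U (Suc j) = U j @ u" for j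
    by (induction j) (auto simp: U_def)
  have pow: "(on_prefix u ^^ j) (on_prefix u v) = on_prefix (U (Suc j)) v" for j v
    unfolding U_def on_prefix_power[symmetric] by (simp add: funpow_swap1)
  have h: "h = comm f m" by (simp add: h_def comm_def)
  have comm: "comm ((on_prefix u ^^ j) (on_prefix u f)) ((on_prefix u ^^ j) (on_prefix u m)) = on_prefix (U (Suc j)) h" for j
  proof -
    have fm: "f \<in> generate ?G E" "m \<in> generate ?G E" unfolding gE by (rule f(1) m)+
    have "comm ((on_prefix u ^^ n) f) ((on_prefix u ^^ n) m) = (on_prefix u ^^ n) h" for n
      unfolding h comm_def using fm
      by (simp only: shift_pow_mult shift_pow_inv generate_mult generate_inv)
    from this[of "Suc j"] show ?thesis
      unfolding pow by (simp only: on_prefix_power U_def)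
  qed
  have haut: "h \<in> carrier tree_aut" using hK by (rule aut)
  have "level j \<noteq> \<one>\<^bsub>?G\<^esub>" for j
  \<comment> \<open>The regions start at \<open>U (Suc 0)\<close>, that is, at \<open>u\<close>:
    level 0 is \<open>h\<close>, which moves the subtree at \<open>u\<close> off itself.\<close>
  proof (rule level_nontrivial[of "\<lambda>j. {v. prefix (U (Suc j)) v}"])
    show "(on_prefix u ^^ i) (on_prefix u f) p = p \<and> (on_prefix u ^^ i) (on_prefix u m) p = p"
      if "p \<notin> {v. prefix (U (Suc i)) v}" for i p
      using that by (simp add: pow on_prefix_other)
    show "{v. prefix (U (Suc (Suc i))) v} \<subseteq> {v. prefix (U (Suc i)) v}" for i
      unfolding U[of "Suc i"] by (auto dest: append_prefixD)
    show "comm ((on_prefix u ^^ i) (on_prefix u f)) ((on_prefix u ^^ i) (on_prefix u m)) p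
        \<notin> {v. prefix (U (Suc (Suc i))) v}" if pU: "p \<in> {v. prefix (U (Suc (Suc i))) v}" for i p
    proof -
      obtain v where p: "p = U (Suc i) @ u @ v" using pU by (auto simp: U[of "Suc i"] prefix_def)
      have "\<not> prefix u (h (u @ v))" using haut u by (rule tree_aut_moves_subtree)
      then show ?thesis unfolding comm p on_prefix_append U[of "Suc i"] by simp
    qed
    show "h p \<notin> {v. prefix (U (Suc 0)) v}" if "p \<in> {v. prefix (U (Suc 0)) v}" for p
      using that tree_aut_moves_subtree[OF haut u] by (auto simp: U_def prefix_def)
    show "{v. prefix (U (Suc i)) v} \<noteq> {}" for i by auto
  qed
  then show ?thesis by (rule word_problem_hard[OF gen code])
qed

section \<open>Thompson's groups\<close>

text \<open>Closure under composition is extracted from the hypothesis that the carrier is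
  generated, as \<open>generate\<close> is closed under products by its definition. What remains for
  each group is to construct inverses.\<close>

lemma transformations_generated:
  assumes gen: "generating_map (transformation_group C) S \<sigma>"
    and inverse: "\<And>f. f \<in> C \<Longrightarrow> \<exists>g\<in>C. g \<circ> f = id \<and> f \<circ> g = id"
  shows "transformations (transformation_group C)"
proof (rule group_transformations[OF _ _ inverse])
  have C: "generate (transformation_group C) (\<sigma> ` S) = C"
    using gen by (simp add: generating_map_def transformation_group_def)
  show "id \<in> C"
    using generate.one[of "transformation_group C" "\<sigma> ` S"] unfolding C by (simp add: transformation_group_def)
  show "g \<circ> f \<in> C" if "f \<in> C" "g \<in> C" for f g
    using generate.eng[of f "transformation_group C" "\<sigma> ` S" g] that unfolding C
    by (simp add: transformation_group_def)
qed

subsection \<open>Dyadic piecewise affine maps\<close>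

lemma dyadicsI: "of_int m / 2 ^ n \<in> dyadics"
  by (auto simp: dyadics_def)

lemma dyadics_of_int: "of_int m \<in> dyadics"
  using dyadicsI[of m 0] by simp

lemma dyadics_add:
  assumes "x \<in> dyadics" "y \<in> dyadics" shows "x + y \<in> dyadics"
proof -
  obtain m n m' n' where e: "x = of_int m / 2 ^ n" "y = of_int m' / 2 ^ n'"
    using assms by (auto simp: dyadics_def)
  have "x + y = of_int (m * 2 ^ n' + m' * 2 ^ n) / 2 ^ (n + n')"
    unfolding e by (simp add: field_simps power_add)
  then show ?thesis by (simp only: dyadicsI)
qed

lemma dyadics_minus: "x \<in> dyadics \<Longrightarrow> - x \<in> dyadics"
  by (auto simp: dyadics_def) (metis minus_divide_left of_int_minus)

lemma dyadics_diff: "x \<in> dyadics \<Longrightarrow> y \<in> dyadics \<Longrightarrow> x - y \<in> dyadics"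
  using dyadics_add[OF _ dyadics_minus] by fastforce

lemma dyadics_powi:
  assumes "x \<in> dyadics" shows "2 powi k * x \<in> dyadics"
proof -
  obtain m n where x: "x = of_int m / 2 ^ n" using assms by (auto simp: dyadics_def)
  show ?thesis
  proof (cases "0 \<le> k")
    case True
    then have "2 powi k * x = of_int (m * 2 ^ nat k) / 2 ^ n"
      by (simp add: x power_int_def)
    then show ?thesis by (simp only: dyadicsI)
  next
    case False
    then have "2 powi k * x = of_int m / 2 ^ (n + nat (- k))"
      by (simp add: x power_int_def field_simps power_add)
    then show ?thesis by (simp only: dyadicsI)
  qed
qed

lemma dyadics_of_int_mult: "x \<in> dyadics \<Longrightarrow> of_int k * x \<in> dyadics"
  using dyadicsI[of "k * m" n for m n] by (auto simp: dyadics_def)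

lemma dyadics_double: "x \<in> dyadics \<Longrightarrow> 2 * x \<in> dyadics"
  and dyadics_half: "x \<in> dyadics \<Longrightarrow> x / 2 \<in> dyadics"
  using dyadics_powi[of x 1] dyadics_powi[of x "-1"] by (simp_all add: power_int_def)

lemma dyadics_powi_iff: "2 powi k * x \<in> dyadics \<longleftrightarrow> x \<in> dyadics"
proof
  assume "2 powi k * x \<in> dyadics"
  from dyadics_powi[OF this, of "- k"] show "x \<in> dyadics"
    by (simp add: power_int_minus field_simps)
qed (rule dyadics_powi)

definition affine_off :: "real set \<Rightarrow> real set \<Rightarrow> (real \<Rightarrow> real) \<Rightarrow> bool" where
  "affine_off B D f \<longleftrightarrow> (\<forall>a b. {a..b} \<subseteq> D \<and> {a<..<b} \<inter> B = {} \<longrightarrow>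
     (\<exists>(k :: int) c. \<forall>x\<in>{a..b}. f x = 2 powi k * x + c))"

text \<open>\<open>b\<close> is the last breakpoint between \<open>x\<close> and \<open>y\<close>,
  or \<open>x\<close> if there is none. Passing from \<open>y\<close> to \<open>b\<close> crosses a
  single affine piece and leaves fewer breakpoints, which drives the inductions below.\<close>

lemma affine_off_piece:
  assumes f: "affine_off B D f" and B: "finite B" and xy: "x < y" "{x..y} \<subseteq> D"
  obtains b and k :: int where "b = x \<or> b \<in> B \<and> x < b" "x \<le> b" "b < y" "f y = f b + 2 powi k * (y - b)"
    "card (B \<inter> {x<..<b}) < card (B \<inter> {x<..<y}) \<or> b = x"
proof -
  let ?M = "insert x (B \<inter> {x<..<y})"
  define b where "b = Max ?M"
  have fin: "finite ?M" using B by simp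
  have b: "b \<in> ?M" unfolding b_def using fin by (intro Max_in) auto
  have max: "m \<le> b" if "m \<in> ?M" for m unfolding b_def using fin that by (rule Max_ge)
  have xb: "x \<le> b" "b < y" using b xy max by auto
  have "{b..y} \<subseteq> D" using xb xy by auto
  moreover have "{b<..<y} \<inter> B = {}" using max xb by fastforce
  ultimately obtain k :: int and c where k: "\<forall>t\<in>{b..y}. f t = 2 powi k * t + c"
    using f unfolding affine_off_def by blast
  have "f y = f b + 2 powi k * (y - b)" using k xb by (simp add: algebra_simps)
  moreover have "card (B \<inter> {x<..<b}) < card (B \<inter> {x<..<y}) \<or> b = x"
  proof (cases "b = x")
    case False
    then have "b \<in> B \<inter> {x<..<y}" using b by simp
    then have "B \<inter> {x<..<b} \<subset> B \<inter> {x<..<y}" using xb by auto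
    then show ?thesis using B by (intro disjI1 psubset_card_mono) auto
  qed simp
  ultimately show thesis using that[of b k] b xb by auto
qed

lemma affine_off_strict_mono:
  assumes f: "affine_off B D f" and B: "finite B" and "x < y" "{x..y} \<subseteq> D"
  shows "f x < f y"
  using assms(3,4)
proof (induction "card (B \<inter> {x<..<y})" arbitrary: y rule: less_induct)
  case less
  obtain b and k :: int where b: "b = x \<or> b \<in> B \<and> x < b" "x \<le> b" "b < y" "f y = f b + 2 powi k * (y - b)"
    "card (B \<inter> {x<..<b}) < card (B \<inter> {x<..<y}) \<or> b = x"
    using affine_off_piece[OF f B less.prems] by blast
  have "f b < f y" using b(3,4) by simp
  moreover have "f x \<le> f b"
  proof (cases "b = x")
    case False
    moreover have "{x..b} \<subseteq> D" by (rule subset_trans[OF _ less.prems(2)]) (use b in auto)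
    ultimately have "f x < f b" using less.hyps[of b] b by auto
    then show ?thesis by simp
  qed simp
  ultimately show ?case by simp
qed

text \<open>Scaling by powers of 2 and translating by dyadics both preserve and reflect being
  dyadic. Preserving makes the breakpoints of inverses in \<open>F\<close> dyadic, reflecting makes
  inverse lifts in \<open>T\<close> preserve the dyadics.\<close>

lemma affine_off_dyadics:
  assumes f: "affine_off B D f" and B: "finite B" "B \<subseteq> dyadics"
    and x: "x \<in> dyadics" "f x \<in> dyadics" and "x \<le> y" "{x..y} \<subseteq> D"
  shows "f y \<in> dyadics \<longleftrightarrow> y \<in> dyadics"
  using assms(6,7)
proof (induction "card (B \<inter> {x<..<y})" arbitrary: y rule: less_induct)
  case less
  show ?case
  proof (cases "x = y")
    case False
    then obtain b and k :: int where b: "b = x \<or> b \<in> B \<and> x < b" "x \<le> b" "b < y" "f y = f b + 2 powi k * (y - b)"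
      "card (B \<inter> {x<..<b}) < card (B \<inter> {x<..<y}) \<or> b = x"
      using affine_off_piece[OF f B(1), of x y] less.prems by auto
    have bd: "b \<in> dyadics" using b(1) x B by auto
    have "f b \<in> dyadics"
    proof (cases "b = x")
      case False
      moreover have "{x..b} \<subseteq> D" by (rule subset_trans[OF _ less.prems(2)]) (use b in auto)
      ultimately show ?thesis using less.hyps[of b] b bd by auto
    qed (use x in simp)
    then have "f y \<in> dyadics \<longleftrightarrow> 2 powi k * (y - b) \<in> dyadics"
      unfolding b(4) using dyadics_add dyadics_diff by (metis add_diff_cancel_left')
    also have "\<dots> \<longleftrightarrow> y \<in> dyadics"
      unfolding dyadics_powi_iff using bd dyadics_add dyadics_diff by (metis diff_add_cancel)
    finally show ?thesis .
  qed (use x in simp)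
qed

lemma inverse_affine:
  assumes "\<forall>x\<in>{p..q}. f x = 2 powi k * x + (c :: real)" "\<And>t. t \<in> A \<Longrightarrow> g t \<in> {p..q} \<and> f (g t) = t"
  shows "\<exists>(k :: int) c. \<forall>t\<in>A. g t = 2 powi k * t + c"
proof (intro exI ballI)
  fix t assume "t \<in> A"
  then have "t = 2 powi k * g t + c" using assms by force
  moreover have "(2::real) powi (- k) * 2 powi k = 1"
    by (simp flip: power_int_add)
  ultimately show "g t = 2 powi (- k) * t + - (2 powi (- k) * c)"
    by (metis (no_types, opaque_lifting) add_diff_cancel_right' diff_conv_add_uminus left_diff_distrib mult.assoc mult.commute mult_1)
qed

text \<open>The standard generator \<open>x_0\<close> of \<open>F\<close>, scaled from the unit
  interval to the one from \<open>l\<close> to \<open>l + 4 * h\<close>; its slopes are 1/2, 1 and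
  2, changing at \<open>l + 2 * h\<close> and \<open>l + 3 * h\<close>. Written with
  \<open>min\<close> and \<open>max\<close> it is visibly continuous, and facts about it reduce to
  linear case distinctions. \<open>stretch\<close> is the inverse.\<close>

definition squeeze :: "real \<Rightarrow> real \<Rightarrow> real \<Rightarrow> real" where
  "squeeze l h x = min x (max ((x + l) / 2) (max (x - h) (2 * x - l - 4 * h)))"

definition stretch :: "real \<Rightarrow> real \<Rightarrow> real \<Rightarrow> real" where
  "stretch l h x = max x (min (2 * x - l) (min (x + h) ((x + l + 4 * h) / 2)))"

lemma squeeze_outside: "0 < h \<Longrightarrow> x \<le> l \<or> l + 4 * h \<le> x \<Longrightarrow> squeeze l h x = x"
  by (auto simp: squeeze_def min_def max_def)

lemma stretch_outside: "0 < h \<Longrightarrow> x \<le> l \<or> l + 4 * h \<le> x \<Longrightarrow> stretch l h x = x"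
  by (auto simp: stretch_def min_def max_def)

lemma squeeze_inside:
  "0 < h \<Longrightarrow> l \<le> x \<Longrightarrow> x \<le> l + 2 * h \<Longrightarrow> squeeze l h x = (x + l) / 2"
  "0 < h \<Longrightarrow> l + 2 * h \<le> x \<Longrightarrow> x \<le> l + 3 * h \<Longrightarrow> squeeze l h x = x - h"
  "0 < h \<Longrightarrow> l + 3 * h \<le> x \<Longrightarrow> x \<le> l + 4 * h \<Longrightarrow> squeeze l h x = 2 * x - l - 4 * h"
  by (auto simp: squeeze_def min_def max_def field_simps)

lemma stretch_inside:
  "0 < h \<Longrightarrow> l \<le> x \<Longrightarrow> x \<le> l + h \<Longrightarrow> stretch l h x = 2 * x - l"
  "0 < h \<Longrightarrow> l + h \<le> x \<Longrightarrow> x \<le> l + 2 * h \<Longrightarrow> stretch l h x = x + h"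
  "0 < h \<Longrightarrow> l + 2 * h \<le> x \<Longrightarrow> x \<le> l + 4 * h \<Longrightarrow> stretch l h x = (x + l + 4 * h) / 2"
  by (auto simp: stretch_def min_def max_def field_simps)

lemma stretch_squeeze: "0 < h \<Longrightarrow> stretch l h (squeeze l h x) = x"
  by (auto simp: stretch_def squeeze_def min_def max_def field_simps)

lemma squeeze_stretch: "0 < h \<Longrightarrow> squeeze l h (stretch l h x) = x"
  by (auto simp: stretch_def squeeze_def min_def max_def field_simps)

lemma strict_mono_squeeze: "strict_mono (squeeze l h)"
  unfolding strict_mono_def squeeze_def min_def max_def by auto

lemma strict_mono_stretch: "strict_mono (stretch l h)"
  unfolding strict_mono_def stretch_def min_def max_def by auto

lemma continuous_squeeze: "continuous_on A (squeeze l h)"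
  unfolding squeeze_def by (intro continuous_intros) auto

lemma continuous_stretch: "continuous_on A (stretch l h)"
  unfolding stretch_def by (intro continuous_intros) auto

lemma dyadics_squeeze: "l \<in> dyadics \<Longrightarrow> h \<in> dyadics \<Longrightarrow> x \<in> dyadics \<Longrightarrow> squeeze l h x \<in> dyadics"
  using dyadics_double[OF dyadics_double[of h]]
  by (auto simp: squeeze_def min_def max_def intro!: dyadics_diff dyadics_add dyadics_half dyadics_double)

lemma dyadics_stretch: "l \<in> dyadics \<Longrightarrow> h \<in> dyadics \<Longrightarrow> x \<in> dyadics \<Longrightarrow> stretch l h x \<in> dyadics"
  using dyadics_double[OF dyadics_double[of h]]
  by (auto simp: stretch_def min_def max_def intro!: dyadics_diff dyadics_add dyadics_half dyadics_double)

lemma dyadic_affine_squeeze: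
  assumes "0 < h" "l \<in> dyadics" "h \<in> dyadics" shows "dyadic_piecewise_affine_on D (squeeze l h)"
proof -
  let ?B = "{l, l + 2 * h, l + 3 * h, l + 4 * h}"
  have "\<exists>(k :: int) c. \<forall>x\<in>{a..b}. squeeze l h x = 2 powi k * x + c" if "{a<..<b} \<inter> ?B = {}" for a b
  proof (cases "a < b")
    case True
    have p: "p \<le> a \<or> b \<le> p" if "p \<in> ?B" for p using \<open>{a<..<b} \<inter> ?B = {}\<close> that by fastforce
    consider "b \<le> l \<or> l + 4 * h \<le> a" | "l \<le> a" "b \<le> l + 2 * h" | "l + 2 * h \<le> a" "b \<le> l + 3 * h"
      | "l + 3 * h \<le> a" "b \<le> l + 4 * h"
      using p[of l] p[of "l + 2 * h"] p[of "l + 3 * h"] p[of "l + 4 * h"] True assms(1) by auto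
    then show ?thesis
    proof cases
      case 1
      then show ?thesis using assms(1)
        by (intro exI[of _ 0] exI[of _ 0]) (auto simp: squeeze_outside)
    next
      case 2
      then show ?thesis using assms(1)
        by (intro exI[of _ "-1"] exI[of _ "l / 2"]) (auto simp: squeeze_inside power_int_def field_simps)
    next
      case 3
      then show ?thesis using assms(1)
        by (intro exI[of _ 0] exI[of _ "- h"]) (auto simp: squeeze_inside)
    next
      case 4
      then show ?thesis using assms(1)
        by (intro exI[of _ 1] exI[of _ "- l - 4 * h"]) (auto simp: squeeze_inside)
    qed
  next
    case False
    then have "{a..b} \<subseteq> {a}" by auto
    then show ?thesis by (intro exI[of _ 0] exI[of _ "squeeze l h a - a"]) auto
  qed
  moreover have "?B \<subseteq> dyadics"
  proof -
    have "2 * h \<in> dyadics" "3 * h \<in> dyadics" "4 * h \<in> dyadics"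
      using dyadics_of_int_mult[OF assms(3), of 2] dyadics_of_int_mult[OF assms(3), of 3]
        dyadics_of_int_mult[OF assms(3), of 4] by simp_all
    then show ?thesis using assms(2) by (auto intro: dyadics_add)
  qed
  ultimately show ?thesis unfolding dyadic_piecewise_affine_on_def
    by (intro exI[of _ ?B] conjI) auto
qed

lemma dyadic_affine_stretch:
  assumes "0 < h" "l \<in> dyadics" "h \<in> dyadics" shows "dyadic_piecewise_affine_on D (stretch l h)"
proof -
  let ?B = "{l, l + h, l + 2 * h, l + 4 * h}"
  have "\<exists>(k :: int) c. \<forall>x\<in>{a..b}. stretch l h x = 2 powi k * x + c" if "{a<..<b} \<inter> ?B = {}" for a b
  proof (cases "a < b")
    case True
    have p: "p \<le> a \<or> b \<le> p" if "p \<in> ?B" for p using \<open>{a<..<b} \<inter> ?B = {}\<close> that by fastforce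
    consider "b \<le> l \<or> l + 4 * h \<le> a" | "l \<le> a" "b \<le> l + h" | "l + h \<le> a" "b \<le> l + 2 * h"
      | "l + 2 * h \<le> a" "b \<le> l + 4 * h"
      using p[of l] p[of "l + h"] p[of "l + 2 * h"] p[of "l + 4 * h"] True assms(1) by auto
    then show ?thesis
    proof cases
      case 1
      then show ?thesis using assms(1)
        by (intro exI[of _ 0] exI[of _ 0]) (auto simp: stretch_outside)
    next
      case 2
      then show ?thesis using assms(1)
        by (intro exI[of _ 1] exI[of _ "- l"]) (auto simp: stretch_inside)
    next
      case 3
      then show ?thesis using assms(1)
        by (intro exI[of _ 0] exI[of _ h]) (auto simp: stretch_inside)
    next
      case 4
      then show ?thesis using assms(1)
        by (intro exI[of _ "-1"] exI[of _ "(l + 4 * h) / 2"]) (auto simp: stretch_inside power_int_def field_simps)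
    qed
  next
    case False
    then have "{a..b} \<subseteq> {a}" by auto
    then show ?thesis by (intro exI[of _ 0] exI[of _ "stretch l h a - a"]) auto
  qed
  moreover have "?B \<subseteq> dyadics"
  proof -
    have "2 * h \<in> dyadics" "4 * h \<in> dyadics"
      using dyadics_of_int_mult[OF assms(3), of 2] dyadics_of_int_mult[OF assms(3), of 4] by simp_all
    then show ?thesis using assms(2,3) by (auto intro: dyadics_add)
  qed
  ultimately show ?thesis unfolding dyadic_piecewise_affine_on_def
    by (intro exI[of _ ?B] conjI) auto
qed

text \<open>The choice of the transformations for \<open>F\<close> and \<open>T\<close>: \<open>I = (3/8, 5/8)\<close>, \<open>J = (31/64, 33/64)\<close>, and
  three applications of \<open>squeeze (1/2) (1/8) \<circ> stretch 0 (1/8)\<close> contract \<open>I\<close> to \<open>J\<close> about \<open>1/2\<close>.\<close>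

lemma squeeze_moves: "t \<in> {3/8<..<5/8} \<Longrightarrow> squeeze 0 (1/4) t \<notin> {3/8<..<5/8}"
  by (auto simp: squeeze_def min_def max_def)

text \<open>\<open>stretch\<close> acts on the lower half of the unit interval and
  \<open>squeeze\<close> on the upper half; on its side next to the common fixed point 1/2 each has
  slope 1/2.\<close>

lemma contraction_step:
  "t \<in> {1/4..3/4} \<Longrightarrow> squeeze (1/2) (1/8) (stretch 0 (1/8) t) = t / 2 + 1/4"
  by (auto simp: squeeze_def stretch_def min_def max_def field_simps)

lemma contraction:
  fixes t :: real
  defines "e \<equiv> squeeze (1/2) (1/8) \<circ> stretch 0 (1/8)"
  assumes "t \<in> {3/8<..<5/8}"
  shows "e (e (e t)) \<in> {31/64<..<33/64}"
proof -
  have "e t = t / 2 + 1/4" unfolding e_def o_apply by (rule contraction_step) (use assms(2) in auto)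
  moreover have "e (t / 2 + 1/4) = (t / 2 + 1/4) / 2 + 1/4"
    unfolding e_def o_apply by (rule contraction_step) (use assms(2) in auto)
  moreover have "e ((t / 2 + 1/4) / 2 + 1/4) = ((t / 2 + 1/4) / 2 + 1/4) / 2 + 1/4"
    unfolding e_def o_apply by (rule contraction_step) (use assms(2) in auto)
  ultimately show ?thesis using assms(2) by simp
qed

text \<open>In units of 1/128: \<open>y\<close> lives on 49 to 61 and so fixes \<open>J\<close>,
  which is 62 to 66. The inverse of \<open>z\<close> maps \<open>J\<close> onto 55 to 58, the piece
  that \<open>y\<close> translates by -3; from the result, 52 to 55, \<open>z\<close> leads to 56 to
  62, just beside \<open>J\<close>.\<close>

lemma commutator_moves:
  assumes "t \<in> {31/64<..<33/64}"
  shows "squeeze (49/128) (3/128) t = t"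
    "stretch (3/8) (1/16) (squeeze (49/128) (3/128) (squeeze (3/8) (1/16) t)) \<notin> {31/64<..<33/64}"
proof -
  show "squeeze (49/128) (3/128) t = t" using assms by (intro squeeze_outside) auto
  define r where "r = squeeze (3/8) (1/16) t"
  have r: "55/128 < r" "r < 58/128"
    using assms by (auto simp: r_def squeeze_def min_def max_def)
  have "squeeze (49/128) (3/128) r = r - 3/128" using r by (intro squeeze_inside(2)) auto
  moreover have "stretch (3/8) (1/16) (r - 3/128) = 2 * (r - 3/128) - 3/8"
    using r by (intro stretch_inside(1)) auto
  ultimately show "stretch (3/8) (1/16) (squeeze (49/128) (3/128) (squeeze (3/8) (1/16) t)) \<notin> {31/64<..<33/64}"
    using r by (simp add: r_def)
qed

lemma unit_interval:
  assumes "0 < h" "0 \<le> l" "l + 4 * h \<le> 1" "t \<in> {0..<1}"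
  shows "squeeze l h t \<in> {0..<1}" "stretch l h t \<in> {0..<1}"
proof -
  have "squeeze l h 0 = 0" "squeeze l h 1 = 1" "stretch l h 0 = 0" "stretch l h 1 = 1"
    using assms by (auto intro!: squeeze_outside stretch_outside)
  then show "squeeze l h t \<in> {0..<1}" "stretch l h t \<in> {0..<1}"
    using assms(4) strict_mono_less_eq[OF strict_mono_squeeze, of l h 0 t]
      strict_mono_less_eq[OF strict_mono_stretch, of l h 0 t]
      strict_mono_less[OF strict_mono_squeeze, of l h t 1]
      strict_mono_less[OF strict_mono_stretch, of l h t 1]
    by auto
qed

lemma dyadics_fractions: "0 \<in> dyadics" "1/4 \<in> dyadics" "1/8 \<in> dyadics" "1/2 \<in> dyadics"
  "3/8 \<in> dyadics" "1/16 \<in> dyadics" "49/128 \<in> dyadics" "3/128 \<in> dyadics"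
  using dyadicsI[of 0 0] dyadicsI[of 1 2] dyadicsI[of 1 3] dyadicsI[of 1 1] dyadicsI[of 3 3]
    dyadicsI[of 1 4] dyadicsI[of 49 7] dyadicsI[of 3 7] by simp_all

context transformations
begin

lemma inv_eqI: "f \<in> carrier G \<Longrightarrow> f q = p \<Longrightarrow> (inv f) p = q"
  by (metis inv_apply(1))

text \<open>The common part of \<open>F\<close> and \<open>T\<close>. \<open>P\<close> is a chart,
  injective on the half-open interval because 0 and 1 coincide on the circle, and
  \<open>\<Phi>\<close> turns maps of the line into maps of the space.\<close>

theorem word_problem_hard_piecewise_affine:
  fixes \<Phi> :: "(real \<Rightarrow> real) \<Rightarrow> 'p \<Rightarrow> 'p" and P :: "real \<Rightarrow> 'p"
  assumes carrier: "\<And>l h. \<lbrakk>0 < h; l \<in> dyadics; h \<in> dyadics; 0 \<le> l; l + 4 * h \<le> 1\<rbrakk> \<Longrightarrow>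
      \<Phi> (squeeze l h) \<in> carrier G \<and> \<Phi> (stretch l h) \<in> carrier G"
    and on_P: "\<And>l h t. \<lbrakk>0 < h; 0 \<le> l; l + 4 * h \<le> 1; t \<in> {0..<1}\<rbrakk> \<Longrightarrow>
      \<Phi> (squeeze l h) (P t) = P (squeeze l h t) \<and> \<Phi> (stretch l h) (P t) = P (stretch l h t)"
    and inj: "inj_on P {0..<1}"
    and other: "\<And>u p. p \<notin> P ` {0<..<1} \<Longrightarrow> (\<And>t. t \<notin> {0<..<1} \<Longrightarrow> u t = t) \<Longrightarrow> \<Phi> u p = p"
    and gen: "generating_map G S \<sigma>" and code: "block_code code (letters S)"
  shows "ALOGTIME_hard (encode_language code (word_problem G S \<sigma>))"
proof -
  let ?g = "\<Phi> (squeeze 0 (1/4))" and ?y = "\<Phi> (squeeze (49/128) (3/128))" and ?z = "\<Phi> (stretch (3/8) (1/16))"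
  define e where "e = \<Phi> (stretch 0 (1/8)) \<otimes> \<Phi> (squeeze (1/2) (1/8))"
  let ?c = "e \<otimes> e \<otimes> e"
  let ?I = "P ` {3/8<..<5/8}" and ?J = "P ` {31/64<..<33/64}"
  have in_P: "P t \<in> P ` X \<longleftrightarrow> t \<in> X" if "t \<in> {0..<1}" "X \<subseteq> {0..<1}" for t X
    by (rule inj_on_image_mem_iff[OF inj that])
  have in_I: "P t \<in> ?I \<longleftrightarrow> t \<in> {3/8<..<5/8}" if "t \<in> {0..<1}" for t
    by (rule in_P[OF that]) auto
  have in_J: "P t \<in> ?J \<longleftrightarrow> t \<in> {31/64<..<33/64}" if "t \<in> {0..<1}" for t
    by (rule in_P[OF that]) auto
  have cl: "?g \<in> carrier G" "?y \<in> carrier G" "?z \<in> carrier G" "e \<in> carrier G"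
    unfolding e_def using carrier dyadics_fractions by auto
  have supp: "\<Phi> u p = p"
    if "p \<notin> ?I" and u: "\<And>t. t \<notin> {3/8<..<5/8} \<Longrightarrow> u t = t"
      "\<And>t. t \<in> {0..<1} \<Longrightarrow> \<Phi> u (P t) = P (u t)" for u p
  proof (cases "p \<in> P ` {0<..<1}")
    case True
    then obtain t where t: "t \<in> {0<..<1}" "p = P t" by blast
    then have "t \<notin> {3/8<..<5/8}" using that(1) by blast
    then show ?thesis using u(1)[of t] u(2)[of t] t by simp
  next
    case False
    then show ?thesis by (rule other) (rule u(1), auto)
  qed
  show ?thesis
  proof (rule word_problem_hard_contraction[of ?g ?y ?z ?c ?I ?J, OF cl(1-3) _ _ _ _ _ _ _ _ gen code])
    show "?c \<in> carrier G" using cl by simp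
    show "?y p = p" if "p \<notin> ?I" for p
      using that by (rule supp) (auto simp: on_P intro!: squeeze_outside)
    show "?z p = p" if "p \<notin> ?I" for p
      using that by (rule supp) (auto simp: on_P intro!: stretch_outside)
    show "?g p \<notin> ?I" if p: "p \<in> ?I" for p
    proof -
      obtain t where t: "t \<in> {3/8<..<5/8}" "p = P t" using p by blast
      have "squeeze 0 (1/4) t \<in> {0..<1}" using t(1) by (auto simp: squeeze_def min_def max_def)
      moreover have "?g p = P (squeeze 0 (1/4) t)" unfolding t(2) using on_P[of "1/4" 0 t] t(1) by simp
      ultimately show ?thesis using squeeze_moves[OF t(1)] in_I by simp
    qed
    show "?c p \<in> ?J" if p: "p \<in> ?I" for p
    proof -
      obtain t where t: "t \<in> {3/8<..<5/8}" "p = P t" using p by blast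
      define e' where "e' = squeeze (1/2) (1/8) \<circ> stretch 0 (1/8)"
      have e: "e (P r) = P (e' r) \<and> e' r \<in> {1/4..3/4}" if "r \<in> {1/4..3/4}" for r
      proof -
        have "stretch 0 (1/8) r \<in> {0..<1}" using that by (auto simp: stretch_def min_def max_def)
        then show ?thesis using that contraction_step[OF that]
          by (simp add: e_def e'_def mult_eq on_P)
      qed
      have "?c p = e (e (e p))" by (simp add: mult_eq)
      also have "\<dots> = P (e' (e' (e' t)))"
        using e[of t] e[of "e' t"] e[of "e' (e' t)"] t by simp
      finally show ?thesis using contraction[OF t(1)] unfolding e'_def by (simp only:) (rule imageI)
    qed
    show "?J \<subseteq> ?I" by auto
    show "?z (?y ((inv ?z) ((inv ?y) p))) \<notin> ?J" if p: "p \<in> ?J" for p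
    proof -
      obtain t where t: "t \<in> {31/64<..<33/64}" "p = P t" using p by blast
      define r where "r = squeeze (3/8) (1/16) t"
      have t1: "t \<in> {0..<1}" using t(1) by simp
      have r1: "r \<in> {0..<1}" unfolding r_def by (rule unit_interval(1)[OF _ _ _ t1]) simp_all
      have r2: "squeeze (49/128) (3/128) r \<in> {0..<1}" by (rule unit_interval(1)[OF _ _ _ r1]) simp_all
      have r3: "stretch (3/8) (1/16) (squeeze (49/128) (3/128) r) \<in> {0..<1}"
        by (rule unit_interval(2)[OF _ _ _ r2]) simp_all
      have "?y p = p" using on_P[of "3/128" "49/128" t] t1 commutator_moves(1)[OF t(1)] t(2) by simp
      then have 1: "(inv ?y) p = p" using cl(2) by (rule inv_fixed[rotated])
      have "?z (P r) = p"
        using on_P[of "1/16" "3/8" r] r1 t(2) by (simp add: r_def squeeze_stretch stretch_squeeze)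
      then have 2: "(inv ?z) p = P r" using cl(3) by (rule inv_eqI[rotated])
      have "?z (?y (P r)) = P (stretch (3/8) (1/16) (squeeze (49/128) (3/128) r))"
        using on_P r1 r2 by simp
      then show ?thesis
        unfolding 1 2 using commutator_moves(2)[OF t(1)] in_J[OF r3] by (simp only: r_def) blast
    qed
    show "?I \<noteq> {}" by (auto intro!: exI[of _ "1/2"])
  qed
qed

end

subsection \<open>The group F\<close>

definition F_maps :: "(real \<Rightarrow> real) set" where
  "F_maps = {f. (\<exists>f'. homeomorphism {0..1} {0..1} f f') \<and> dyadic_piecewise_affine_on {0..1} f \<and>
         (\<forall>x. x \<notin> {0..1} \<longrightarrow> f x = x)}"

lemma Thompson_F_eq: "Thompson_F = transformation_group F_maps"
  by (simp add: Thompson_F_def F_maps_def)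

lemma dyadic_piecewise_affine_iff:
  "dyadic_piecewise_affine_on D f \<longleftrightarrow> (\<exists>B. finite B \<and> B \<subseteq> dyadics \<and> affine_off B D f)"
  by (simp add: dyadic_piecewise_affine_on_def affine_off_def)

text \<open>Slopes are powers of 2, so \<open>f\<close> is increasing and fixes 0. The breakpoints
  of the inverse are the images of those of \<open>f\<close>, and they are dyadic because
  \<open>f\<close> preserves dyadics, starting from 0.\<close>

lemma F_maps_inverse:
  assumes "f \<in> F_maps" shows "\<exists>g\<in>F_maps. g \<circ> f = id \<and> f \<circ> g = id"
proof -
  obtain f' B where f': "homeomorphism {0..1} {0..1} f f'" and B: "finite B" "B \<subseteq> dyadics"
    and f: "affine_off B {0..1} f" and out: "\<And>x. x \<notin> {0..1} \<Longrightarrow> f x = x"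
    using assms by (auto simp: F_maps_def dyadic_piecewise_affine_iff)
  have mono: "f x < f y" if "x < y" "0 \<le> x" "y \<le> 1" for x y
    using that by (intro affine_off_strict_mono[OF f B(1)]) auto
  have im: "f x \<in> {0..1}" "f' x \<in> {0..1}" "f (f' x) = x" "f' (f x) = x" if "x \<in> {0..1}" for x
    using f' that by (auto simp: homeomorphism_def)
  have f0: "f 0 = 0"
  proof (rule ccontr)
    assume "f 0 \<noteq> 0"
    then have "f' 0 \<noteq> 0" using im(3)[of 0] by auto
    then have "f 0 < f (f' 0)" using im(2)[of 0] by (intro mono) auto
    then show False using im(1)[of 0] im(3)[of 0] by auto
  qed
  define g where "g x = (if x \<in> {0..1} then f' x else x)" for x
  have "g (f x) = x \<and> f (g x) = x" for x
  proof (cases "x \<in> {0..1}")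
    case True
    then show ?thesis using im[of x] by (simp only: g_def if_True)
  next
    case False
    then show ?thesis using out[OF False] by (simp only: g_def if_False)
  qed
  then have "g \<circ> f = id" "f \<circ> g = id" by (auto simp: fun_eq_iff)
  moreover have "g \<in> F_maps"
  proof -
    have hom: "homeomorphism {0..1} {0..1} g f"
      using homeomorphism_symD[OF f'] by (rule homeomorphism_cong) (auto simp: g_def)
    have aff: "affine_off (f ` (B \<inter> {0..1})) {0..1} g"
      unfolding affine_off_def
    proof (intro allI impI)
      fix a b assume ab: "{a..b} \<subseteq> {0..1} \<and> {a<..<b} \<inter> f ` (B \<inter> {0..1}) = {}"
      show "\<exists>(k :: int) c. \<forall>t\<in>{a..b}. g t = 2 powi k * t + c"
      proof (cases "a \<le> b")
        case True
        then have ab1: "a \<in> {0..1}" "b \<in> {0..1}" using ab by auto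
        have le: "f' s \<le> f' t" if "s \<le> t" "s \<in> {0..1}" "t \<in> {0..1}" for s t
        proof (rule ccontr)
          assume "\<not> f' s \<le> f' t"
          then have "f (f' t) < f (f' s)" using im(2)[of s] im(2)[of t] that by (intro mono) auto
          then show False using im(3) that by simp
        qed
        have sub: "{f' a..f' b} \<subseteq> {0..1}" using im(2)[OF ab1(1)] im(2)[OF ab1(2)] by auto
        have "{f' a<..<f' b} \<inter> B = {}"
        proof (rule ccontr)
          assume "{f' a<..<f' b} \<inter> B \<noteq> {}"
          then obtain x where x: "f' a < x" "x < f' b" "x \<in> B" by auto
          have "f (f' a) < f x" "f x < f (f' b)" "x \<in> {0..1}"
            using x im(2)[OF ab1(1)] im(2)[OF ab1(2)] by (auto intro!: mono)
          then have "f x \<in> {a<..<b} \<inter> f ` (B \<inter> {0..1})" using im(3) ab1 x by auto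
          then show False using ab by blast
        qed
        then obtain k :: int and c where k: "\<forall>x\<in>{f' a..f' b}. f x = 2 powi k * x + c"
          using f sub unfolding affine_off_def by blast
        show ?thesis
        proof (rule inverse_affine[OF k])
          fix t assume "t \<in> {a..b}"
          then have "t \<in> {0..1}" "a \<le> t" "t \<le> b" using ab by auto
          then show "g t \<in> {f' a..f' b} \<and> f (g t) = t"
            using le[of a t] le[of t b] ab1 im(3) by (auto simp: g_def)
        qed
      qed auto
    qed
    have dy: "f ` (B \<inter> {0..1}) \<subseteq> dyadics"
    proof clarify
      fix b assume b: "b \<in> B" "b \<in> {0..1}"
      have "f b \<in> dyadics \<longleftrightarrow> b \<in> dyadics"
        using b f0 dyadics_fractions(1) by (intro affine_off_dyadics[OF f B, of 0]) auto
      then show "f b \<in> dyadics" using b B by auto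
    qed
    have fin: "finite (f ` (B \<inter> {0..1}))" using B(1) by simp
    show ?thesis
      unfolding F_maps_def dyadic_piecewise_affine_iff
    proof (intro CollectI conjI allI impI)
      show "\<exists>f'. homeomorphism {0..1} {0..1} g f'" by (rule exI, rule hom)
      show "\<exists>B. finite B \<and> B \<subseteq> dyadics \<and> affine_off B {0..1} g"
        by (rule exI, intro conjI, rule fin, rule dy, rule aff)
    qed (simp only: g_def if_False)
  qed
  ultimately show ?thesis by blast
qed

lemma homeomorphism_squeeze:
  assumes "0 < h" "0 \<le> l" "l + 4 * h \<le> 1"
  shows "homeomorphism {0..1} {0..1} (squeeze l h) (stretch l h)"
proof (rule homeomorphismI)
  have s: "squeeze l h 0 = 0" "squeeze l h 1 = 1" "stretch l h 0 = 0" "stretch l h 1 = 1"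
    using assms by (auto intro!: squeeze_outside stretch_outside)
  show "squeeze l h ` {0..1} \<subseteq> {0..1}"
    using s strict_mono_less_eq[OF strict_mono_squeeze, of l h 0] strict_mono_less_eq[OF strict_mono_squeeze, of l h _ 1]
    by auto
  show "stretch l h ` {0..1} \<subseteq> {0..1}"
    using s strict_mono_less_eq[OF strict_mono_stretch, of l h 0] strict_mono_less_eq[OF strict_mono_stretch, of l h _ 1]
    by auto
qed (use assms in \<open>auto simp: continuous_squeeze continuous_stretch stretch_squeeze squeeze_stretch\<close>)

theorem word_problem_hard_Thompson_F:
  assumes gen: "generating_map Thompson_F S \<sigma>" and code: "block_code code (letters S)"
  shows "ALOGTIME_hard (encode_language code (word_problem Thompson_F S \<sigma>))"
proof -
  interpret transformations Thompson_F
    unfolding Thompson_F_eq by (rule transformations_generated[OF gen[unfolded Thompson_F_eq] F_maps_inverse])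
  have car: "carrier Thompson_F = F_maps" by (simp add: Thompson_F_eq transformation_group_def)
  show ?thesis
  proof (rule word_problem_hard_piecewise_affine[of "\<lambda>u. u" "\<lambda>t. t", OF _ _ _ _ gen code])
    fix l h :: real
    assume h: "0 < h" "l \<in> dyadics" "h \<in> dyadics" "0 \<le> l" "l + 4 * h \<le> 1"
    have hom: "homeomorphism {0..1} {0..1} (squeeze l h) (stretch l h)"
      using h by (intro homeomorphism_squeeze) auto
    show "squeeze l h \<in> carrier Thompson_F \<and> stretch l h \<in> carrier Thompson_F"
      unfolding car F_maps_def
    proof (intro CollectI conjI allI impI)
      show "\<exists>f'. homeomorphism {0..1} {0..1} (squeeze l h) f'" "\<exists>f'. homeomorphism {0..1} {0..1} (stretch l h) f'"
        using hom homeomorphism_symD[OF hom] by blast+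
      show "dyadic_piecewise_affine_on {0..1} (squeeze l h)" "dyadic_piecewise_affine_on {0..1} (stretch l h)"
        using h dyadic_affine_squeeze dyadic_affine_stretch by blast+
      show "squeeze l h x = x" "stretch l h x = x" if "x \<notin> {0..1}" for x
        using that h by (auto intro!: squeeze_outside stretch_outside)
    qed
  qed auto
qed

subsection \<open>The group T\<close>

definition T_lift :: "(circle \<Rightarrow> circle) \<Rightarrow> (real \<Rightarrow> real) \<Rightarrow> bool" where
  "T_lift g h \<longleftrightarrow> continuous_on UNIV h \<and> strict_mono h \<and> (\<forall>x. h (x + 1) = h x + 1) \<and>
     (\<forall>x. g (abs_circle x) = abs_circle (h x)) \<and>
     dyadic_piecewise_affine_on {0..1} h \<and> h ` dyadics \<subseteq> dyadics"

definition T_maps :: "(circle \<Rightarrow> circle) set" where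
  "T_maps = {g. (\<exists>g'. homeomorphism UNIV UNIV g g') \<and> (\<exists>h. T_lift g h)}"

lemma Thompson_T_eq: "Thompson_T = transformation_group T_maps"
  by (simp add: Thompson_T_def T_maps_def T_lift_def)

lemma abs_circle_eq_iff: "abs_circle x = abs_circle y \<longleftrightarrow> x - y \<in> \<int>"
  by (rule circle.abs_eq_iff)

lemma abs_rep_circle: "abs_circle (rep_circle p) = p"
  by (rule Quotient3_abs_rep[OF Quotient3_circle])

lemma abs_circle_add_of_int: "abs_circle (x + of_int n) = abs_circle x"
  by (simp add: abs_circle_eq_iff)

lemma periodic_of_int:
  fixes h :: "real \<Rightarrow> real"
  assumes "\<And>x. h (x + 1) = h x + 1"
  shows "h (x + of_int n) = h x + of_int n"
proof -
  have nat: "h (x + of_nat m) = h x + of_nat m" for m x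
  proof (induction m)
    case (Suc m)
    then show ?case using assms[of "x + of_nat m"] by (simp add: algebra_simps)
  qed simp
  show ?thesis
  proof (cases n)
    case (nonneg m)
    then show ?thesis using nat[of x m] by simp
  next
    case (neg m)
    then show ?thesis using nat[of "x + of_int n" "Suc m"] by simp
  qed
qed

lemma strict_mono_periodic_surj:
  fixes h :: "real \<Rightarrow> real"
  assumes "continuous_on UNIV h" "\<And>x. h (x + 1) = h x + 1"
  shows "\<exists>x. h x = t"
proof -
  define n where "n = \<lfloor>t - h 0\<rfloor>"
  have h: "h (of_int i) = h 0 + of_int i" for i
    using periodic_of_int[of h, OF assms(2), of 0 i] by simp
  have "of_int n \<le> t - h 0" "t - h 0 \<le> of_int (n + 1)" unfolding n_def by linarith+
  then have "h (of_int n) \<le> t" "t \<le> h (of_int (n + 1))" unfolding h by simp_all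
  moreover have "continuous_on {of_int n..of_int (n + 1)} h"
    using assms(1) by (rule continuous_on_subset) simp
  ultimately show ?thesis using IVT'[of h "of_int n" t "of_int (n + 1)"] by auto
qed

text \<open>The inverse \<open>k\<close> of the lift is a lift of the inverse. The affine pieces of
  \<open>h\<close> are given on \<open>{0..1}\<close> only, so points are first moved there by
  integers.\<close>

lemma T_maps_inverse:
  assumes "g \<in> T_maps" shows "\<exists>g'\<in>T_maps. g' \<circ> g = id \<and> g \<circ> g' = id"
proof -
  obtain g' h where g': "homeomorphism UNIV UNIV g g'" and "T_lift g h"
    using assms by (auto simp: T_maps_def)
  then have h: "continuous_on UNIV h" "strict_mono h" "\<And>x. h (x + 1) = h x + 1"
      "\<And>x. g (abs_circle x) = abs_circle (h x)" "dyadic_piecewise_affine_on {0..1} h" "h ` dyadics \<subseteq> dyadics"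
    by (simp_all add: T_lift_def)
  obtain B where B: "finite B" "B \<subseteq> dyadics" and aff: "affine_off B {0..1} h"
    using h(5) unfolding dyadic_piecewise_affine_iff by blast
  have gg: "g' (g p) = p" "g (g' p) = p" for p using g' by (auto simp: homeomorphism_def)
  define k where "k t = (SOME x. h x = t)" for t
  have hk: "h (k t) = t" for t
    unfolding k_def by (rule someI_ex) (rule strict_mono_periodic_surj[OF h(1) h(3)])
  have kh: "k (h x) = x" for x using hk[of "h x"] strict_mono_eq[OF h(2)] by simp
  have le: "k s \<le> k t \<longleftrightarrow> s \<le> t" for s t using strict_mono_less_eq[OF h(2), of "k s" "k t"] by (simp add: hk)
  have less: "k s < k t \<longleftrightarrow> s < t" for s t using strict_mono_less[OF h(2), of "k s" "k t"] by (simp add: hk)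
  have h_less: "a < h x \<longleftrightarrow> k a < x" "h x < a \<longleftrightarrow> x < k a" for a x
    using less[of a "h x"] less[of "h x" a] by (simp_all add: kh)
  have hn: "h (x + of_int n) = h x + of_int n" for x n by (rule periodic_of_int[of h, OF h(3)])
  have k1: "k (t + 1) = k t + 1" for t using kh[of "k t + 1"] by (simp add: h(3) hk)
  have mono: "strict_mono k" using less by (simp add: strict_mono_def)
  have "continuous_on UNIV k"
  proof (rule continuous_onI_mono)
    have "surj k" using kh by (metis surjI)
    then show "open (range k)" by simp
  qed (simp add: le)
  moreover have "g' (abs_circle t) = abs_circle (k t)" for t
    using gg(1)[of "abs_circle (k t)"] by (simp add: h(4) hk)
  moreover have "k ` dyadics \<subseteq> dyadics"
  proof clarify
    fix t :: real assume t: "t \<in> dyadics"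
    define n where "n = \<lfloor>k t\<rfloor>"
    define y where "y = k t - of_int n"
    have y: "0 \<le> y" "y \<le> 1" by (simp_all add: y_def n_def) linarith+
    have "h y = t - of_int n" using hn[of y n] by (simp add: y_def hk)
    then have "h y \<in> dyadics" using t by (simp add: dyadics_diff dyadics_of_int)
    moreover have "h y \<in> dyadics \<longleftrightarrow> y \<in> dyadics"
    proof (rule affine_off_dyadics[OF aff B dyadics_fractions(1)])
      show "h 0 \<in> dyadics" using h(6) dyadics_fractions(1) by blast
    qed (use y in auto)
    ultimately have "y + of_int n \<in> dyadics" by (intro dyadics_add dyadics_of_int) blast
    then show "k t \<in> dyadics" by (simp add: y_def)
  qed
  moreover have "dyadic_piecewise_affine_on {0..1} k"
  proof -
    \<comment> \<open>\<open>k\<close> maps \<open>{0..1}\<close> onto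
      \<open>{k 0..k 0 + 1}\<close>, which is covered by two consecutive unit intervals, so two
      translates of \<open>B\<close> suffice. The point 0 is added because pieces may change at
      integers.\<close>
    let ?A = "insert 0 (B \<inter> {0..1}) \<times> {\<lfloor>k 0\<rfloor>..\<lfloor>k 0\<rfloor> + 1}"
    define B' where "B' = (\<lambda>(b, i). h (b + of_int i)) ` ?A"
    have B'I: "h (b + of_int i) \<in> B'" if "b \<in> insert 0 (B \<inter> {0..1})" "i \<in> {\<lfloor>k 0\<rfloor>..\<lfloor>k 0\<rfloor> + 1}" for b i
      unfolding B'_def by (rule image_eqI[of _ _ "(b, i)"]) (use that in simp_all)
    have "finite B'" unfolding B'_def using B(1) by (intro finite_imageI finite_cartesian_product) simp_all
    moreover have "B' \<subseteq> dyadics"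
    proof
      fix s assume "s \<in> B'"
      then obtain b i where s: "s = h (b + of_int i)" "b \<in> insert 0 (B \<inter> {0..1})"
        unfolding B'_def by auto
      have "b + of_int i \<in> dyadics"
        using s(2) B(2) dyadics_fractions(1) by (intro dyadics_add dyadics_of_int) blast
      then show "s \<in> dyadics" unfolding s(1) using h(6) by blast
    qed
    moreover have "affine_off B' {0..1} k"
      unfolding affine_off_def
    proof (intro allI impI)
      fix a b assume ab: "{a..b} \<subseteq> {0..1} \<and> {a<..<b} \<inter> B' = {}"
      show "\<exists>(j :: int) c. \<forall>t\<in>{a..b}. k t = 2 powi j * t + c"
      proof (cases "a < b")
        case True
        then have ab1: "0 \<le> a" "b \<le> 1" using ab by auto
        define n where "n = \<lfloor>k a\<rfloor>"
        have n: "of_int n \<le> k a" "k a < of_int n + 1" unfolding n_def by linarith+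
        have k01: "k 0 \<le> k a" "k b \<le> k 0 + 1" "k a < k b"
          using ab1 True le[of 0 a] le[of b "0 + 1"] k1[of 0] by (auto simp: less)
        have n0: "\<lfloor>k 0\<rfloor> \<le> n" unfolding n_def using k01(1) by (rule floor_mono)
        have not: "h (x + of_int i) \<notin> B'" if "k a < x + of_int i" "x + of_int i < k b" for x i
        proof
          assume "h (x + of_int i) \<in> B'"
          moreover have "h (x + of_int i) \<in> {a<..<b}" using that by (simp add: h_less)
          ultimately show False using ab by blast
        qed
        have kb: "k b \<le> of_int n + 1"
        proof (rule ccontr)
          assume *: "\<not> k b \<le> of_int n + 1"
          then have "of_int n < k 0" using k01 by simp
          then have "n \<le> \<lfloor>k 0\<rfloor>" by linarith
          then have "h (0 + of_int (n + 1)) \<in> B'" using n0 by (intro B'I) auto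
          moreover have "h (0 + of_int (n + 1)) \<notin> B'" by (rule not) (use n * in auto)
          ultimately show False by blast
        qed
        let ?p = "k a - of_int n" and ?q = "k b - of_int n"
        have sub: "{?p..?q} \<subseteq> {0..1}" using n kb by auto
        have "{?p<..<?q} \<inter> B = {}"
        proof (rule ccontr)
          assume "{?p<..<?q} \<inter> B \<noteq> {}"
          then obtain x where x: "x \<in> B" "?p < x" "x < ?q" by auto
          have "of_int n < k 0 + 1" using n(1) k01 by linarith
          then have "n \<le> \<lfloor>k 0\<rfloor> + 1" by linarith
          then have "h (x + of_int n) \<in> B'" using x n0 n kb by (intro B'I) auto
          moreover have "h (x + of_int n) \<notin> B'" by (rule not) (use x in auto)
          ultimately show False by blast
        qed
        then obtain j :: int and c where j: "\<forall>x\<in>{?p..?q}. h x = 2 powi j * x + c"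
          using aff sub unfolding affine_off_def by blast
        have "\<exists>(j :: int) c. \<forall>t\<in>{a..b}. k t - of_int n = 2 powi j * t + c"
        proof (rule inverse_affine)
          show "\<forall>x\<in>{?p..?q}. h x + of_int n = 2 powi j * x + (c + of_int n)" using j by simp
          show "k t - of_int n \<in> {?p..?q} \<and> h (k t - of_int n) + of_int n = t" if "t \<in> {a..b}" for t
            using that hn[of "k t - of_int n" n] by (simp add: le hk)
        qed
        then obtain j' :: int and c' where "\<forall>t\<in>{a..b}. k t - of_int n = 2 powi j' * t + c'" by blast
        then have "\<forall>t\<in>{a..b}. k t = 2 powi j' * t + (c' + of_int n)" by (simp add: algebra_simps)
        then show ?thesis by blast
      next
        case False
        then have "t = a" if "t \<in> {a..b}" for t using that by auto
        then have "\<forall>t\<in>{a..b}. k t = 2 powi 0 * t + (k a - a)" by fastforce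
        then show ?thesis by blast
      qed
    qed
    ultimately show ?thesis unfolding dyadic_piecewise_affine_iff by blast
  qed
  ultimately have "T_lift g' k" unfolding T_lift_def using k1 mono by simp
  then have "g' \<in> T_maps" unfolding T_maps_def using homeomorphism_symD[OF g'] by blast
  then show ?thesis using gg by (intro bexI[of _ g']) (auto simp: fun_eq_iff)
qed

definition periodic_lift :: "(real \<Rightarrow> real) \<Rightarrow> real \<Rightarrow> real" where
  "periodic_lift u x = of_int \<lfloor>x\<rfloor> + u (frac x)"

definition circle_map :: "(real \<Rightarrow> real) \<Rightarrow> circle \<Rightarrow> circle" where
  "circle_map u p = abs_circle (periodic_lift u (rep_circle p))"

lemma periodic_lift_add_1: "periodic_lift u (x + 1) = periodic_lift u x + 1"
  by (simp add: periodic_lift_def frac_def)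

lemma circle_map_abs: "circle_map u (abs_circle x) = abs_circle (periodic_lift u x)"
proof -
  have "abs_circle (rep_circle (abs_circle x)) = abs_circle x" by (rule abs_rep_circle)
  then obtain n where "rep_circle (abs_circle x) - x = of_int n"
    unfolding abs_circle_eq_iff by (elim Ints_cases)
  then have n: "rep_circle (abs_circle x) = x + of_int n" by simp
  show ?thesis
    unfolding circle_map_def n periodic_of_int[of "periodic_lift u", OF periodic_lift_add_1] by (rule abs_circle_add_of_int)
qed

lemma circle_cases:
  obtains x where "p = abs_circle x" "x \<in> {0..<1}"
proof -
  have "rep_circle p = frac (rep_circle p) + of_int \<lfloor>rep_circle p\<rfloor>" by (simp add: frac_def)
  then have "p = abs_circle (frac (rep_circle p))"
    using abs_rep_circle[of p] abs_circle_add_of_int by metis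
  then show thesis using that frac_ge_0 frac_lt_1 by (metis atLeastLessThan_iff)
qed

lemma inj_abs_circle: "inj_on abs_circle {0..<1}"
proof (rule inj_onI)
  fix x y :: real assume xy: "x \<in> {0..<1}" "y \<in> {0..<1}" "abs_circle x = abs_circle y"
  then obtain n where n: "x - y = of_int n" unfolding abs_circle_eq_iff by (elim Ints_cases)
  then have "\<bar>of_int n :: real\<bar> < 1" using xy by auto
  then have "n = 0" by linarith
  then show "x = y" using n by simp
qed

locale unit_homeomorphism =
  fixes u v :: "real \<Rightarrow> real"
  assumes mono: "strict_mono u" and inverse: "\<And>x. u (v x) = x" "\<And>x. v (u x) = x"
    and outside: "\<And>t. t \<notin> {0<..<1} \<Longrightarrow> u t = t"
begin

lemma unit: "t \<in> {0..<1} \<Longrightarrow> u t \<in> {0..<1}"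
  using strict_mono_less_eq[OF mono, of 0 t] strict_mono_less[OF mono, of t 1] outside[of 0] outside[of 1] by simp

lemma periodic_lift_unit: "t \<in> {0..1} \<Longrightarrow> periodic_lift u t = u t"
proof (cases "t = 1")
  case False
  assume "t \<in> {0..1}"
  then have "\<lfloor>t\<rfloor> = 0" using False by (simp add: floor_eq_iff)
  then show ?thesis by (simp add: periodic_lift_def frac_def)
qed (simp add: periodic_lift_def outside)

lemma floor_periodic_lift: "\<lfloor>periodic_lift u x\<rfloor> = \<lfloor>x\<rfloor>" "frac (periodic_lift u x) = u (frac x)"
proof -
  have "u (frac x) \<in> {0..<1}" by (rule unit) (simp add: frac_lt_1)
  then show *: "\<lfloor>periodic_lift u x\<rfloor> = \<lfloor>x\<rfloor>" by (simp add: periodic_lift_def floor_eq_iff)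
  show "frac (periodic_lift u x) = u (frac x)" unfolding frac_def * by (simp add: periodic_lift_def frac_def)
qed

lemma strict_mono_periodic_lift: "strict_mono (periodic_lift u)"
proof (rule strict_monoI)
  fix x y :: real assume "x < y"
  show "periodic_lift u x < periodic_lift u y"
  proof (cases "\<lfloor>x\<rfloor> = \<lfloor>y\<rfloor>")
    case True
    then have "frac x < frac y" using \<open>x < y\<close> by (simp add: frac_def)
    then show ?thesis using True strict_mono_less[OF mono] by (simp add: periodic_lift_def)
  next
    case False
    then have "\<lfloor>x\<rfloor> < \<lfloor>y\<rfloor>" using floor_mono[of x y] \<open>x < y\<close> by simp
    then have "\<lfloor>periodic_lift u x\<rfloor> < \<lfloor>periodic_lift u y\<rfloor>" by (simp only: floor_periodic_lift)
    then show ?thesis by linarith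
  qed
qed

end

lemma unit_homeomorphism_sym:
  assumes "unit_homeomorphism u v" shows "unit_homeomorphism v u"
proof -
  interpret unit_homeomorphism u v by fact
  show ?thesis
  proof
    show "strict_mono v"
    proof (rule strict_monoI)
      fix x y :: real assume "x < y"
      then show "v x < v y" using strict_mono_less[OF mono, of "v x" "v y"] by (simp add: inverse)
    qed
    show "v t = t" if "t \<notin> {0<..<1}" for t using outside[OF that] inverse(2)[of t] by simp
  qed (rule inverse)+
qed

context unit_homeomorphism
begin

lemma periodic_lift_inverse: "periodic_lift v (periodic_lift u x) = x"
  unfolding periodic_lift_def[of v] floor_periodic_lift inverse by (simp add: frac_def)

lemma circle_map_inverse: "circle_map v (circle_map u p) = p"
  by (rule circle_cases[of p]) (simp add: circle_map_abs periodic_lift_inverse)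

text \<open>A monotone map onto the line is continuous; this avoids gluing at the integers.\<close>

lemma continuous_periodic_lift: "continuous_on UNIV (periodic_lift u)"
proof (rule continuous_onI_mono)
  interpret inv: unit_homeomorphism v u by (rule unit_homeomorphism_sym) unfold_locales
  have "surj (periodic_lift u)" using inv.periodic_lift_inverse by (rule surjI)
  then show "open (range (periodic_lift u))" by simp
qed (simp add: strict_mono_less_eq[OF strict_mono_periodic_lift])

text \<open>By the definition of the quotient topology, continuity of the lift descends to the
  circle.\<close>

lemma continuous_circle_map: "continuous_on UNIV (circle_map u)"
  unfolding continuous_on_open_vimage[OF open_UNIV] Int_UNIV_right
proof (intro allI impI)
  fix U :: "circle set" assume "open U"
  then have "open (periodic_lift u -` (abs_circle -` U))"
    unfolding open_circle_def by (rule open_vimage) (rule continuous_periodic_lift)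
  also have "periodic_lift u -` (abs_circle -` U) = abs_circle -` (circle_map u -` U)"
    by (simp add: vimage_def circle_map_abs)
  finally show "open (circle_map u -` U)" unfolding open_circle_def .
qed

lemma circle_map_in_T_maps:
  assumes affine: "dyadic_piecewise_affine_on {0..1} u" and dyadic: "u ` dyadics \<subseteq> dyadics"
  shows "circle_map u \<in> T_maps"
proof -
  interpret inv: unit_homeomorphism v u by (rule unit_homeomorphism_sym) unfold_locales
  have "homeomorphism UNIV UNIV (circle_map u) (circle_map v)"
    by (rule homeomorphismI)
      (simp_all add: continuous_circle_map inv.continuous_circle_map circle_map_inverse inv.circle_map_inverse)
  moreover have "T_lift (circle_map u) (periodic_lift u)"
    unfolding T_lift_def
  proof (intro conjI allI)
    show "periodic_lift u ` dyadics \<subseteq> dyadics"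
    proof clarify
      fix x :: real assume "x \<in> dyadics"
      then have "frac x \<in> dyadics" unfolding frac_def by (intro dyadics_diff dyadics_of_int)
      then have "u (frac x) \<in> dyadics" using dyadic by blast
      then show "periodic_lift u x \<in> dyadics"
        unfolding periodic_lift_def by (intro dyadics_add dyadics_of_int)
    qed
    obtain B where B: "finite B" "B \<subseteq> dyadics" "affine_off B {0..1} u"
      using affine unfolding dyadic_piecewise_affine_iff by blast
    have "affine_off B {0..1} (periodic_lift u)"
      unfolding affine_off_def
    proof (intro allI impI)
      fix a b assume ab: "{a..b} \<subseteq> {0..1} \<and> {a<..<b} \<inter> B = {}"
      then obtain k :: int and c where k: "\<forall>x\<in>{a..b}. u x = 2 powi k * x + c"
        using B(3) unfolding affine_off_def by blast
      have "\<forall>x\<in>{a..b}. periodic_lift u x = 2 powi k * x + c"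
      proof
        fix x assume x: "x \<in> {a..b}"
        then have "periodic_lift u x = u x" using ab by (intro periodic_lift_unit) blast
        then show "periodic_lift u x = 2 powi k * x + c" using k x by simp
      qed
      then show "\<exists>(k :: int) c. \<forall>x\<in>{a..b}. periodic_lift u x = 2 powi k * x + c" by blast
    qed
    then show "dyadic_piecewise_affine_on {0..1} (periodic_lift u)"
      unfolding dyadic_piecewise_affine_iff using B by blast
  qed (simp_all add: continuous_periodic_lift strict_mono_periodic_lift periodic_lift_add_1 circle_map_abs)
  ultimately show ?thesis unfolding T_maps_def by blast
qed

end

lemma unit_homeomorphism_squeeze:
  assumes "0 < h" "0 \<le> l" "l + 4 * h \<le> 1"
  shows "unit_homeomorphism (squeeze l h) (stretch l h)"
proof
  show "squeeze l h t = t" if "t \<notin> {0<..<1}" for t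
    using assms that by (intro squeeze_outside) auto
qed (simp_all add: strict_mono_squeeze squeeze_stretch stretch_squeeze assms)

theorem word_problem_hard_Thompson_T:
  assumes gen: "generating_map Thompson_T S \<sigma>" and code: "block_code code (letters S)"
  shows "ALOGTIME_hard (encode_language code (word_problem Thompson_T S \<sigma>))"
proof -
  interpret transformations Thompson_T
    unfolding Thompson_T_eq by (rule transformations_generated[OF gen[unfolded Thompson_T_eq] T_maps_inverse])
  have car: "carrier Thompson_T = T_maps" by (simp add: Thompson_T_eq transformation_group_def)
  show ?thesis
  proof (rule word_problem_hard_piecewise_affine[of circle_map abs_circle, OF _ _ _ _ gen code])
    fix l h :: real
    assume h: "0 < h" "l \<in> dyadics" "h \<in> dyadics" "0 \<le> l" "l + 4 * h \<le> 1"
    interpret u: unit_homeomorphism "squeeze l h" "stretch l h"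
      by (rule unit_homeomorphism_squeeze) (use h in simp_all)
    interpret v: unit_homeomorphism "stretch l h" "squeeze l h"
      by (rule unit_homeomorphism_sym) unfold_locales
    show "circle_map (squeeze l h) \<in> carrier Thompson_T \<and> circle_map (stretch l h) \<in> carrier Thompson_T"
      unfolding car
    proof
      show "circle_map (squeeze l h) \<in> T_maps"
        by (rule u.circle_map_in_T_maps) (use h dyadic_affine_squeeze dyadics_squeeze in blast)+
      show "circle_map (stretch l h) \<in> T_maps"
        by (rule v.circle_map_in_T_maps) (use h dyadic_affine_stretch dyadics_stretch in blast)+
    qed
  next
    fix l h t :: real
    assume h: "0 < h" "0 \<le> l" "l + 4 * h \<le> 1" and t: "t \<in> {0..<1}"
    interpret u: unit_homeomorphism "squeeze l h" "stretch l h"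
      by (rule unit_homeomorphism_squeeze) (use h in simp_all)
    interpret v: unit_homeomorphism "stretch l h" "squeeze l h"
      by (rule unit_homeomorphism_sym) unfold_locales
    show "circle_map (squeeze l h) (abs_circle t) = abs_circle (squeeze l h t) \<and>
        circle_map (stretch l h) (abs_circle t) = abs_circle (stretch l h t)"
      using t by (simp add: circle_map_abs u.periodic_lift_unit v.periodic_lift_unit)
  next
    show "inj_on abs_circle {0..<1}" by (rule inj_abs_circle)
  next
    fix u :: "real \<Rightarrow> real" and p assume p: "p \<notin> abs_circle ` {0<..<1}" and u: "\<And>t. t \<notin> {0<..<1} \<Longrightarrow> u t = t"
    obtain x where x: "p = abs_circle x" "x \<in> {0..<1}" by (rule circle_cases)
    then have "x = 0" using p by (cases "x = 0") auto
    then show "circle_map u p = p" using u[of 0] by (simp add: x(1) circle_map_abs periodic_lift_def)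
  qed
qed

subsection \<open>The group V\<close>

definition V_maps :: "(bool stream \<Rightarrow> bool stream) set" where
  "V_maps = {g. \<exists>C D \<beta>. finite C \<and> complete_prefix_code C \<and> finite D \<and> complete_prefix_code D \<and>
           bij_betw \<beta> C D \<and> (\<forall>u\<in>C. \<forall>w. g (u @- w) = \<beta> u @- w)}"

lemma Thompson_V_eq: "Thompson_V = transformation_group V_maps"
  by (simp add: Thompson_V_def V_maps_def)

lemma shift_eq_shift_prefix:
  assumes "u @- w = u' @- w'" "length u \<le> length u'" shows "prefix u u'"
proof -
  have "u = stake (length u) (u @- w)" by (simp add: stake_shift)
  also have "\<dots> = take (length u) u'" unfolding assms(1) using assms(2) by (simp add: stake_shift)
  finally show ?thesis by (metis take_is_prefix)
qed

lemma prefix_code_eq: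
  assumes "complete_prefix_code C" "u \<in> C" "u' \<in> C" "u @- w = u' @- w'"
  shows "u = u' \<and> w = w'"
proof -
  have "prefix u u' \<or> prefix u' u"
    using shift_eq_shift_prefix[OF assms(4)] shift_eq_shift_prefix[OF assms(4)[symmetric]] by linarith
  then have "u = u'" using assms(1-3) unfolding complete_prefix_code_def by metis
  then show ?thesis using assms(4) by simp
qed

text \<open>The inverse exchanges the two prefix codes. Injectivity needs that a stream determines
  its code word in \<open>D\<close>, surjectivity that every stream has one.\<close>

lemma V_maps_inverse:
  assumes "g \<in> V_maps" shows "\<exists>g'\<in>V_maps. g' \<circ> g = id \<and> g \<circ> g' = id"
proof -
  obtain C D \<beta> where C: "finite C" "complete_prefix_code C" and D: "finite D" "complete_prefix_code D"
    and \<beta>: "bij_betw \<beta> C D" and g: "\<And>u w. u \<in> C \<Longrightarrow> g (u @- w) = \<beta> u @- w"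
    using assms by (auto simp: V_maps_def)
  have split: "\<exists>u\<in>C. \<exists>w. p = u @- w" "\<exists>v\<in>D. \<exists>w. p = v @- w" for p
    using C(2) D(2) by (simp_all add: complete_prefix_code_def)
  have "inj g"
  proof (rule injI)
    fix p q assume pq: "g p = g q"
    obtain u w where u: "u \<in> C" "p = u @- w" using split(1) by blast
    obtain u' w' where u': "u' \<in> C" "q = u' @- w'" using split(1) by blast
    have "\<beta> u @- w = \<beta> u' @- w'" using pq g u u' by simp
    moreover have "\<beta> u \<in> D" "\<beta> u' \<in> D" using \<beta> u u' by (auto simp: bij_betw_def)
    ultimately have "\<beta> u = \<beta> u'" "w = w'" using prefix_code_eq[OF D(2)] by blast+
    moreover have "u = u'" using \<beta> u(1) u'(1) \<open>\<beta> u = \<beta> u'\<close> by (auto simp: bij_betw_def inj_on_def)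
    ultimately show "p = q" using u u' by simp
  qed
  have inverse: "inv_into UNIV g (v @- w) = inv_into C \<beta> v @- w" if "v \<in> D" for v w
  proof -
    have v: "inv_into C \<beta> v \<in> C" "\<beta> (inv_into C \<beta> v) = v"
      using that \<beta> by (auto simp: bij_betw_def inv_into_into f_inv_into_f)
    then have "g (inv_into C \<beta> v @- w) = v @- w" by (simp add: g)
    then show ?thesis using inv_f_f[OF \<open>inj g\<close>] by metis
  qed
  have "surj g"
    unfolding surj_def
  proof
    fix p
    obtain v w where v: "v \<in> D" "p = v @- w" using split(2) by blast
    then obtain u where "u \<in> C" "v = \<beta> u" using \<beta> by (auto simp: bij_betw_def)
    then show "\<exists>q. p = g q" using g v(2) by metis
  qed
  have "inv_into UNIV g \<in> V_maps"
    unfolding V_maps_def using C D bij_betw_inv_into[OF \<beta>] inverse by blast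
  moreover have "inv_into UNIV g \<circ> g = id" "g \<circ> inv_into UNIV g = id"
    using \<open>inj g\<close> \<open>surj g\<close> by (simp_all add: surj_iff)
  ultimately show ?thesis by blast
qed

fun replace_prefix :: "(bool list \<times> bool list) list \<Rightarrow> bool stream \<Rightarrow> bool stream" where
  "replace_prefix [] p = p"
| "replace_prefix ((u, v) # R) p =
     (if stake (length u) p = u then v @- sdrop (length u) p else replace_prefix R p)"

text \<open>The names give the prefixes that are exchanged; pairs with equal entries complete the
  prefix code. \<open>shrink\<close> maps the cone of 0 onto the cone of 00.\<close>

abbreviation (input) "swap_0_1 \<equiv> replace_prefix [([False], [True]), ([True], [False])]"
abbreviation (input) "swap_00_010 \<equiv> replace_prefix [([False, False], [False, True, False]),
  ([False, True, False], [False, False]), ([False, True, True], [False, True, True]), ([True], [True])]"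
abbreviation (input) "swap_010_011 \<equiv> replace_prefix [([False, False], [False, False]),
  ([False, True, False], [False, True, True]), ([False, True, True], [False, True, False]), ([True], [True])]"
abbreviation (input) "shrink \<equiv> replace_prefix [([False], [False, False]), ([True, False], [False, True]),
  ([True, True], [True])]"

lemma replace_prefix_in_V_maps:
  assumes "distinct (map fst R)" "distinct (map snd R)"
    and "complete_prefix_code (set (map fst R))" "complete_prefix_code (set (map snd R))"
  shows "replace_prefix R \<in> V_maps"
proof -
  let ?\<beta> = "\<lambda>u. the (map_of R u)"
  have \<beta>: "?\<beta> u = v" if "(u, v) \<in> set R" for u v
    using that assms(1) by simp
  have "bij_betw ?\<beta> (set (map fst R)) (set (map snd R))"
  proof (rule bij_betw_imageI)
    have "v = v' \<Longrightarrow> u = u'" if "(u, v) \<in> set R" "(u', v') \<in> set R" for u v u' v'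
      using that assms(2) by (metis (no_types, lifting) distinct_map inj_on_def snd_conv prod.inject)
    then show "inj_on ?\<beta> (set (map fst R))" using \<beta> by (fastforce simp: inj_on_def)
    show "?\<beta> ` set (map fst R) = set (map snd R)" using \<beta> by (force simp: image_iff)
  qed
  moreover have "replace_prefix R (u @- w) = ?\<beta> u @- w" if "u \<in> set (map fst R)" for u w
  proof -
    have "replace_prefix R' (u @- w) = the (map_of R' u) @- w" if "u \<in> set (map fst R')" "set R' \<subseteq> set R" for R'
      using that
    proof (induction R')
      case (Cons r R')
      obtain a b where r: "r = (a, b)" by fastforce
      show ?case
      proof (cases "u = a")
        case True
        then show ?thesis by (simp add: r stake_shift sdrop_shift)
      next
        case False
        have "stake (length a) (u @- w) \<noteq> a"
        proof
          assume "stake (length a) (u @- w) = a"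
          then have "a @- sdrop (length a) (u @- w) = u @- w" by (metis stake_sdrop)
          moreover have "a \<in> set (map fst R)" "u \<in> set (map fst R)"
            using Cons.prems by (force simp: r)+
          ultimately show False using prefix_code_eq[OF assms(3)] False by blast
        qed
        then show ?thesis using Cons False by (simp add: r)
      qed
    qed simp
    then show ?thesis using that by blast
  qed
  ultimately show ?thesis unfolding V_maps_def using assms(3,4) by blast
qed

lemma stream_cases_3:
  obtains a b c s where "p = a ## b ## c ## s"
  by (metis stream.collapse)

text \<open>The code words below have at most three letters, so completeness becomes a finite check
  on the first three letters of a stream.\<close>

lemma complete_prefix_codeI:
  assumes "\<And>u v. u \<in> C \<Longrightarrow> v \<in> C \<Longrightarrow> prefix u v \<Longrightarrow> u = v"
    and "\<And>a b c s. \<exists>u\<in>C. stake (length u) (a ## b ## c ## s) = u"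
  shows "complete_prefix_code C"
  unfolding complete_prefix_code_def
proof (intro conjI ballI allI impI)
  fix p :: "bool stream"
  obtain a b c s where "p = a ## b ## c ## s" by (rule stream_cases_3)
  then obtain u where "u \<in> C" "stake (length u) p = u" using assms(2) by blast
  then show "\<exists>u\<in>C. \<exists>p'. p = u @- p'" by (metis stake_sdrop)
qed (rule assms(1))

lemma complete_prefix_codes:
  "complete_prefix_code {[False], [True]}"
  "complete_prefix_code {[False, False], [False, True, False], [False, True, True], [True]}"
  "complete_prefix_code {[False], [True, False], [True, True]}"
  "complete_prefix_code {[False, False], [False, True], [True]}"
  by (rule complete_prefix_codeI; auto)+

theorem word_problem_hard_Thompson_V:
  assumes gen: "generating_map Thompson_V S \<sigma>" and code: "block_code code (letters S)"
  shows "ALOGTIME_hard (encode_language code (word_problem Thompson_V S \<sigma>))"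
proof -
  interpret transformations Thompson_V
    unfolding Thompson_V_eq by (rule transformations_generated[OF gen[unfolded Thompson_V_eq] V_maps_inverse])
  have car: "carrier Thompson_V = V_maps" by (simp add: Thompson_V_eq transformation_group_def)
  define I :: "bool stream set" where "I = {p. \<not> shd p}"
  define J :: "bool stream set" where "J = {p. \<not> shd p \<and> \<not> shd (stl p)}"
  have cl: "swap_0_1 \<in> carrier Thompson_V" "swap_00_010 \<in> carrier Thompson_V"
      "swap_010_011 \<in> carrier Thompson_V" "shrink \<in> carrier Thompson_V"
    unfolding car using complete_prefix_codes
    by (auto intro!: replace_prefix_in_V_maps simp: insert_commute)
  show ?thesis
  proof (rule word_problem_hard_contraction[of swap_0_1 swap_00_010 swap_010_011 shrink I J,
        OF cl _ _ _ _ _ _ _ gen code])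
    fix p assume "p \<notin> I"
    then obtain w where "p = True ## w" unfolding I_def by (metis mem_Collect_eq stream.collapse)
    then show "swap_00_010 p = p" "swap_010_011 p = p" by simp_all
  next
    fix p assume "p \<in> I"
    then obtain w where "p = False ## w" unfolding I_def by (metis mem_Collect_eq stream.collapse)
    then show "swap_0_1 p \<notin> I" "shrink p \<in> J" by (simp_all add: I_def J_def)
  next
    show "J \<subseteq> I" by (auto simp: I_def J_def)
    have "False ## p \<in> I" for p by (simp add: I_def)
    then show "I \<noteq> {}" by blast
  next
    fix p assume "p \<in> J"
    moreover obtain a b w where "p = a ## b ## w" by (metis stream.collapse)
    ultimately have p: "p = False ## False ## w" by (simp add: J_def)
    \<comment> \<open>The commutator takes the prefix 00 through 010, 011 and again 011 to 010,
      which is in \<open>I\<close> but outside \<open>J\<close>.\<close>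
    have 1: "(inv\<^bsub>Thompson_V\<^esub> swap_00_010) p = False ## True ## False ## w"
      by (rule inv_eqI[OF cl(2)]) (simp add: p)
    have 2: "(inv\<^bsub>Thompson_V\<^esub> swap_010_011) (False ## True ## False ## w) = False ## True ## True ## w"
      by (rule inv_eqI[OF cl(3)]) simp
    show "swap_010_011 (swap_00_010 ((inv\<^bsub>Thompson_V\<^esub> swap_010_011) ((inv\<^bsub>Thompson_V\<^esub> swap_00_010) p))) \<notin> J"
      unfolding 1 2 by (simp add: J_def)
  qed
qed

theorem corollaryA:
  fixes S :: "'s set" and code :: "'s letter \<Rightarrow> bool list"
  assumes "block_code code (letters S)"
  shows
    "(\<forall>\<sigma>. generating_map Thompson_F S \<sigma> \<longrightarrow>
        ALOGTIME_hard (encode_language code (word_problem Thompson_F S \<sigma>))) \<and>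
     (\<forall>\<sigma>. generating_map Thompson_T S \<sigma> \<longrightarrow>
        ALOGTIME_hard (encode_language code (word_problem Thompson_T S \<sigma>))) \<and>
     (\<forall>\<sigma>. generating_map Thompson_V S \<sigma> \<longrightarrow>
        ALOGTIME_hard (encode_language code (word_problem Thompson_V S \<sigma>))) \<and>
     (\<forall>(G :: ('x::finite list \<Rightarrow> 'x list) set) \<sigma>.
        weakly_branched G \<and>
        finitely_generated (tree_aut\<lparr>carrier := G\<rparr>) \<and>
        (\<exists>K. branching_subgroup G K \<and> finitely_generated (tree_aut\<lparr>carrier := K\<rparr>)) \<and>
        generating_map (tree_aut\<lparr>carrier := G\<rparr>) S \<sigma> \<longrightarrow>
        ALOGTIME_hard (encode_language code (word_problem (tree_aut\<lparr>carrier := G\<rparr>) S \<sigma>)))"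
proof (intro conjI allI impI)
  show "ALOGTIME_hard (encode_language code (word_problem Thompson_F S \<sigma>))"
    if "generating_map Thompson_F S \<sigma>" for \<sigma>
    using that assms by (rule word_problem_hard_Thompson_F)
  show "ALOGTIME_hard (encode_language code (word_problem Thompson_T S \<sigma>))"
    if "generating_map Thompson_T S \<sigma>" for \<sigma>
    using that assms by (rule word_problem_hard_Thompson_T)
  show "ALOGTIME_hard (encode_language code (word_problem Thompson_V S \<sigma>))"
    if "generating_map Thompson_V S \<sigma>" for \<sigma>
    using that assms by (rule word_problem_hard_Thompson_V)
  fix G :: "('x list \<Rightarrow> 'x list) set" and \<sigma>
  assume G: "weakly_branched G \<and> finitely_generated (tree_aut\<lparr>carrier := G\<rparr>) \<and>
    (\<exists>K. branching_subgroup G K \<and> finitely_generated (tree_aut\<lparr>carrier := K\<rparr>)) \<and>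
    generating_map (tree_aut\<lparr>carrier := G\<rparr>) S \<sigma>"
  then obtain K where "branching_subgroup G K" "finitely_generated (tree_aut\<lparr>carrier := K\<rparr>)" by blast
  moreover have "self_similar G" using G by (simp add: weakly_branched_def)
  ultimately show "ALOGTIME_hard (encode_language code (word_problem (tree_aut\<lparr>carrier := G\<rparr>) S \<sigma>))"
    using G assms by (intro word_problem_hard_weakly_branched) blast+
qed

end
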